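(* (1) The group of units of a fundamental Tarski inverse monoid $S$, acting on $\mathsf{X}(E(S))$ by the natural action, is a Cantor group; and each Cantor group occurs (up to isomorphism of Cantor groups) as the group of units, with its natural action, of some fundamental Tarski inverse monoid. (2) The group of units of a $0$-simplifying fundamental Tarski inverse monoid, with its natural action, is a minimal Cantor group; and each minimal Cantor group occurs (up to isomorphism of Cantor groups) as the group of units, with its natural action, of a $0$-simplifying fundamental Tarski inverse monoid, which is unique up to isomorphism.
   Context: Inverse monoids. An inverse semigroup is a semigroup $S$ in which each $s$ has a unique $s^{-1}$ with $s=ss^{-1}s$, $s^{-1}=s^{-1}ss^{-1}$. All inverse monoids have a zero $0$. $E(S)$ is the set of idempotents (they commute), ordered by $e\le f\iff e=ef$. The natural partial order is $s\le t\iff s=ts^{-1}s$; meets $\wedge$ and joins $\vee$ are taken with respect to it. $a,b$ are compatible if $ab^{-1}$ and $a^{-1}b$ are idempotents. $S$ is distributive if every compatible pair has a join and multiplication distributes over all binary joins that exist. A Boolean inverse monoid is a distributive inverse monoid whose idempotents form a Boolean algebra; it is a Boolean inverse $\wedge$-monoid if in addition every pair of elements has a meet. A Tarski inverse monoid is a countable Boolean inverse $\wedge$-monoid $S$ such that $E(S)$ is the countable atomless Boolean algebra. An ideal $I\subseteq S$ (closed under left and right multiplication by $S$) is a $\vee$-ideal if $a\vee b\in I$ for all compatible $a,b\in I$; $S$ is $0$-simplifying if its only $\vee$-ideals are $\{0\}$ and $S$. $S$ is fundamental if every element commuting with all idempotents is an idempotent. A unit is an invertible element; $\mathsf{U}(S)$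 is the group of units. Natural action. $\mathsf{X}(E(S))$ is the Stone space of the Boolean algebra $E(S)$ (ultrafilters $F\subseteq E(S)$, basis $U_e=\{F: e\in F\}$); for a Tarski inverse monoid it is homeomorphic to the Cantor space. $\mathsf{U}(S)$ acts on it by homeomorphisms $F\mapsto gFg^{-1}$; this is the natural action, and it identifies $\mathsf{U}(S)$ with its image in $\mathrm{Homeo}(\mathsf{X}(E(S)))$ when it is faithful (saying that $\mathsf{U}(S)$ is a Cantor group includes faithfulness). Stone and Cantor groups. A Stone space is a compact Hausdorff space with a basis of clopen sets. For $\alpha\in\mathrm{Homeo}(\mathscr{S})$, $\mathrm{supp}(\alpha)$ is the closure of $\{x:\alpha(x)\ne x\}$. A Stone group is a subgroup $G\le \mathrm{Homeo}(\mathscr{S})$, $\mathscr S$ a Stone space, such that: (i) $\mathrm{supp}(\alpha)$ is clopen for each $\alpha\in G$; (ii) (fullness) if $\{e_1,\dots,e_n\}$ is a finite partition of $\mathscr S$ by clopen sets and $g_1,\dots,g_n\in G$ are such that $\{g_1e_1,\dots,g_ne_n\}$ is also a partition of $\mathscr S$ by clopen sets, then the union of the partial bijections $g_1|e_1,\dots,g_n|e_n$ is an element of $G$. A Cantor group is a countable Stone group whose Stone space is the Cantor space. Two Cantor groups $G\le\mathrm{Homeo}(X)$, $G'\le\mathrm{Homeo}(X')$ are isomorphic if there is a homeomorphism $\theta:X\to X'$ with $\theta G\theta^{-1}=G'$. A Cantor group is minimal if every orbit on the Cantor space is dense. *)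

theory Defs
  imports
    "HOL-Analysis.Analysis"
    "HOL-Algebra.Group_Action"
    "HOL-Algebra.Lattice"
begin

section \<open>Inverse monoids with zero\<close>

definition zero_of :: "('a, 'm) monoid_scheme \<Rightarrow> 'a" where
  "zero_of S = (THE z. z \<in> carrier S \<and>
     (\<forall>s\<in>carrier S. z \<otimes>\<^bsub>S\<^esub> s = z \<and> s \<otimes>\<^bsub>S\<^esub> z = z))"

locale inverse_monoid = monoid S for S (structure) +
  assumes unique_inverse:
    "s \<in> carrier S \<Longrightarrow> \<exists>!t. t \<in> carrier S \<and> s = s \<otimes> t \<otimes> s \<and> t = t \<otimes> s \<otimes> t"
  and zero_exists:
    "\<exists>z\<in>carrier S. \<forall>s\<in>carrier S. z \<otimes> s = z \<and> s \<otimes> z = z"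

text \<open>The inverse in the sense of inverse semigroups, as opposed to \<^const>\<open>m_inv\<close>, which is
  meaningful for units only (where the two agree).\<close>

definition star :: "('a, 'm) monoid_scheme \<Rightarrow> 'a \<Rightarrow> 'a" where
  "star S s = (THE t. t \<in> carrier S \<and> s = s \<otimes>\<^bsub>S\<^esub> t \<otimes>\<^bsub>S\<^esub> s \<and> t = t \<otimes>\<^bsub>S\<^esub> s \<otimes>\<^bsub>S\<^esub> t)"

definition idempotents :: "('a, 'm) monoid_scheme \<Rightarrow> 'a set" where
  "idempotents S = {e \<in> carrier S. e \<otimes>\<^bsub>S\<^esub> e = e}"

definition idem_poset :: "('a, 'm) monoid_scheme \<Rightarrow> 'a gorder" where
  "idem_poset S = \<lparr>carrier = idempotents S, eq = (=), le = (\<lambda>e f. e = e \<otimes>\<^bsub>S\<^esub> f)\<rparr>"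

definition natural_poset :: "('a, 'm) monoid_scheme \<Rightarrow> 'a gorder" where
  "natural_poset S =
     \<lparr>carrier = carrier S, eq = (=), le = (\<lambda>s t. s = t \<otimes>\<^bsub>S\<^esub> star S s \<otimes>\<^bsub>S\<^esub> s)\<rparr>"

definition is_join :: "('a, 'm) monoid_scheme \<Rightarrow> 'a \<Rightarrow> 'a \<Rightarrow> 'a \<Rightarrow> bool" where
  "is_join S a b c \<longleftrightarrow> least (natural_poset S) c (Upper (natural_poset S) {a, b})"

definition is_meet :: "('a, 'm) monoid_scheme \<Rightarrow> 'a \<Rightarrow> 'a \<Rightarrow> 'a \<Rightarrow> bool" where
  "is_meet S a b c \<longleftrightarrow> greatest (natural_poset S) c (Lower (natural_poset S) {a, b})"

definition compatible :: "('a, 'm) monoid_scheme \<Rightarrow> 'a \<Rightarrow> 'a \<Rightarrow> bool" where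
  "compatible S a b \<longleftrightarrow>
     a \<otimes>\<^bsub>S\<^esub> star S b \<in> idempotents S \<and> star S a \<otimes>\<^bsub>S\<^esub> b \<in> idempotents S"

section \<open>Boolean and Tarski inverse monoids\<close>

locale boolean_lattice = Lattice.bounded_lattice L for L (structure) +
  assumes distrib:
    "\<lbrakk>x \<in> carrier L; y \<in> carrier L; z \<in> carrier L\<rbrakk>
       \<Longrightarrow> x \<sqinter> (y \<squnion> z) = (x \<sqinter> y) \<squnion> (x \<sqinter> z)"
  and complemented:
    "x \<in> carrier L \<Longrightarrow> \<exists>y\<in>carrier L. x \<sqinter> y = \<bottom> \<and> x \<squnion> y = \<top>"

text \<open>The countable atomless Boolean algebra is nondegenerate by convention; it is then unique
  up to isomorphism.\<close>

locale countable_atomless_boolean_lattice = boolean_lattice L for L (structure) +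
  assumes countable_carrier: "countable (carrier L)"
  and nondegenerate: "\<bottom> \<noteq> \<top>"
  and atomless:
    "\<lbrakk>x \<in> carrier L; x \<noteq> \<bottom>\<rbrakk> \<Longrightarrow> \<exists>y\<in>carrier L. y \<noteq> \<bottom> \<and> y \<sqsubset> x"

locale distributive_inverse_monoid = inverse_monoid S for S (structure) +
  assumes compatible_join:
    "\<lbrakk>a \<in> carrier S; b \<in> carrier S; compatible S a b\<rbrakk> \<Longrightarrow> \<exists>c. is_join S a b c"
  and mult_join_left:
    "\<lbrakk>s \<in> carrier S; a \<in> carrier S; b \<in> carrier S; is_join S a b c\<rbrakk>
       \<Longrightarrow> is_join S (s \<otimes> a) (s \<otimes> b) (s \<otimes> c)"
  and mult_join_right:
    "\<lbrakk>s \<in> carrier S; a \<in> carrier S; b \<in> carrier S; is_join S a b c\<rbrakk>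
       \<Longrightarrow> is_join S (a \<otimes> s) (b \<otimes> s) (c \<otimes> s)"

locale boolean_inverse_monoid = distributive_inverse_monoid S for S (structure) +
  assumes boolean_idempotents: "boolean_lattice (idem_poset S)"

locale boolean_inverse_meet_monoid = boolean_inverse_monoid S for S (structure) +
  assumes binary_meets: "\<lbrakk>a \<in> carrier S; b \<in> carrier S\<rbrakk> \<Longrightarrow> \<exists>c. is_meet S a b c"

locale tarski_inverse_monoid = boolean_inverse_meet_monoid S for S (structure) +
  assumes countable_monoid: "countable (carrier S)"
  and atomless_idempotents: "countable_atomless_boolean_lattice (idem_poset S)"

definition fundamental :: "('a, 'm) monoid_scheme \<Rightarrow> bool" where
  "fundamental S \<longleftrightarrow>
     (\<forall>s\<in>carrier S. (\<forall>e\<in>idempotents S. s \<otimes>\<^bsub>S\<^esub> e = e \<otimes>\<^bsub>S\<^esub> s) \<longrightarrow> s \<in> idempotents S)"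

definition vee_ideal :: "('a, 'm) monoid_scheme \<Rightarrow> 'a set \<Rightarrow> bool" where
  "vee_ideal S I \<longleftrightarrow>
     I \<noteq> {} \<and> I \<subseteq> carrier S \<and>
     (\<forall>a\<in>I. \<forall>s\<in>carrier S. s \<otimes>\<^bsub>S\<^esub> a \<in> I \<and> a \<otimes>\<^bsub>S\<^esub> s \<in> I) \<and>
     (\<forall>a\<in>I. \<forall>b\<in>I. \<forall>c. compatible S a b \<and> is_join S a b c \<longrightarrow> c \<in> I)"

definition zero_simplifying :: "('a, 'm) monoid_scheme \<Rightarrow> bool" where
  "zero_simplifying S \<longleftrightarrow> (\<forall>I. vee_ideal S I \<longrightarrow> I = {zero_of S} \<or> I = carrier S)"

section \<open>The Stone space and the natural action\<close>

definition proper_filter :: "('a, 'm) gorder_scheme \<Rightarrow> 'a set \<Rightarrow> bool" where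
  "proper_filter L F \<longleftrightarrow>
     F \<subseteq> carrier L \<and> F \<noteq> {} \<and> \<bottom>\<^bsub>L\<^esub> \<notin> F \<and>
     (\<forall>x\<in>F. \<forall>y\<in>carrier L. x \<sqsubseteq>\<^bsub>L\<^esub> y \<longrightarrow> y \<in> F) \<and>
     (\<forall>x\<in>F. \<forall>y\<in>F. x \<sqinter>\<^bsub>L\<^esub> y \<in> F)"

definition ultrafilters :: "('a, 'm) gorder_scheme \<Rightarrow> 'a set set" where
  "ultrafilters L =
     {F. proper_filter L F \<and> (\<forall>F'. proper_filter L F' \<and> F \<subseteq> F' \<longrightarrow> F' = F)}"

definition stone_space :: "('a, 'm) gorder_scheme \<Rightarrow> 'a set topology" where
  "stone_space L = topology_generated_by ((\<lambda>e. {F \<in> ultrafilters L. e \<in> F}) ` carrier L)"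

definition natural_action :: "('a, 'm) monoid_scheme \<Rightarrow> 'a \<Rightarrow> 'a set \<Rightarrow> 'a set" where
  "natural_action S g =
     (\<lambda>F\<in>ultrafilters (idem_poset S). (\<lambda>e. g \<otimes>\<^bsub>S\<^esub> e \<otimes>\<^bsub>S\<^esub> inv\<^bsub>S\<^esub> g) ` F)"

definition unit_homeos :: "('a, 'm) monoid_scheme \<Rightarrow> ('a set \<Rightarrow> 'a set) set" where
  "unit_homeos S = natural_action S ` Units S"

section \<open>Stone groups and Cantor groups\<close>

text \<open>As in \<^const>\<open>BijGroup\<close>, self-maps of a space are represented by functions that are
  \<^const>\<open>undefined\<close> outside the underlying set, so that equal homeomorphisms are equal functions.\<close>

definition homeo_group :: "'a topology \<Rightarrow> ('a \<Rightarrow> 'a) monoid" where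
  "homeo_group X =
     (BijGroup (topspace X))\<lparr>carrier := {f \<in> Bij (topspace X). homeomorphic_map X X f}\<rparr>"

definition clopenin :: "'a topology \<Rightarrow> 'a set \<Rightarrow> bool" where
  "clopenin X U \<longleftrightarrow> openin X U \<and> closedin X U"

definition is_stone_space :: "'a topology \<Rightarrow> bool" where
  "is_stone_space X \<longleftrightarrow>
     compact_space X \<and> Hausdorff_space X \<and> arbitrary union_of (clopenin X) = openin X"

definition is_cantor_space :: "'a topology \<Rightarrow> bool" where
  "is_cantor_space X \<longleftrightarrow>
     X homeomorphic_space
       product_topology (\<lambda>_::nat. discrete_topology (UNIV :: bool set)) UNIV"

definition homeo_support :: "'a topology \<Rightarrow> ('a \<Rightarrow> 'a) \<Rightarrow> 'a set" where
  "homeo_support X f = X closure_of {x \<in> topspace X. f x \<noteq> x}"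

text \<open>Partitions are indexed families, so that \<open>e i = e j\<close> is excluded for \<open>i \<noteq> j\<close>; a family of
  images that coincide as sets must not count as a partition, since the union of the restricted
  bijections would not be injective.\<close>

definition clopen_partition :: "'a topology \<Rightarrow> nat \<Rightarrow> (nat \<Rightarrow> 'a set) \<Rightarrow> bool" where
  "clopen_partition X n e \<longleftrightarrow>
     (\<forall>i<n. clopenin X (e i) \<and> e i \<noteq> {}) \<and> disjoint_family_on e {..<n} \<and>
     (\<Union>i<n. e i) = topspace X"

locale stone_group =
  fixes X :: "'a topology" and G :: "('a \<Rightarrow> 'a) set"
  assumes stone: "is_stone_space X"
  and subgroup_homeo: "subgroup G (homeo_group X)"
  and support_clopen: "f \<in> G \<Longrightarrow> clopenin X (homeo_support X f)"
  and full:
    "\<lbrakk>clopen_partition X n e; \<And>i. i < n \<Longrightarrow> g i \<in> G;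
      clopen_partition X n (\<lambda>i. g i ` e i);
      h \<in> extensional (topspace X); \<And>i x. i < n \<Longrightarrow> x \<in> e i \<Longrightarrow> h x = g i x\<rbrakk>
       \<Longrightarrow> h \<in> G"

locale cantor_group = stone_group X G for X :: "'a topology" and G +
  assumes cantor: "is_cantor_space X"
  and countable_group: "countable G"

locale minimal_cantor_group = cantor_group X G for X :: "'a topology" and G +
  assumes dense_orbits: "x \<in> topspace X \<Longrightarrow> X closure_of {g x | g. g \<in> G} = topspace X"

definition conjugate :: "'a topology \<Rightarrow> 'b topology \<Rightarrow> ('a \<Rightarrow> 'b) \<Rightarrow> ('a \<Rightarrow> 'a) \<Rightarrow> 'b \<Rightarrow> 'b" where
  "conjugate X Y \<theta> g = (\<lambda>y\<in>topspace Y. \<theta> (g (inv_into (topspace X) \<theta> y)))"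

definition cantor_group_iso ::
    "'a topology \<Rightarrow> ('a \<Rightarrow> 'a) set \<Rightarrow> 'b topology \<Rightarrow> ('b \<Rightarrow> 'b) set \<Rightarrow> bool" where
  "cantor_group_iso X G Y H \<longleftrightarrow>
     (\<exists>\<theta>. homeomorphic_map X Y \<theta> \<and> conjugate X Y \<theta> ` G = H)"

text \<open>Faithfulness is what identifies the abstract group of units with \<^const>\<open>unit_homeos\<close>.\<close>

abbreviation naturally_faithful :: "('a, 'm) monoid_scheme \<Rightarrow> bool" where
  "naturally_faithful S \<equiv>
     faithful_action (units_of S) (ultrafilters (idem_poset S)) (natural_action S)"

definition occurs_as_units ::
    "'b topology \<Rightarrow> ('b \<Rightarrow> 'b) set \<Rightarrow> ('a, 'm) monoid_scheme \<Rightarrow> bool" where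
  "occurs_as_units X G S \<longleftrightarrow>
     naturally_faithful S \<and> cantor_group_iso X G (stone_space (idem_poset S)) (unit_homeos S)"

end

theory Submission
  imports Defs
begin

text \<open>
  Every fundamental Boolean inverse \<open>\<and>\<close>-monoid is concrete. Let \<open>s\<close> act on the ultrafilters \<open>F\<close> of
  idempotents with \<open>s\<^sup>\<star>s \<in> F\<close> by \<open>F \<mapsto> {e. s\<^sup>\<star>es \<in> F}\<close>. By Stone duality this turns idempotents into
  identities of clopen sets and elements into partial homeomorphisms between clopen sets; compatible
  joins become unions, since ultrafilters are prime, and the action is faithful exactly because the
  monoid is fundamental (\<open>stone_rep_inject\<close>). So the objects of the theorem can be replaced by
  sets \<open>M\<close> of partial bijections of a Stone space \<open>X\<close> (locale \<open>pseudogroup\<close>), with a monoid \<open>S\<close> attached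
  to \<open>M\<close> by the locale \<open>pseudogroup_model\<close>. The units of \<open>S\<close> are then the total elements of \<open>M\<close>, and
  the natural action is their action on points.

  For the first half of the theorem, the total elements of a pseudogroup form a full group of
  homeomorphisms, and the existence of a meet of \<open>g\<close> and \<open>1\<close> makes the support of \<open>g\<close> clopen
  (\<open>cantor_group_full_maps\<close>). Conversely, a Cantor group \<open>G\<close> generates the pseudogroup of all partial
  bijections between clopen sets that agree locally with elements of \<open>G\<close>
  (\<open>pseudogroup_generated\<close>). By compactness its elements are finite unions of restrictions of
  elements of \<open>G\<close>, so there are only countably many of them, and fullness of \<open>G\<close> says that its total
  elements are the elements of \<open>G\<close> and no others (\<open>full_maps_generated\<close>). That all the spaces involved
  are Cantor spaces follows from the characterization of the Cantor space by its clopen sets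
  (\<open>is_cantor_space_iff\<close>).

  For the second half, the elements defined only at points whose orbit under \<open>M\<close> meets a clopen set
  \<open>U\<close> form a \<open>\<or>\<close>-ideal, so \<open>0\<close>-simplifying means that all orbits under \<open>M\<close> are dense. An element that
  moves a point \<open>x\<close> agrees near \<open>x\<close> with a total involution (\<open>moving_element_extends\<close>). Hence the
  orbits under the total elements are dense as well. An element that fixes \<open>x\<close> factors near \<open>x\<close> into
  two elements that move their points, because the orbit of \<open>x\<close> contains a second point. Thus \<open>M\<close> is
  generated by its total elements (\<open>generated_full_maps\<close>). This gives uniqueness: a homeomorphism
  that conjugates the groups of units conjugates the generated pseudogroups.
\<close>

section \<open>Clopen sets and the Cantor space\<close>

lemma clopenin_Int: "clopenin X U \<Longrightarrow> clopenin X V \<Longrightarrow> clopenin X (U \<inter> V)"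
  and clopenin_Un: "clopenin X U \<Longrightarrow> clopenin X V \<Longrightarrow> clopenin X (U \<union> V)"
  and clopenin_Diff: "clopenin X U \<Longrightarrow> clopenin X V \<Longrightarrow> clopenin X (U - V)"
  and clopenin_empty: "clopenin X {}"
  and clopenin_topspace: "clopenin X (topspace X)"
  by (auto simp: clopenin_def openin_diff closedin_diff)

lemma clopenin_subset: "clopenin X U \<Longrightarrow> U \<subseteq> topspace X"
  by (simp add: clopenin_def openin_subset)

lemma clopenin_Union: "finite A \<Longrightarrow> (\<And>U. U \<in> A \<Longrightarrow> clopenin X U) \<Longrightarrow> clopenin X (\<Union>A)"
  by (auto simp: clopenin_def intro!: closedin_Union)

lemma stone_space_clopen_base:
  assumes "is_stone_space X" "openin X W" "x \<in> W"
  obtains U where "clopenin X U" "x \<in> U" "U \<subseteq> W"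
  using assms openin_topology_base_unique[of X "clopenin X"] unfolding is_stone_space_def by metis

lemma is_stone_spaceI:
  assumes "compact_space X" "Hausdorff_space X"
    and "\<And>W x. openin X W \<Longrightarrow> x \<in> W \<Longrightarrow> \<exists>U. clopenin X U \<and> x \<in> U \<and> U \<subseteq> W"
  shows "is_stone_space X"
proof -
  have "openin X = arbitrary union_of (clopenin X)"
    using assms(3) by (auto simp: openin_topology_base_unique clopenin_def)
  then show ?thesis using assms by (simp add: is_stone_space_def)
qed

lemma stone_space_separate:
  assumes "is_stone_space X" "x \<in> topspace X" "y \<in> topspace X" "x \<noteq> y"
  obtains U where "clopenin X U" "x \<in> U" "y \<notin> U"
proof -
  obtain W where "openin X W" "x \<in> W" "y \<notin> W"
    using assms unfolding is_stone_space_def Hausdorff_space_def disjnt_def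
    by (metis IntI empty_iff)
  then show thesis using stone_space_clopen_base[OF assms(1)] that by blast
qed

lemma continuous_map_of_clopen_preimages:
  assumes "is_stone_space Y" "\<And>x. x \<in> topspace X \<Longrightarrow> f x \<in> topspace Y"
    and "\<And>V. clopenin Y V \<Longrightarrow> openin X {x \<in> topspace X. f x \<in> V}"
  shows "continuous_map X Y f"
  unfolding continuous_map_def
proof (intro conjI allI impI)
  show "f \<in> topspace X \<rightarrow> topspace Y" using assms(2) by auto
  fix W assume W: "openin Y W"
  show "openin X {x \<in> topspace X. f x \<in> W}"
  proof (subst openin_subopen, intro ballI)
    fix x assume "x \<in> {x \<in> topspace X. f x \<in> W}"
    then have x: "x \<in> topspace X" "f x \<in> W" by auto
    obtain V where V: "clopenin Y V" "f x \<in> V" "V \<subseteq> W"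
      using stone_space_clopen_base[OF assms(1) W x(2)] by blast
    show "\<exists>T. openin X T \<and> x \<in> T \<and> T \<subseteq> {x \<in> topspace X. f x \<in> W}"
      using assms(3)[OF V(1)] x V by (intro exI[of _ "{x \<in> topspace X. f x \<in> V}"]) auto
  qed
qed

text \<open>Compactness turns a property that holds near every point into one that holds on each piece of
  a finite clopen partition, provided that clopen subsets inherit it: a finite subcover is made
  disjoint by removing from each member the earlier ones, and empty pieces are dropped.\<close>

lemma clopen_partition_of_local:
  assumes "compact_space X"
    and loc: "\<And>x. x \<in> topspace X \<Longrightarrow> \<exists>U. clopenin X U \<and> x \<in> U \<and> P U"
    and her: "\<And>U V. P U \<Longrightarrow> clopenin X V \<Longrightarrow> V \<subseteq> U \<Longrightarrow> P V"
  shows "\<exists>n e. clopen_partition X n e \<and> (\<forall>i<n. P (e i))"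
proof -
  let ?\<U> = "{U. clopenin X U \<and> P U}"
  have op: "openin X U" if "U \<in> ?\<U>" for U using that by (simp add: clopenin_def)
  have cov: "topspace X \<subseteq> \<Union>?\<U>"
  proof
    fix x assume "x \<in> topspace X"
    from loc[OF this] obtain U where "clopenin X U" "x \<in> U" "P U" by blast
    then show "x \<in> \<Union>?\<U>" by blast
  qed
  have "\<exists>\<F>. finite \<F> \<and> \<F> \<subseteq> ?\<U> \<and> topspace X \<subseteq> \<Union>\<F>"
    by (rule compactinD[OF assms(1)[unfolded compact_space_def] op cov])
  then obtain \<F> where \<F>: "finite \<F>" "\<F> \<subseteq> ?\<U>" "topspace X \<subseteq> \<Union>\<F>" by blast
  obtain m :: nat and u where u: "\<F> = u ` {i. i < m}"
    using \<F>(1) unfolding finite_conv_nat_seg_image by blast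
  define D where "D i = u i - (\<Union>j<i. u j)" for i
  have uc: "clopenin X (u i)" "P (u i)" if "i < m" for i using \<F> u that by auto
  have Dc: "clopenin X (D i)" if "i < m" for i
    unfolding D_def using that uc by (intro clopenin_Diff clopenin_Union) auto
  have DP: "P (D i)" if "i < m" for i
    using her[OF uc(2)[OF that] Dc[OF that]] by (simp add: D_def)
  have DU: "(\<Union>i<m. D i) = topspace X"
  proof
    show "(\<Union>i<m. D i) \<subseteq> topspace X" using Dc clopenin_subset by blast
    show "topspace X \<subseteq> (\<Union>i<m. D i)"
    proof
      fix x assume "x \<in> topspace X"
      then have ex: "\<exists>i. i < m \<and> x \<in> u i" using \<F>(3) u by auto
      define k where "k = (LEAST i. i < m \<and> x \<in> u i)"
      have k: "k < m \<and> x \<in> u k" unfolding k_def by (rule LeastI_ex[OF ex])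
      have "\<not> (j < m \<and> x \<in> u j)" if "j < k" for j using that not_less_Least unfolding k_def by blast
      then have "x \<in> D k" using k by (auto simp: D_def)
      then show "x \<in> (\<Union>i<m. D i)" using k by auto
    qed
  qed
  have Dd: "D i \<inter> D j = {}" if "i < j" for i j using that by (auto simp: D_def)
  then have Dd': "D i \<inter> D j = {}" if "i \<noteq> j" for i j using that by (metis inf_commute nat_neq_iff)
  let ?K = "{i. i < m \<and> D i \<noteq> {}}"
  have "finite ?K" by auto
  then obtain h where h: "bij_betw h {..<card ?K} ?K"
    using ex_bij_betw_nat_finite[of ?K] by (auto simp: atLeast0LessThan)
  have hK: "h i \<in> ?K" if "i < card ?K" for i using h that by (auto simp: bij_betw_def)
  have "clopen_partition X (card ?K) (D \<circ> h)"
    unfolding clopen_partition_def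
  proof (intro conjI allI impI)
    fix i assume "i < card ?K"
    from hK[OF this] show "clopenin X ((D \<circ> h) i)" "(D \<circ> h) i \<noteq> {}" using Dc by auto
  next
    show "disjoint_family_on (D \<circ> h) {..<card ?K}"
      using h Dd' by (auto simp: disjoint_family_on_def bij_betw_def inj_on_def)
    have "(\<Union>i<card ?K. (D \<circ> h) i) = (\<Union>i\<in>h ` {..<card ?K}. D i)" by auto
    also have "\<dots> = (\<Union>i\<in>?K. D i)" using h by (simp add: bij_betw_def)
    also have "\<dots> = (\<Union>i<m. D i)" by blast
    also note DU
    finally show "(\<Union>i<card ?K. (D \<circ> h) i) = topspace X" .
  qed
  then show ?thesis using hK DP by (intro exI[of _ "card ?K"] exI[of _ "D \<circ> h"]) simp
qed

definition cylinder :: "bool list \<Rightarrow> (nat \<Rightarrow> bool) set" where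
  "cylinder w = {f. \<forall>i<length w. f i = w ! i}"

abbreviation cantor_topology :: "(nat \<Rightarrow> bool) topology" where
  "cantor_topology \<equiv> product_topology (\<lambda>_::nat. discrete_topology (UNIV :: bool set)) UNIV"

lemma clopenin_coordinate: "clopenin cantor_topology {f. f i = b}"
proof -
  have "continuous_map cantor_topology (discrete_topology (UNIV :: bool set)) (\<lambda>f. f i)"
    by (rule continuous_map_product_projection) simp
  from openin_continuous_map_preimage[OF this, of "{b}"] closedin_continuous_map_preimage[OF this, of "{b}"]
  show ?thesis by (simp add: clopenin_def)
qed

lemma clopenin_cylinder: "clopenin cantor_topology (cylinder w)"
proof (induction w rule: rev_induct)
  case Nil
  show ?case using clopenin_topspace[of cantor_topology] by (simp add: cylinder_def)
next
  case (snoc b w)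
  have "cylinder (w @ [b]) = cylinder w \<inter> {f. f (length w) = b}"
    by (auto simp: cylinder_def nth_append less_Suc_eq)
  then show ?case using snoc clopenin_Int clopenin_coordinate by metis
qed

lemma cylinder_base:
  assumes "openin cantor_topology W" "f \<in> W"
  obtains n where "cylinder (map f [0..<n]) \<subseteq> W"
proof -
  obtain U where U: "finite {i. U i \<noteq> (UNIV :: bool set)}" "f \<in> (\<Pi>\<^sub>E i\<in>UNIV. U i)" "(\<Pi>\<^sub>E i\<in>UNIV. U i) \<subseteq> W"
    using assms unfolding openin_product_topology_alt by auto
  obtain n where n: "\<forall>i\<in>{i. U i \<noteq> UNIV}. i < n" using U(1) finite_nat_set_iff_bounded by blast
  have "cylinder (map f [0..<n]) \<subseteq> (\<Pi>\<^sub>E i\<in>UNIV. U i)"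
  proof
    fix g assume g: "g \<in> cylinder (map f [0..<n])"
    have "g i \<in> U i" for i
    proof (cases "i < n")
      case True
      then have "g i = f i" using g by (auto simp: cylinder_def)
      then show ?thesis using U(2) by (auto simp: PiE_iff)
    next
      case False
      then show ?thesis using n by auto
    qed
    then show "g \<in> (\<Pi>\<^sub>E i\<in>UNIV. U i)" by auto
  qed
  then show thesis using that U(3) by blast
qed

lemma mem_cylinder_self: "f \<in> cylinder (map f [0..<n])"
  by (simp add: cylinder_def)

lemma is_stone_space_cantor: "is_stone_space cantor_topology"
proof (rule is_stone_spaceI)
  show "compact_space cantor_topology" by (simp add: compact_space_product_topology compact_space_discrete_topology)
  show "Hausdorff_space cantor_topology" by (simp add: Hausdorff_space_product_topology)
  fix W f assume "openin cantor_topology W" "f \<in> W"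
  then show "\<exists>U. clopenin cantor_topology U \<and> f \<in> U \<and> U \<subseteq> W"
    using cylinder_base clopenin_cylinder mem_cylinder_self by metis
qed

lemma countable_clopenin_cantor: "countable {U. clopenin cantor_topology U}"
proof -
  have "{U. clopenin cantor_topology U} \<subseteq> Union ` {\<F>. finite \<F> \<and> \<F> \<subseteq> range cylinder}"
  proof
    fix K assume "K \<in> {U. clopenin cantor_topology U}"
    then have K: "openin cantor_topology K" "closedin cantor_topology K" by (auto simp: clopenin_def)
    have "compactin cantor_topology K"
      using K(2) is_stone_space_cantor closedin_compact_space unfolding is_stone_space_def by blast
    moreover have "K \<subseteq> \<Union>{C \<in> range cylinder. C \<subseteq> K}"
    proof
      fix f assume "f \<in> K"
      then obtain n where "cylinder (map f [0..<n]) \<subseteq> K" using cylinder_base[OF K(1)] by blast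
      then show "f \<in> \<Union>{C \<in> range cylinder. C \<subseteq> K}" using mem_cylinder_self by blast
    qed
    moreover have op: "openin cantor_topology C" if "C \<in> {C \<in> range cylinder. C \<subseteq> K}" for C
      using that clopenin_cylinder unfolding clopenin_def by blast
    ultimately obtain \<F> where "finite \<F>" "\<F> \<subseteq> {C \<in> range cylinder. C \<subseteq> K}" "K \<subseteq> \<Union>\<F>"
      using compactinD[of cantor_topology K "{C \<in> range cylinder. C \<subseteq> K}"] op by meson
    then have "K = \<Union>\<F>" "finite \<F>" "\<F> \<subseteq> range cylinder" by blast+
    then show "K \<in> Union ` {\<F>. finite \<F> \<and> \<F> \<subseteq> range cylinder}" by blast
  qed
  moreover have "countable {\<F>. finite \<F> \<and> \<F> \<subseteq> range cylinder}"
    by (intro countable_Collect_finite_subset) auto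
  ultimately show ?thesis by (meson countable_image countable_subset)
qed

lemma cantor_split:
  assumes "clopenin cantor_topology U" "U \<noteq> {}"
  shows "\<exists>V. clopenin cantor_topology V \<and> V \<noteq> {} \<and> V \<subset> U"
proof -
  obtain f where f: "f \<in> U" using assms by auto
  obtain n where n: "cylinder (map f [0..<n]) \<subseteq> U"
    using cylinder_base f assms(1) unfolding clopenin_def by metis
  have "f \<in> cylinder (map f [0..<Suc n])" by (rule mem_cylinder_self)
  moreover have "cylinder (map f [0..<Suc n]) \<subseteq> cylinder (map f [0..<n])"
    by (auto simp: cylinder_def simp del: upt_Suc)
  moreover have "f(n := \<not> f n) \<in> cylinder (map f [0..<n]) - cylinder (map f [0..<Suc n])"
    by (auto simp: cylinder_def simp del: upt_Suc)
  ultimately show ?thesis using n clopenin_cylinder by blast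
qed

text \<open>A perfect Stone space with countably many clopen sets is a Cantor space: following an
  enumeration of the clopen sets, a binary tree of nonempty clopen sets is grown so that each
  piece of level \<open>n+1\<close> decides the \<open>n\<close>-th clopen set. The choice of an arbitrary proper clopen
  subset keeps both children nonempty where the \<open>n\<close>-th set does not split the piece.\<close>

locale cantor_scheme =
  fixes X :: "'a topology" and c :: "nat \<Rightarrow> 'a set"
  assumes stone: "is_stone_space X"
    and enum: "\<And>U. clopenin X U \<Longrightarrow> U \<in> range c"
    and cl: "\<And>n. clopenin X (c n)"
    and ne: "topspace X \<noteq> {}"
    and perfect: "\<And>U. clopenin X U \<Longrightarrow> U \<noteq> {} \<Longrightarrow> \<exists>V. clopenin X V \<and> V \<noteq> {} \<and> V \<subset> U"
begin

definition left_half :: "'a set \<Rightarrow> 'a set \<Rightarrow> 'a set" where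
  "left_half U C = (if U \<inter> C \<noteq> {} \<and> U - C \<noteq> {} then U \<inter> C
     else (SOME V. clopenin X V \<and> V \<noteq> {} \<and> V \<subset> U))"

lemma left_half:
  assumes "clopenin X U" "U \<noteq> {}" "clopenin X C"
  shows "clopenin X (left_half U C)" "left_half U C \<noteq> {}" "left_half U C \<subset> U"
    "V \<in> {left_half U C, U - left_half U C} \<Longrightarrow> V \<subseteq> C \<or> V \<inter> C = {}"
proof -
  have "clopenin X (left_half U C) \<and> left_half U C \<noteq> {} \<and> left_half U C \<subset> U"
  proof (cases "U \<inter> C \<noteq> {} \<and> U - C \<noteq> {}")
    case True
    then show ?thesis using assms clopenin_Int by (auto simp: left_half_def)
  next
    case False
    then have "left_half U C = (SOME V. clopenin X V \<and> V \<noteq> {} \<and> V \<subset> U)"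
      unfolding left_half_def by (rule if_not_P)
    then show ?thesis using someI_ex[OF perfect[OF assms(1,2)]] by simp
  qed
  then show *: "clopenin X (left_half U C)" "left_half U C \<noteq> {}" "left_half U C \<subset> U" by auto
  show "V \<subseteq> C \<or> V \<inter> C = {}" if "V \<in> {left_half U C, U - left_half U C}"
  proof (cases "U \<inter> C \<noteq> {} \<and> U - C \<noteq> {}")
    case True
    then show ?thesis using that by (auto simp: left_half_def)
  next
    case False
    then show ?thesis using that * by blast
  qed
qed

primrec piece :: "bool list \<Rightarrow> 'a set" where
  "piece [] = topspace X"
| "piece (b # w) = (if b then left_half (piece w) (c (length w))
                    else piece w - left_half (piece w) (c (length w)))"

lemma piece: "clopenin X (piece w) \<and> piece w \<noteq> {}"
proof (induction w)
  case Nil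
  then show ?case using ne clopenin_topspace by simp
next
  case (Cons b w)
  then show ?case
    using left_half(1-3)[of "piece w" "c (length w)", OF _ _ cl] clopenin_Diff[of X "piece w"] by auto
qed

lemma piece_mono: "piece (b # w) \<subseteq> piece w"
  using left_half(3)[of "piece w" "c (length w)", OF _ _ cl] piece[of w] by auto

lemma piece_decides: "piece (b # w) \<subseteq> c (length w) \<or> piece (b # w) \<inter> c (length w) = {}"
  using left_half(4)[of "piece w" "c (length w)" "piece (b # w)", OF _ _ cl] piece[of w] by simp

text \<open>The path of a point through the tree, its latest turn first.\<close>

primrec path :: "'a \<Rightarrow> nat \<Rightarrow> bool list" where
  "path x 0 = []"
| "path x (Suc n) = (x \<in> piece (True # path x n)) # path x n"

definition code :: "'a \<Rightarrow> nat \<Rightarrow> bool" where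
  "code x n = (x \<in> piece (True # path x n))"

lemma length_path [simp]: "length (path x n) = n"
  by (induction n) auto

lemma mem_piece_path: "x \<in> topspace X \<Longrightarrow> x \<in> piece (path x n)"
  by (induction n) auto

lemma path_eq_iff: "x \<in> topspace X \<Longrightarrow> path x (length w) = w \<longleftrightarrow> x \<in> piece w"
proof (induction w)
  case (Cons b w)
  show ?case
  proof
    assume "path x (length (b # w)) = b # w"
    then show "x \<in> piece (b # w)" using mem_piece_path[OF Cons.prems, of "length (b # w)"] by metis
  next
    assume x: "x \<in> piece (b # w)"
    then have "path x (length w) = w" using Cons piece_mono by auto
    then show "path x (length (b # w)) = b # w" using x by (auto split: if_splits)
  qed
qed auto

lemma continuous_code: "continuous_map X cantor_topology code"
  unfolding continuous_map_componentwise_UNIV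
proof
  fix n
  have op: "openin X {x \<in> topspace X. code x n = b}" for b
  proof -
    have code: "{x \<in> topspace X. code x n = b} = (\<Union>w\<in>{w. length w = n}. piece (b # w))"
    proof (intro equalityI subsetI)
      fix x assume "x \<in> {x \<in> topspace X. code x n = b}"
      then have "x \<in> topspace X" "code x n = b" by auto
      then have "path x (Suc n) = b # path x n" by (simp add: code_def)
      then have "x \<in> piece (b # path x n)" using mem_piece_path[OF \<open>x \<in> topspace X\<close>, of "Suc n"] by metis
      then show "x \<in> (\<Union>w\<in>{w. length w = n}. piece (b # w))" using length_path by blast
    next
      fix x assume "x \<in> (\<Union>w\<in>{w. length w = n}. piece (b # w))"
      then obtain w where w: "length w = n" "x \<in> piece (b # w)" by blast
      then have x: "x \<in> topspace X" using piece clopenin_subset by blast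
      then have "path x (Suc n) = b # w" using path_eq_iff[OF x, of "b # w"] w by (simp del: piece.simps path.simps)
      then show "x \<in> {x \<in> topspace X. code x n = b}" using x by (auto simp: code_def)
    qed
    show ?thesis unfolding code using piece by (intro openin_Union) (auto simp: clopenin_def simp del: piece.simps)
  qed
  have "openin X {x \<in> topspace X. code x n \<in> U}" for U
  proof -
    have "{x \<in> topspace X. code x n \<in> U} = (\<Union>b\<in>U. {x \<in> topspace X. code x n = b})" by auto
    then show ?thesis using op by auto
  qed
  then show "continuous_map X (discrete_topology UNIV) (\<lambda>x. code x n)"
    by (auto simp: continuous_map_def)
qed

lemma path_eq_code: "path x n = rev (map (code x) [0..<n])"
  by (induction n) (auto simp: code_def)

lemma inj_code: "inj_on code (topspace X)"
proof (rule inj_onI, rule ccontr)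
  fix x y assume xy: "x \<in> topspace X" "y \<in> topspace X" "code x = code y" "x \<noteq> y"
  obtain U where U: "clopenin X U" "x \<in> U" "y \<notin> U" using stone_space_separate[OF stone xy(1,2,4)] .
  then obtain n where n: "U = c n" using enum by auto
  have "path x (Suc n) = path y (Suc n)" using xy(3) by (simp only: path_eq_code)
  then obtain b where "x \<in> piece (b # path x n)" "y \<in> piece (b # path x n)"
    using mem_piece_path[OF xy(1), of "Suc n"] mem_piece_path[OF xy(2), of "Suc n"] by (metis path.simps(2))
  then show False using piece_decides[of b "path x n"] U n by auto
qed

text \<open>The pieces along a branch are nested and nonempty, so by compactness they have a common point.\<close>

lemma surj_code: "code ` topspace X = UNIV"
proof -
  have "\<exists>x \<in> topspace X. code x = b" for b
  proof -
    let ?w = "\<lambda>n. rev (map b [0..<n])"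
    have "(\<Inter>n. piece (?w n)) \<noteq> {}"
    proof (rule compact_space_imp_nest)
      show "compact_space X" using stone by (simp add: is_stone_space_def)
      show "decseq (\<lambda>n. piece (?w n))"
      proof (rule decseq_SucI)
        fix n show "piece (?w (Suc n)) \<le> piece (?w n)" using piece_mono[of "b n" "?w n"] by simp
      qed
    qed (use piece in \<open>auto simp: clopenin_def\<close>)
    then obtain x where x: "\<And>n. x \<in> piece (?w n)" by blast
    then have X: "x \<in> topspace X" by (metis list.simps(8) piece.simps(1) rev.simps(1) upt_0)
    have "code x n = b n" for n
    proof -
      have "path x (Suc n) = ?w (Suc n)" using path_eq_iff[OF X, of "?w (Suc n)"] x[of "Suc n"] by (simp del: piece.simps path.simps)
      then show ?thesis by (auto simp: code_def)
    qed
    then show ?thesis using X by blast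
  qed
  then show ?thesis by (metis UNIV_eq_I image_eqI)
qed

lemma is_cantor_space: "is_cantor_space X"
proof -
  have "homeomorphic_map X cantor_topology code"
    using continuous_code inj_code surj_code stone is_stone_space_cantor
    by (intro continuous_imp_homeomorphic_map) (auto simp: is_stone_space_def)
  then show ?thesis unfolding is_cantor_space_def homeomorphic_space by blast
qed

end

lemma homeomorphic_map_clopenin:
  assumes "homeomorphic_map X Y f" "U \<subseteq> topspace X"
  shows "clopenin Y (f ` U) \<longleftrightarrow> clopenin X U"
  using assms by (simp add: clopenin_def homeomorphic_map_openness homeomorphic_map_closedness)

text \<open>The Cantor property can thus be read off the algebra of clopen sets. This is used in both
  directions: for Stone spaces of countable atomless Boolean lattices, and for the lattice of
  idempotents of a monoid that is built from a Cantor group.\<close>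

theorem is_cantor_space_iff:
  "is_cantor_space X \<longleftrightarrow> is_stone_space X \<and> countable {U. clopenin X U} \<and> topspace X \<noteq> {} \<and>
     (\<forall>U. clopenin X U \<and> U \<noteq> {} \<longrightarrow> (\<exists>V. clopenin X V \<and> V \<noteq> {} \<and> V \<subset> U))" (is "_ \<longleftrightarrow> ?R")
proof
  assume R: ?R
  have "{} \<in> {U. clopenin X U}" using clopenin_empty by blast
  then have c: "range (from_nat_into {U. clopenin X U}) = {U. clopenin X U}"
    using R by (intro range_from_nat_into) blast+
  have cl: "clopenin X (from_nat_into {U. clopenin X U} n)" for n using c by blast
  interpret cantor_scheme X "from_nat_into {U. clopenin X U}"
  proof
    show "U \<in> range (from_nat_into {U. clopenin X U})" if "clopenin X U" for U
      unfolding c using that by blast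
  qed (use R cl in blast)+
  show "is_cantor_space X" by (rule is_cantor_space)
next
  assume "is_cantor_space X"
  then have "cantor_topology homeomorphic_space X"
    unfolding is_cantor_space_def using homeomorphic_space_sym by blast
  then obtain f where f: "homeomorphic_map cantor_topology X f" unfolding homeomorphic_space by blast
  have im: "f ` UNIV = topspace X" using homeomorphic_imp_surjective_map[OF f] by simp
  have inj: "inj f" using homeomorphic_imp_injective_map[OF f] by simp
  have cl: "clopenin X (f ` U) \<longleftrightarrow> clopenin cantor_topology U" for U
    using homeomorphic_map_clopenin[OF f] by simp
  have cl': "\<exists>V. clopenin cantor_topology V \<and> U = f ` V" if "clopenin X U" for U
  proof -
    have U: "f ` (f -` U) = U" using im clopenin_subset[OF that] by (simp add: image_vimage_eq Int_absorb2)
    then have "clopenin cantor_topology (f -` U)" using cl[of "f -` U"] that by simp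
    then show ?thesis using U by blast
  qed
  show ?R
  proof (intro conjI allI impI)
    show "is_stone_space X"
    proof (rule is_stone_spaceI)
      show "compact_space X" "Hausdorff_space X"
        using is_stone_space_cantor homeomorphic_compact_space homeomorphic_Hausdorff_space
          homeomorphic_map_imp_homeomorphic_space[OF f] unfolding is_stone_space_def by blast+
      fix W x assume W: "openin X W" "x \<in> W"
      then obtain z where z: "x = f z" using im openin_subset[OF W(1)] by blast
      have "openin cantor_topology (f -` W)"
        using homeomorphic_map_openness[OF f, of "f -` W"] W im openin_subset[OF W(1)]
        by (simp add: image_vimage_eq inf_absorb1)
      then obtain U where "clopenin cantor_topology U" "z \<in> U" "U \<subseteq> f -` W"
        using stone_space_clopen_base[OF is_stone_space_cantor, of "f -` W" z] W z by blast
      then show "\<exists>U. clopenin X U \<and> x \<in> U \<and> U \<subseteq> W" using cl z by blast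
    qed
    have "{U. clopenin X U} \<subseteq> image f ` {U. clopenin cantor_topology U}" using cl' by blast
    then show "countable {U. clopenin X U}"
      using countable_clopenin_cantor by (meson countable_image countable_subset)
    show "topspace X \<noteq> {}" using im by blast
    fix U assume "clopenin X U \<and> U \<noteq> {}"
    then obtain U' where U': "clopenin cantor_topology U'" "U = f ` U'" "U' \<noteq> {}" using cl' by blast
    then obtain V where V: "clopenin cantor_topology V" "V \<noteq> {}" "V \<subset> U'" using cantor_split by blast
    have "f ` V \<subset> U" using V(3) U'(2) inj by (simp add: image_strict_mono inj_on_subset)
    then show "\<exists>V. clopenin X V \<and> V \<noteq> {} \<and> V \<subset> U" using V cl by blast
  qed
qed

section \<open>Stone duality for Boolean lattices\<close>

definition basic_open :: "('a, 'm) gorder_scheme \<Rightarrow> 'a \<Rightarrow> 'a set set" where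
  "basic_open L e = {F \<in> ultrafilters L. e \<in> F}"

lemma ultrafilter_proper: "F \<in> ultrafilters L \<Longrightarrow> proper_filter L F"
  by (simp add: ultrafilters_def)

context boolean_lattice
begin

lemma proper_filterD:
  assumes "proper_filter L F"
  shows "F \<subseteq> carrier L" "F \<noteq> {}" "\<bottom> \<notin> F"
    "x \<in> F \<Longrightarrow> y \<in> carrier L \<Longrightarrow> x \<sqsubseteq> y \<Longrightarrow> y \<in> F"
    "x \<in> F \<Longrightarrow> y \<in> F \<Longrightarrow> x \<sqinter> y \<in> F"
  using assms by (auto simp: proper_filter_def)

lemma proper_filter_top: "proper_filter L F \<Longrightarrow> \<top> \<in> F"
  by (metis ex_in_conv proper_filterD(1,2,4) subsetD top_closed top_higher)

lemma extend_to_ultrafilter: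
  assumes "proper_filter L F"
  obtains G where "G \<in> ultrafilters L" "F \<subseteq> G"
proof -
  let ?A = "{G. proper_filter L G \<and> F \<subseteq> G}"
  have "\<exists>M\<in>?A. \<forall>H\<in>?A. M \<subseteq> H \<longrightarrow> H = M"
  proof (rule subset_Zorn_nonempty)
    show "?A \<noteq> {}" using assms by blast
    fix C assume C: "C \<noteq> {}" "subset.chain ?A C"
    then have CA: "\<And>G. G \<in> C \<Longrightarrow> proper_filter L G \<and> F \<subseteq> G" by (auto simp: subset_chain_def)
    have ch: "G \<subseteq> H \<or> H \<subseteq> G" if "G \<in> C" "H \<in> C" for G H
      using C(2) that by (auto simp: subset_chain_def)
    have "x \<sqinter> y \<in> \<Union>C" if xy: "x \<in> \<Union>C" "y \<in> \<Union>C" for x y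
    proof -
      obtain G H where GH: "G \<in> C" "H \<in> C" "x \<in> G" "y \<in> H" using xy by blast
      then obtain K where "K \<in> C" "x \<in> K" "y \<in> K" using ch by blast
      then show ?thesis using CA proper_filterD(5) by blast
    qed
    then have "proper_filter L (\<Union>C)"
      unfolding proper_filter_def
    proof (intro conjI ballI impI)
      show "\<Union>C \<subseteq> carrier L" "\<bottom> \<notin> \<Union>C" using CA proper_filterD(1,3) by blast+
      obtain G where "G \<in> C" using C(1) by blast
      then show "\<Union>C \<noteq> {}" using CA proper_filterD(2) by blast
      show "y \<in> \<Union>C" if "x \<in> \<Union>C" "y \<in> carrier L" "x \<sqsubseteq> y" for x y
        using that CA proper_filterD(4) by (meson UnionE UnionI)
    qed
    then show "\<Union>C \<in> ?A" using CA C(1) by blast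
  qed
  then obtain M where M: "proper_filter L M" "F \<subseteq> M" "\<And>H. proper_filter L H \<Longrightarrow> F \<subseteq> H \<Longrightarrow> M \<subseteq> H \<Longrightarrow> H = M"
    by auto
  then have "M \<in> ultrafilters L" unfolding ultrafilters_def by (auto dest: order_trans)
  then show thesis using that M(2) by blast
qed

lemma bottom_unique: "x \<in> carrier L \<Longrightarrow> x \<sqsubseteq> \<bottom> \<Longrightarrow> x = \<bottom>"
  by (simp add: le_antisym)

lemma meet_top: "x \<in> carrier L \<Longrightarrow> x \<sqinter> \<top> = x"
  using le_iff_join[of x \<top>] by simp

lemma join_bottom: "x \<in> carrier L \<Longrightarrow> x \<squnion> \<bottom> = x"
  using le_iff_meet[of \<bottom> x] by (simp add: join_comm[of L x])

text \<open>An ultrafilter omitting \<open>x\<close> contains an element disjoint from \<open>x\<close>, since otherwise it could be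
  enlarged by \<open>x\<close>.\<close>

lemma ultrafilter_disjoint_witness:
  assumes F: "F \<in> ultrafilters L" and x: "x \<in> carrier L" "x \<notin> F"
  obtains f where "f \<in> F" "f \<sqinter> x = \<bottom>"
proof (rule ccontr)
  assume no: "\<not> thesis"
  note pf = ultrafilter_proper[OF F]
  have sub: "f \<in> carrier L" if "f \<in> F" for f using proper_filterD(1)[OF pf] that by blast
  let ?G = "{z \<in> carrier L. \<exists>f\<in>F. f \<sqinter> x \<sqsubseteq> z}"
  have "proper_filter L ?G"
    unfolding proper_filter_def
  proof (intro conjI ballI impI)
    show "?G \<subseteq> carrier L" by blast
    show "?G \<noteq> {}" using proper_filter_top[OF pf] x by (metis (mono_tags, lifting) empty_iff le_refl meet_closed mem_Collect_eq top_closed)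
    show "\<bottom> \<notin> ?G" using no that bottom_unique x sub by force
  next
    fix a b assume "a \<in> ?G" "b \<in> carrier L" "a \<sqsubseteq> b"
    then obtain f where "f \<in> F" "f \<sqinter> x \<sqsubseteq> a" "a \<in> carrier L" by blast
    then have "f \<sqinter> x \<sqsubseteq> b" using le_trans[of "f \<sqinter> x" a b] x sub \<open>a \<sqsubseteq> b\<close> \<open>b \<in> carrier L\<close> by simp
    then show "b \<in> ?G" using \<open>f \<in> F\<close> \<open>b \<in> carrier L\<close> by blast
  next
    fix a b assume "a \<in> ?G" "b \<in> ?G"
    then obtain f g where fg: "f \<in> F" "g \<in> F" "f \<sqinter> x \<sqsubseteq> a" "g \<sqinter> x \<sqsubseteq> b" and ab: "a \<in> carrier L" "b \<in> carrier L" by blast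
    have c: "f \<in> carrier L" "g \<in> carrier L" using fg sub by auto
    have "(f \<sqinter> g) \<sqinter> x \<sqsubseteq> f \<sqinter> x" "(f \<sqinter> g) \<sqinter> x \<sqsubseteq> g \<sqinter> x"
      using c x by (meson le_trans meet_closed meet_le meet_left meet_right)+
    then have "(f \<sqinter> g) \<sqinter> x \<sqsubseteq> a" "(f \<sqinter> g) \<sqinter> x \<sqsubseteq> b" using c x ab fg by (meson le_trans meet_closed)+
    then have "(f \<sqinter> g) \<sqinter> x \<sqsubseteq> a \<sqinter> b" using c x ab by (simp add: meet_le)
    then show "a \<sqinter> b \<in> ?G" using ab proper_filterD(5)[OF pf fg(1,2)] by auto
  qed
  moreover have "F \<subseteq> ?G"
  proof
    fix f assume "f \<in> F"
    then show "f \<in> ?G" using x sub meet_left by blast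
  qed
  ultimately have "?G = F" using F unfolding ultrafilters_def by blast
  moreover have "x \<in> ?G" using proper_filter_top[OF pf] x meet_right by blast
  ultimately show False using x by simp
qed

lemma ultrafilter_meet_iff:
  assumes F: "F \<in> ultrafilters L" and "x \<in> carrier L" "y \<in> carrier L"
  shows "x \<sqinter> y \<in> F \<longleftrightarrow> x \<in> F \<and> y \<in> F"
  using proper_filterD[OF ultrafilter_proper[OF F]] assms by (meson meet_left meet_right)

lemma ultrafilter_join_iff:
  assumes F: "F \<in> ultrafilters L" and xy: "x \<in> carrier L" "y \<in> carrier L"
  shows "x \<squnion> y \<in> F \<longleftrightarrow> x \<in> F \<or> y \<in> F"
proof
  note pf = ultrafilter_proper[OF F]
  show "x \<squnion> y \<in> F" if "x \<in> F \<or> y \<in> F"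
    using that proper_filterD(4)[OF pf] xy by (meson join_closed join_left join_right)
  show "x \<in> F \<or> y \<in> F" if j: "x \<squnion> y \<in> F"
  proof (rule ccontr)
    assume "\<not> (x \<in> F \<or> y \<in> F)"
    then obtain f g where fg: "f \<in> F" "f \<sqinter> x = \<bottom>" "g \<in> F" "g \<sqinter> y = \<bottom>"
      using ultrafilter_disjoint_witness[OF F] xy by metis
    have c: "f \<in> carrier L" "g \<in> carrier L" using fg proper_filterD(1)[OF pf] by auto
    have "(f \<sqinter> g) \<sqinter> x \<sqsubseteq> f \<sqinter> x" "(f \<sqinter> g) \<sqinter> y \<sqsubseteq> g \<sqinter> y"
      using c xy by (meson le_trans meet_closed meet_le meet_left meet_right)+
    then have "(f \<sqinter> g) \<sqinter> x = \<bottom>" "(f \<sqinter> g) \<sqinter> y = \<bottom>" using fg bottom_unique c xy by auto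
    then have "(f \<sqinter> g) \<sqinter> (x \<squnion> y) = \<bottom>" using distrib c xy join_bottom by simp
    moreover have "(f \<sqinter> g) \<sqinter> (x \<squnion> y) \<in> F" using fg j proper_filterD(5)[OF pf] by blast
    ultimately show False using proper_filterD(3)[OF pf] by simp
  qed
qed

lemma ultrafilter_complement_iff:
  assumes F: "F \<in> ultrafilters L" and "x \<in> carrier L" "y \<in> carrier L" "x \<sqinter> y = \<bottom>" "x \<squnion> y = \<top>"
  shows "y \<in> F \<longleftrightarrow> x \<notin> F"
  using ultrafilter_meet_iff[OF F assms(2,3)] ultrafilter_join_iff[OF F assms(2,3)] assms(4,5)
    proper_filter_top proper_filterD(3) ultrafilter_proper[OF F] by metis

lemma ultrafilterI:
  assumes pf: "proper_filter L F"
    and prime: "\<And>x y. \<lbrakk>x \<in> carrier L; y \<in> carrier L; x \<sqinter> y = \<bottom>; x \<squnion> y = \<top>\<rbrakk> \<Longrightarrow> x \<in> F \<or> y \<in> F"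
  shows "F \<in> ultrafilters L"
  unfolding ultrafilters_def
proof (intro CollectI conjI allI impI pf)
  fix G assume G: "proper_filter L G \<and> F \<subseteq> G"
  have "x \<in> F" if "x \<in> G" for x
  proof -
    have x: "x \<in> carrier L" using G that proper_filterD(1) by blast
    then obtain y where y: "y \<in> carrier L" "x \<sqinter> y = \<bottom>" "x \<squnion> y = \<top>" using complemented by blast
    have "y \<notin> F" using y G that proper_filterD(3,5)[of G] by (metis subsetD)
    then show ?thesis using prime x y by blast
  qed
  then show "G = F" using G by blast
qed

lemma ultrafilter_containing:
  assumes "x \<in> carrier L" "x \<noteq> \<bottom>"
  obtains F where "F \<in> ultrafilters L" "x \<in> F"
proof -
  have "proper_filter L {z \<in> carrier L. x \<sqsubseteq> z}"
    unfolding proper_filter_def using assms bottom_unique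
    by (auto intro: le_trans meet_le)
  then show thesis using extend_to_ultrafilter that assms(1) by (metis (mono_tags, lifting) le_refl mem_Collect_eq subsetD)
qed

lemma le_iff_ultrafilters:
  assumes "x \<in> carrier L" "y \<in> carrier L"
  shows "x \<sqsubseteq> y \<longleftrightarrow> (\<forall>F\<in>ultrafilters L. x \<in> F \<longrightarrow> y \<in> F)"
proof
  show "\<forall>F\<in>ultrafilters L. x \<in> F \<longrightarrow> y \<in> F" if "x \<sqsubseteq> y"
    using that assms proper_filterD(4) ultrafilter_proper by blast
  assume R: "\<forall>F\<in>ultrafilters L. x \<in> F \<longrightarrow> y \<in> F"
  obtain y' where y': "y' \<in> carrier L" "y \<sqinter> y' = \<bottom>" "y \<squnion> y' = \<top>" using complemented assms by blast
  have "x \<sqinter> y' = \<bottom>"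
  proof (rule ccontr)
    assume "x \<sqinter> y' \<noteq> \<bottom>"
    then obtain F where "F \<in> ultrafilters L" "x \<sqinter> y' \<in> F"
      using ultrafilter_containing assms y' meet_closed by metis
    then show False using R ultrafilter_meet_iff ultrafilter_complement_iff assms y' by metis
  qed
  then have "x = x \<sqinter> y" using distrib[of x y y'] y' assms by (simp add: meet_top join_bottom)
  then show "x \<sqsubseteq> y" using assms by (metis meet_right)
qed

lemma eq_iff_ultrafilters:
  assumes "x \<in> carrier L" "y \<in> carrier L"
  shows "x = y \<longleftrightarrow> (\<forall>F\<in>ultrafilters L. x \<in> F \<longleftrightarrow> y \<in> F)"
  using le_iff_ultrafilters assms by (metis le_antisym)

lemma openin_stone_space:
  "openin (stone_space L) W \<longleftrightarrow>
     W \<subseteq> ultrafilters L \<and> (\<forall>F\<in>W. \<exists>e\<in>carrier L. F \<in> basic_open L e \<and> basic_open L e \<subseteq> W)"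
proof
  let ?S = "(\<lambda>e. {F \<in> ultrafilters L. e \<in> F}) ` carrier L"
  assume "openin (stone_space L) W"
  then have "generate_topology_on ?S W" by (simp add: stone_space_def openin_topology_generated_by_iff)
  then show "W \<subseteq> ultrafilters L \<and> (\<forall>F\<in>W. \<exists>e\<in>carrier L. F \<in> basic_open L e \<and> basic_open L e \<subseteq> W)"
  proof (induction rule: generate_topology_on.induct)
    case (Int a b)
    show ?case
    proof (intro conjI ballI)
      fix F assume "F \<in> a \<inter> b"
      then obtain d e where de: "d \<in> carrier L" "e \<in> carrier L" "F \<in> basic_open L d" "F \<in> basic_open L e"
        "basic_open L d \<subseteq> a" "basic_open L e \<subseteq> b" using Int.IH by (meson IntD1 IntD2)
      moreover have "basic_open L (d \<sqinter> e) = basic_open L d \<inter> basic_open L e"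
        using de ultrafilter_meet_iff by (auto simp: basic_open_def)
      ultimately show "\<exists>e\<in>carrier L. F \<in> basic_open L e \<and> basic_open L e \<subseteq> a \<inter> b"
        by (intro bexI[of _ "d \<sqinter> e"]) auto
    qed (use Int in auto)
  next
    case (UN K)
    show ?case
    proof (intro conjI ballI)
      show "\<Union>K \<subseteq> ultrafilters L" using UN by blast
      fix F assume "F \<in> \<Union>K"
      then obtain k where "k \<in> K" "F \<in> k" by blast
      then show "\<exists>e\<in>carrier L. F \<in> basic_open L e \<and> basic_open L e \<subseteq> \<Union>K"
        using UN.IH[of k] by (meson Sup_upper order_trans)
    qed
  qed (auto simp: basic_open_def)
next
  assume R: "W \<subseteq> ultrafilters L \<and> (\<forall>F\<in>W. \<exists>e\<in>carrier L. F \<in> basic_open L e \<and> basic_open L e \<subseteq> W)"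
  have "openin (stone_space L) (basic_open L e)" if "e \<in> carrier L" for e
    unfolding stone_space_def using that by (intro topology_generated_by_Basis) (auto simp: basic_open_def)
  then show "openin (stone_space L) W" using R by (subst openin_subopen) blast
qed

lemma topspace_stone_space: "topspace (stone_space L) = ultrafilters L"
proof
  show "topspace (stone_space L) \<subseteq> ultrafilters L"
    using openin_topspace openin_stone_space by blast
  have "F \<in> basic_open L \<top>" if "F \<in> ultrafilters L" for F
    using that proper_filter_top[OF ultrafilter_proper] by (simp add: basic_open_def)
  then have "openin (stone_space L) (ultrafilters L)"
    by (auto simp: openin_stone_space basic_open_def)
  then show "ultrafilters L \<subseteq> topspace (stone_space L)" using openin_subset by blast
qed

lemma clopenin_basic_open:
  assumes e: "e \<in> carrier L"
  shows "clopenin (stone_space L) (basic_open L e)"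
proof -
  have op: "openin (stone_space L) (basic_open L e)" if "e \<in> carrier L" for e
    using that by (auto simp: openin_stone_space basic_open_def)
  obtain y where y: "y \<in> carrier L" "e \<sqinter> y = \<bottom>" "e \<squnion> y = \<top>" using complemented e by blast
  have "basic_open L y = ultrafilters L - basic_open L e"
    using ultrafilter_complement_iff[OF _ e y] by (auto simp: basic_open_def)
  then have "openin (stone_space L) (topspace (stone_space L) - basic_open L e)"
    using op[OF y(1)] by (simp add: topspace_stone_space)
  moreover have "basic_open L e \<subseteq> topspace (stone_space L)"
    unfolding topspace_stone_space by (auto simp: basic_open_def)
  ultimately show ?thesis using op[OF e] by (simp add: clopenin_def closedin_def)
qed

text \<open>The elements whose basic open set has a finite subcover form an ideal \<open>I\<close>. If \<open>\<top>\<close> were not in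
  \<open>I\<close>, the complements of the elements of \<open>I\<close> would form a proper filter; but an ultrafilter
  extending it lies in a member of the cover, and so contains an element of \<open>I\<close>.\<close>

lemma compact_stone_space: "compact_space (stone_space L)"
  unfolding compact_space_alt
proof (intro allI impI)
  fix \<U> assume U: "(\<forall>U\<in>\<U>. openin (stone_space L) U) \<and> topspace (stone_space L) \<subseteq> \<Union>\<U>"
  define I where "I = {x \<in> carrier L. \<exists>\<F>. finite \<F> \<and> \<F> \<subseteq> \<U> \<and> basic_open L x \<subseteq> \<Union>\<F>}"
  have Ijoin: "x \<squnion> y \<in> I" if xy: "x \<in> I" "y \<in> I" for x y
  proof -
    obtain A B where AB: "finite A" "A \<subseteq> \<U>" "basic_open L x \<subseteq> \<Union>A" "finite B" "B \<subseteq> \<U>" "basic_open L y \<subseteq> \<Union>B"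
      and c: "x \<in> carrier L" "y \<in> carrier L"
      using xy by (auto simp: I_def)
    have "basic_open L (x \<squnion> y) = basic_open L x \<union> basic_open L y"
      using ultrafilter_join_iff c by (auto simp: basic_open_def)
    then have "basic_open L (x \<squnion> y) \<subseteq> \<Union>(A \<union> B)" using AB by blast
    then show ?thesis using AB c unfolding I_def by (intro CollectI conjI exI[of _ "A \<union> B"]) auto
  qed
  have "\<top> \<in> I"
  proof (rule ccontr)
    assume top: "\<top> \<notin> I"
    have bot: "\<bottom> \<in> I"
      using proper_filterD(3)[OF ultrafilter_proper]
      by (auto simp: I_def basic_open_def intro!: exI[of _ "{}"])
    let ?F = "{z \<in> carrier L. \<exists>x\<in>I. z \<squnion> x = \<top>}"
    have cI: "x \<in> carrier L" if "x \<in> I" for x using that by (simp add: I_def)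
    have "proper_filter L ?F"
      unfolding proper_filter_def
    proof (intro conjI ballI impI)
      have "\<top> \<in> ?F" using bot join_bottom[of \<top>] by auto
      then show "?F \<noteq> {}" by blast
      show "\<bottom> \<notin> ?F"
      proof
        assume "\<bottom> \<in> ?F"
        then obtain x where "x \<in> I" "\<bottom> \<squnion> x = \<top>" by blast
        then have "x = \<top>" using join_bottom[OF cI[OF \<open>x \<in> I\<close>]] join_comm[of L \<bottom> x] by simp
        then show False using top \<open>x \<in> I\<close> by simp
      qed
      fix a b assume ab: "a \<in> ?F" "b \<in> carrier L" "a \<sqsubseteq> b"
      then obtain x where x: "x \<in> I" "a \<squnion> x = \<top>" "a \<in> carrier L" by blast
      note c = ab(2) x(3) cI[OF x(1)]
      have "a \<sqsubseteq> b \<squnion> x" using le_trans[OF ab(3) join_left] c by simp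
      then have "a \<squnion> x \<sqsubseteq> b \<squnion> x" using join_le[OF _ join_right] c by simp
      then have "b \<squnion> x = \<top>" using x(2) c le_antisym[of \<top> "b \<squnion> x"] by simp
      then show "b \<in> ?F" using x ab by blast
    next
      fix a b assume "a \<in> ?F" "b \<in> ?F"
      then obtain x y where xy: "a \<in> carrier L" "b \<in> carrier L" "x \<in> I" "a \<squnion> x = \<top>" "y \<in> I" "b \<squnion> y = \<top>" by blast
      have "(a \<sqinter> b) \<squnion> (x \<squnion> y) = \<top>"
      proof (subst eq_iff_ultrafilters)
        note c = xy(1,2) cI[OF xy(3)] cI[OF xy(5)]
        show "(a \<sqinter> b) \<squnion> (x \<squnion> y) \<in> carrier L" "\<top> \<in> carrier L" using c by simp_all
        have "(a \<sqinter> b) \<squnion> (x \<squnion> y) \<in> H" if H: "H \<in> ultrafilters L" for H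
        proof -
          have "\<top> \<in> H" using proper_filter_top ultrafilter_proper[OF H] by blast
          then have "a \<in> H \<or> x \<in> H" "b \<in> H \<or> y \<in> H"
            using ultrafilter_join_iff[OF H] c xy(4,6) by metis+
          then show ?thesis using c by (auto simp: ultrafilter_join_iff[OF H] ultrafilter_meet_iff[OF H])
        qed
        then show "\<forall>H\<in>ultrafilters L. (a \<sqinter> b) \<squnion> (x \<squnion> y) \<in> H \<longleftrightarrow> \<top> \<in> H"
          using proper_filter_top ultrafilter_proper by blast
      qed
      then show "a \<sqinter> b \<in> ?F" using Ijoin xy by auto
    qed blast
    then obtain G where G: "G \<in> ultrafilters L" "?F \<subseteq> G" by (rule extend_to_ultrafilter)
    then obtain W where W: "W \<in> \<U>" "G \<in> W" using U topspace_stone_space by blast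
    then obtain e where e: "e \<in> carrier L" "e \<in> G" "basic_open L e \<subseteq> W"
      using U openin_stone_space[of W] by (auto simp: basic_open_def)
    then have "e \<in> I" using W(1) unfolding I_def by (intro CollectI conjI exI[of _ "{W}"]) auto
    obtain y where y: "y \<in> carrier L" "e \<sqinter> y = \<bottom>" "e \<squnion> y = \<top>" using complemented e by blast
    then have "y \<squnion> e = \<top>" by (simp add: join_comm)
    then have "y \<in> ?F" using \<open>e \<in> I\<close> y(1) by blast
    then show False using G ultrafilter_complement_iff[OF G(1) e(1) y] e(2) by blast
  qed
  then obtain \<F> where "finite \<F>" "\<F> \<subseteq> \<U>" "basic_open L \<top> \<subseteq> \<Union>\<F>" by (auto simp: I_def)
  moreover have "basic_open L \<top> = topspace (stone_space L)"
    using proper_filter_top[OF ultrafilter_proper] by (auto simp: basic_open_def topspace_stone_space)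
  ultimately show "\<exists>\<F>. finite \<F> \<and> \<F> \<subseteq> \<U> \<and> topspace (stone_space L) \<subseteq> \<Union>\<F>" by auto
qed

lemma is_stone_space_stone_space: "is_stone_space (stone_space L)"
proof (rule is_stone_spaceI)
  show "compact_space (stone_space L)" by (rule compact_stone_space)
  show "Hausdorff_space (stone_space L)"
    unfolding Hausdorff_space_def topspace_stone_space
  proof (intro allI impI)
    fix F G assume FG: "F \<in> ultrafilters L \<and> G \<in> ultrafilters L \<and> F \<noteq> G"
    have "\<not> F \<subseteq> G" using FG unfolding ultrafilters_def by blast
    then obtain x where x: "x \<in> F" "x \<notin> G" by blast
    have c: "x \<in> carrier L" using x FG ultrafilter_proper proper_filterD(1) by blast
    then obtain y where y: "y \<in> carrier L" "x \<sqinter> y = \<bottom>" "x \<squnion> y = \<top>" using complemented by blast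
    have *: "y \<in> H \<longleftrightarrow> x \<notin> H" if "H \<in> ultrafilters L" for H
      using ultrafilter_complement_iff[OF that c y] .
    show "\<exists>U V. openin (stone_space L) U \<and> openin (stone_space L) V \<and> F \<in> U \<and> G \<in> V \<and> disjnt U V"
      using clopenin_basic_open[OF c] clopenin_basic_open[OF y(1)] * FG x
      by (intro exI[of _ "basic_open L x"] exI[of _ "basic_open L y"])
        (auto simp: clopenin_def basic_open_def disjnt_def)
  qed
  fix W F assume "openin (stone_space L) W" "F \<in> W"
  then show "\<exists>U. clopenin (stone_space L) U \<and> F \<in> U \<and> U \<subseteq> W"
    using clopenin_basic_open openin_stone_space by blast
qed

text \<open>A clopen set is compact, hence a finite union of basic sets, and so the basic set of a join.\<close>

lemma clopenin_stone_space_iff: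
  "clopenin (stone_space L) U \<longleftrightarrow> (\<exists>e\<in>carrier L. U = basic_open L e)"
proof
  assume "clopenin (stone_space L) U"
  then have U: "openin (stone_space L) U" "closedin (stone_space L) U" by (auto simp: clopenin_def)
  let ?B = "{B \<in> basic_open L ` carrier L. B \<subseteq> U}"
  have "compactin (stone_space L) U" using U(2) compact_stone_space closedin_compact_space by blast
  moreover have "openin (stone_space L) B" if "B \<in> ?B" for B
    using that clopenin_basic_open unfolding clopenin_def by blast
  moreover have "U \<subseteq> \<Union>?B" using U(1) unfolding openin_stone_space by blast
  ultimately obtain \<F> where F: "finite \<F>" "\<F> \<subseteq> ?B" "U \<subseteq> \<Union>\<F>" by (meson compactinD)
  have "\<exists>e\<in>carrier L. \<Union>\<F> = basic_open L e"
    using F(1,2)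
  proof (induction \<F>)
    case empty
    have "basic_open L \<bottom> = {}"
      using proper_filterD(3)[OF ultrafilter_proper] by (auto simp: basic_open_def)
    then show ?case by (metis Union_empty bottom_closed)
  next
    case (insert B \<F>)
    have "\<exists>d\<in>carrier L. B = basic_open L d" using insert.prems by blast
    moreover have "\<exists>e\<in>carrier L. \<Union>\<F> = basic_open L e" using insert by simp
    ultimately obtain d e where "d \<in> carrier L" "e \<in> carrier L" "B = basic_open L d" "\<Union>\<F> = basic_open L e"
      by metis
    note de = this
    have "basic_open L (d \<squnion> e) = basic_open L d \<union> basic_open L e"
      using ultrafilter_join_iff[OF _ de(1,2)] by (auto simp: basic_open_def)
    then have "\<Union>(insert B \<F>) = basic_open L (d \<squnion> e)" using de by simp
    then show ?case using join_closed[OF de(1,2)] by blast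
  qed
  moreover have "\<Union>\<F> = U" using F by blast
  ultimately show "\<exists>e\<in>carrier L. U = basic_open L e" by simp
qed (use clopenin_basic_open in blast)

lemma basic_open_subset_iff:
  "x \<in> carrier L \<Longrightarrow> y \<in> carrier L \<Longrightarrow> basic_open L x \<subseteq> basic_open L y \<longleftrightarrow> x \<sqsubseteq> y"
  using le_iff_ultrafilters by (auto simp: basic_open_def)

lemma basic_open_empty_iff: "x \<in> carrier L \<Longrightarrow> basic_open L x = {} \<longleftrightarrow> x = \<bottom>"
  using ultrafilter_containing[of x] proper_filterD(3)[OF ultrafilter_proper] unfolding basic_open_def by blast

end

lemma (in countable_atomless_boolean_lattice) is_cantor_space_stone_space:
  "is_cantor_space (stone_space L)"
  unfolding is_cantor_space_iff
proof (intro conjI allI impI)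
  show "is_stone_space (stone_space L)" by (rule is_stone_space_stone_space)
  have "{U. clopenin (stone_space L) U} = basic_open L ` carrier L"
    using clopenin_stone_space_iff by blast
  then show "countable {U. clopenin (stone_space L) U}" using countable_carrier by simp
  show "topspace (stone_space L) \<noteq> {}"
    using ultrafilter_containing[of \<top>] nondegenerate topspace_stone_space by auto
  fix U assume "clopenin (stone_space L) U \<and> U \<noteq> {}"
  then obtain x where x: "x \<in> carrier L" "U = basic_open L x" "x \<noteq> \<bottom>"
    using clopenin_stone_space_iff basic_open_empty_iff by metis
  then obtain y where y: "y \<in> carrier L" "y \<noteq> \<bottom>" "y \<sqsubset> x" using atomless by blast
  have "y \<sqsubseteq> x" "y \<noteq> x" using y(3) by (auto simp: lless_eq)
  then have "\<not> x \<sqsubseteq> y" using x y le_antisym by blast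
  then have "basic_open L y \<subset> U" using \<open>y \<sqsubseteq> x\<close> basic_open_subset_iff x y by blast
  moreover have "basic_open L y \<noteq> {}" using basic_open_empty_iff y by blast
  ultimately show "\<exists>V. clopenin (stone_space L) V \<and> V \<noteq> {} \<and> V \<subset> U"
    using clopenin_basic_open[OF y(1)] by blast
qed

section \<open>Pseudogroups of clopen partial bijections\<close>

lemma homeo_group_simps:
  "carrier (homeo_group X) = {f \<in> Bij (topspace X). homeomorphic_map X X f}"
  "f \<in> Bij (topspace X) \<Longrightarrow> g \<in> Bij (topspace X) \<Longrightarrow> f \<otimes>\<^bsub>homeo_group X\<^esub> g = compose (topspace X) f g"
  "\<one>\<^bsub>homeo_group X\<^esub> = (\<lambda>x\<in>topspace X. x)"
  by (simp_all add: homeo_group_def BijGroup_def)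

lemma Bij_inverse_homeomorphic:
  assumes f: "f \<in> Bij (topspace X)" and h: "homeomorphic_map X X f"
  shows "homeomorphic_map X X (\<lambda>x\<in>topspace X. inv_into (topspace X) f x)"
proof -
  have im: "f ` topspace X = topspace X" and inj: "inj_on f (topspace X)"
    using f by (auto simp: Bij_def bij_betw_def)
  obtain g where g: "homeomorphic_maps X X f g" using h homeomorphic_map_maps by blast
  then have "homeomorphic_map X X g" by (simp add: homeomorphic_maps_map)
  moreover have "(\<lambda>x\<in>topspace X. inv_into (topspace X) f x) y = g y" if "y \<in> topspace X" for y
  proof -
    have "g y \<in> topspace X" "f (g y) = y"
      using g that by (auto simp: homeomorphic_maps_def continuous_map_def)
    then show ?thesis using that inv_into_f_f[OF inj] by fastforce
  qed
  ultimately show ?thesis by (metis (no_types, lifting) homeomorphic_map_eq)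
qed

lemma subgroup_homeos: "subgroup {f \<in> Bij (topspace X). homeomorphic_map X X f} (BijGroup (topspace X))"
proof (rule group.subgroupI[OF group_BijGroup])
  show "{f \<in> Bij (topspace X). homeomorphic_map X X f} \<subseteq> carrier (BijGroup (topspace X))"
    by (auto simp: BijGroup_def)
  have "homeomorphic_map X X (\<lambda>x\<in>topspace X. x)"
    by (rule homeomorphic_map_eq[of X X id]) auto
  then show "{f \<in> Bij (topspace X). homeomorphic_map X X f} \<noteq> {}" using id_Bij by blast
next
  fix f assume "f \<in> {f \<in> Bij (topspace X). homeomorphic_map X X f}"
  then show "inv\<^bsub>BijGroup (topspace X)\<^esub> f \<in> {f \<in> Bij (topspace X). homeomorphic_map X X f}"
    by (simp add: inv_BijGroup restrict_inv_into_Bij Bij_inverse_homeomorphic)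
next
  fix f g assume fg: "f \<in> {f \<in> Bij (topspace X). homeomorphic_map X X f}"
    "g \<in> {f \<in> Bij (topspace X). homeomorphic_map X X f}"
  then have "homeomorphic_map X X (f \<circ> g)" using homeomorphic_map_compose by blast
  then have "homeomorphic_map X X (compose (topspace X) f g)"
    by (rule homeomorphic_map_eq) (auto simp: compose_def)
  then show "f \<otimes>\<^bsub>BijGroup (topspace X)\<^esub> g \<in> {f \<in> Bij (topspace X). homeomorphic_map X X f}"
    using fg by (simp add: BijGroup_def compose_Bij)
qed

lemma inv_homeo_group:
  assumes "f \<in> Bij (topspace X)" "homeomorphic_map X X f"
  shows "inv\<^bsub>homeo_group X\<^esub> f = (\<lambda>x\<in>topspace X. inv_into (topspace X) f x)"
  unfolding homeo_group_def
  using group.m_inv_consistent[OF group_BijGroup subgroup_homeos, of f X] assms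
  by (simp add: inv_BijGroup)

lemma subgroup_homeo_group_iff:
  "subgroup G (homeo_group X) \<longleftrightarrow>
     G \<subseteq> {f \<in> Bij (topspace X). homeomorphic_map X X f} \<and> (\<lambda>x\<in>topspace X. x) \<in> G \<and>
     (\<forall>f\<in>G. \<forall>g\<in>G. compose (topspace X) f g \<in> G) \<and>
     (\<forall>f\<in>G. (\<lambda>x\<in>topspace X. inv_into (topspace X) f x) \<in> G)"
proof (cases "G \<subseteq> {f \<in> Bij (topspace X). homeomorphic_map X X f}")
  case True
  then have "\<And>f g. f \<in> G \<Longrightarrow> g \<in> G \<Longrightarrow> f \<otimes>\<^bsub>homeo_group X\<^esub> g = compose (topspace X) f g"
    "\<And>f. f \<in> G \<Longrightarrow> inv\<^bsub>homeo_group X\<^esub> f = (\<lambda>x\<in>topspace X. inv_into (topspace X) f x)"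
    using homeo_group_simps(2) inv_homeo_group by blast+
  then show ?thesis using True by (auto simp: subgroup_def homeo_group_simps(1,3))
next
  case False
  then show ?thesis by (auto simp: subgroup_def homeo_group_simps(1))
qed

definition partial_bij :: "('a \<times> 'b) set \<Rightarrow> bool" where
  "partial_bij r \<longleftrightarrow> single_valued r \<and> single_valued (r\<inverse>)"

lemma partial_bijI:
  assumes "\<And>x y z. (x, y) \<in> r \<Longrightarrow> (x, z) \<in> r \<Longrightarrow> y = z" "\<And>x y z. (y, x) \<in> r \<Longrightarrow> (z, x) \<in> r \<Longrightarrow> y = z"
  shows "partial_bij r"
  unfolding partial_bij_def by (auto intro!: single_valuedI dest: assms)

lemma partial_bijD:
  assumes "partial_bij r"
  shows "(x, y) \<in> r \<Longrightarrow> (x, z) \<in> r \<Longrightarrow> y = z" "(y, x) \<in> r \<Longrightarrow> (z, x) \<in> r \<Longrightarrow> y = z"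
  using assms unfolding partial_bij_def by (auto dest: single_valuedD)

lemma partial_bij_subset: "partial_bij s \<Longrightarrow> r \<subseteq> s \<Longrightarrow> partial_bij r"
  unfolding partial_bij_def by (meson converse_mono single_valued_subset)

lemma partial_bij_converse: "partial_bij r \<Longrightarrow> partial_bij (r\<inverse>)"
  by (auto simp: partial_bij_def)

lemma partial_bij_relcomp: "partial_bij r \<Longrightarrow> partial_bij s \<Longrightarrow> partial_bij (r O s)"
  unfolding partial_bij_def by (simp add: single_valued_relcomp converse_relcomp)

lemma partial_bij_Id_on: "partial_bij (Id_on U)"
  by (auto simp: partial_bij_def single_valued_def)

lemma Id_on_eq_iff [simp]: "Id_on U = Id_on V \<longleftrightarrow> U = V"
  by (auto simp: Id_on_def)

lemma Id_on_subset_iff [simp]: "Id_on U \<subseteq> Id_on V \<longleftrightarrow> U \<subseteq> V"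
  by (auto simp: Id_on_def)

definition graph :: "'a set \<Rightarrow> ('a \<Rightarrow> 'b) \<Rightarrow> ('a \<times> 'b) set" where
  "graph A g = (\<lambda>x. (x, g x)) ` A"

lemma mem_graph_iff: "(x, y) \<in> graph A g \<longleftrightarrow> x \<in> A \<and> y = g x"
  by (auto simp: graph_def)

lemma graph_inject: "f \<in> extensional A \<Longrightarrow> g \<in> extensional A \<Longrightarrow> graph A f = graph A g \<longleftrightarrow> f = g"
  by (auto simp: set_eq_iff mem_graph_iff intro: extensionalityI)

lemma partial_bij_graph: "inj_on g A \<Longrightarrow> partial_bij (graph A g)"
  by (rule partial_bijI) (auto simp: mem_graph_iff inj_on_def)

text \<open>This is the concrete form of a fundamental Boolean inverse \<open>\<and>\<close>-monoid: its elements are partial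
  homeomorphisms between clopen sets, composed as relations, and its idempotents are the identities
  of clopen sets. The last axiom provides meets: the meet of \<open>a\<close> and \<open>b\<close> is the restriction of \<open>a\<close>
  to the largest clopen set on which \<open>a\<close> and \<open>b\<close> agree, that is, on which \<open>a O b\<inverse>\<close> is the
  identity.\<close>

locale pseudogroup =
  fixes X :: "'a topology" and M :: "('a \<times> 'a) set set"
  assumes stone: "is_stone_space X"
    and pbij: "r \<in> M \<Longrightarrow> partial_bij r"
    and Id_on_iff: "Id_on U \<in> M \<longleftrightarrow> clopenin X U"
    and comp: "r \<in> M \<Longrightarrow> s \<in> M \<Longrightarrow> r O s \<in> M"
    and conv: "r \<in> M \<Longrightarrow> r\<inverse> \<in> M"
    and union: "r \<in> M \<Longrightarrow> s \<in> M \<Longrightarrow> partial_bij (r \<union> s) \<Longrightarrow> r \<union> s \<in> M"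
    and fixed: "r \<in> M \<Longrightarrow> \<exists>U. clopenin X U \<and> Id_on U \<subseteq> r \<and> (\<forall>V. clopenin X V \<and> Id_on V \<subseteq> r \<longrightarrow> V \<subseteq> U)"

text \<open>The total elements of \<open>M\<close> as functions on points; they play the part of the group of units.\<close>

definition full_maps :: "'a topology \<Rightarrow> ('a \<times> 'a) set set \<Rightarrow> ('a \<Rightarrow> 'a) set" where
  "full_maps X M = {g \<in> Bij (topspace X). graph (topspace X) g \<in> M}"

context pseudogroup
begin

lemma clopen_Domain:
  assumes "r \<in> M"
  shows "clopenin X (Domain r)"
proof -
  have "r O r\<inverse> = Id_on (Domain r)"
    using partial_bijD(2)[OF pbij[OF assms]] by auto
  then show ?thesis using comp[OF assms conv[OF assms]] Id_on_iff by simp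
qed

lemma clopen_Range: "r \<in> M \<Longrightarrow> clopenin X (Range r)"
  using clopen_Domain[OF conv] by simp

lemma in_topspace: "r \<in> M \<Longrightarrow> (x, y) \<in> r \<Longrightarrow> x \<in> topspace X \<and> y \<in> topspace X"
  using clopenin_subset[OF clopen_Domain] clopenin_subset[OF clopen_Range] by blast

lemma empty_mem: "{} \<in> M"
  using Id_on_iff[of "{}"] clopenin_empty by simp

lemma finite_union: "finite A \<Longrightarrow> A \<subseteq> M \<Longrightarrow> partial_bij (\<Union>A) \<Longrightarrow> \<Union>A \<in> M"
proof (induction A rule: finite_induct)
  case empty
  then show ?case using empty_mem by simp
next
  case (insert r A)
  have "partial_bij (\<Union>A)" using partial_bij_subset[OF insert.prems(2)] by auto
  then have "\<Union>A \<in> M" using insert by simp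
  then show ?case using union[of r "\<Union>A"] insert.prems by simp
qed

lemma full_mapsD:
  assumes "g \<in> full_maps X M"
  shows "g \<in> Bij (topspace X)" "graph (topspace X) g \<in> M" "inj_on g (topspace X)"
    "g ` topspace X = topspace X" "g \<in> extensional (topspace X)"
  using assms by (auto simp: full_maps_def Bij_def bij_betw_def)

lemma full_maps_homeomorphic:
  assumes g: "g \<in> full_maps X M"
  shows "homeomorphic_map X X g"
proof (rule continuous_imp_homeomorphic_map)
  show "compact_space X" "Hausdorff_space X" using stone by (auto simp: is_stone_space_def)
  show "g ` topspace X = topspace X" "inj_on g (topspace X)" using full_mapsD[OF g] by auto
  show "continuous_map X X g"
  proof (rule continuous_map_of_clopen_preimages[OF stone])
    show "g x \<in> topspace X" if "x \<in> topspace X" for x using that full_mapsD(4)[OF g] by blast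
    fix V assume "clopenin X V"
    then have "graph (topspace X) g O Id_on V \<in> M" using comp full_mapsD(2)[OF g] Id_on_iff by blast
    moreover have "Domain (graph (topspace X) g O Id_on V) = {x \<in> topspace X. g x \<in> V}"
      by (auto simp: graph_def)
    ultimately show "openin X {x \<in> topspace X. g x \<in> V}" using clopen_Domain unfolding clopenin_def by metis
  qed
qed

lemma subgroup_full_maps: "subgroup (full_maps X M) (homeo_group X)"
  unfolding subgroup_homeo_group_iff
proof (intro conjI ballI)
  show "full_maps X M \<subseteq> {f \<in> Bij (topspace X). homeomorphic_map X X f}"
    using full_maps_homeomorphic full_mapsD(1) by blast
  have "graph (topspace X) (\<lambda>x\<in>topspace X. x) = Id_on (topspace X)" by (auto simp: graph_def)
  then show "(\<lambda>x\<in>topspace X. x) \<in> full_maps X M"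
    using Id_on_iff by (simp add: full_maps_def clopenin_topspace id_Bij)
next
  fix f g assume fg: "f \<in> full_maps X M" "g \<in> full_maps X M"
  have "graph (topspace X) (compose (topspace X) f g) = graph (topspace X) g O graph (topspace X) f"
    using full_mapsD(4)[OF fg(2)] by (auto simp: graph_def compose_def)
  then show "compose (topspace X) f g \<in> full_maps X M"
    using fg comp by (simp add: full_maps_def compose_Bij)
next
  fix f assume f: "f \<in> full_maps X M"
  have "graph (topspace X) (\<lambda>x\<in>topspace X. inv_into (topspace X) f x) = (graph (topspace X) f)\<inverse>"
    (is "?l = ?r")
    unfolding set_eq_iff split_paired_All
  proof (intro allI)
    fix x y
    have "x \<in> topspace X \<and> y = inv_into (topspace X) f x \<longleftrightarrow> y \<in> topspace X \<and> x = f y"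
    proof safe
      assume x: "x \<in> topspace X"
      then have "x \<in> f ` topspace X" using full_mapsD(4)[OF f] by simp
      then show "inv_into (topspace X) f x \<in> topspace X" "x = f (inv_into (topspace X) f x)"
        using f_inv_into_f[of x f "topspace X"] by (simp_all add: inv_into_into)
    next
      assume "y \<in> topspace X"
      then show "f y \<in> topspace X" "y = inv_into (topspace X) f (f y)"
        using full_mapsD(4)[OF f] inv_into_f_f[OF full_mapsD(3)[OF f]] by auto
    qed
    then show "(x, y) \<in> ?l \<longleftrightarrow> (x, y) \<in> ?r" by (auto simp: mem_graph_iff)
  qed
  then show "(\<lambda>x\<in>topspace X. inv_into (topspace X) f x) \<in> full_maps X M"
    unfolding full_maps_def mem_Collect_eq
    using conv[OF full_mapsD(2)[OF f]] restrict_inv_into_Bij[OF full_mapsD(1)[OF f]] by metis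
qed

text \<open>The complement of the support is the interior of the set of fixed points, which is the largest
  clopen set on which \<open>g\<close> is the identity.\<close>

lemma support_full_map:
  assumes g: "g \<in> full_maps X M"
  shows "clopenin X (homeo_support X g)"
proof -
  obtain U where U: "clopenin X U" "Id_on U \<subseteq> graph (topspace X) g"
    "\<And>V. clopenin X V \<Longrightarrow> Id_on V \<subseteq> graph (topspace X) g \<Longrightarrow> V \<subseteq> U"
    using fixed[OF full_mapsD(2)[OF g]] by metis
  let ?N = "{x \<in> topspace X. g x \<noteq> x}"
  have "X closure_of ?N = topspace X - U"
  proof
    have "?N \<subseteq> topspace X - U" using U(2) by (auto simp: graph_def)
    moreover have "closedin X (topspace X - U)" using U(1) unfolding clopenin_def by blast
    ultimately show "X closure_of ?N \<subseteq> topspace X - U" by (rule closure_of_minimal)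
    show "topspace X - U \<subseteq> X closure_of ?N"
    proof
      fix x assume x: "x \<in> topspace X - U"
      have "\<exists>y. y \<in> ?N \<and> y \<in> T" if T: "x \<in> T" "openin X T" for T
      proof (rule ccontr)
        assume no: "\<nexists>y. y \<in> ?N \<and> y \<in> T"
        obtain V where V: "clopenin X V" "x \<in> V" "V \<subseteq> T" using stone_space_clopen_base[OF stone T(2,1)] .
        have "v \<in> topspace X \<and> v = g v" if "v \<in> V" for v
          using no V(3) clopenin_subset[OF V(1)] that by (metis (mono_tags, lifting) mem_Collect_eq subsetD)
        then have "Id_on V \<subseteq> graph (topspace X) g" by (auto simp: mem_graph_iff)
        then show False using U(3)[OF V(1)] V(2) x by blast
      qed
      then show "x \<in> X closure_of ?N" using x unfolding in_closure_of by blast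
    qed
  qed
  then show ?thesis unfolding homeo_support_def using clopenin_Diff[OF clopenin_topspace U(1)] by simp
qed

text \<open>The graph of the glued map is a finite union of elements of \<open>M\<close>, and it is a partial bijection
  because the images of the pieces are disjoint.\<close>

lemma full_maps_glue:
  assumes p: "clopen_partition X n e" and g: "\<And>i. i < n \<Longrightarrow> g i \<in> full_maps X M"
    and q: "clopen_partition X n (\<lambda>i. g i ` e i)"
    and h: "h \<in> extensional (topspace X)" "\<And>i x. i < n \<Longrightarrow> x \<in> e i \<Longrightarrow> h x = g i x"
  shows "h \<in> full_maps X M"
proof -
  have e: "\<And>i. i < n \<Longrightarrow> clopenin X (e i)" and eU: "(\<Union>i<n. e i) = topspace X"
    and gU: "(\<Union>i<n. g i ` e i) = topspace X" and gd: "disjoint_family_on (\<lambda>i. g i ` e i) {..<n}"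
    using p q by (auto simp: clopen_partition_def)
  have inj: "inj_on h (topspace X)"
  proof (rule inj_onI)
    fix x y assume xy: "x \<in> topspace X" "y \<in> topspace X" "h x = h y"
    obtain i j where ij: "i < n" "x \<in> e i" "j < n" "y \<in> e j" using xy eU by blast
    then have eq: "g i x = g j y" using h(2) xy(3) by metis
    have "i = j"
    proof (rule ccontr)
      assume "i \<noteq> j"
      then have "g i ` e i \<inter> g j ` e j = {}" using gd ij unfolding disjoint_family_on_def by blast
      then show False using eq ij by blast
    qed
    then show "x = y" using eq xy full_mapsD(3)[OF g[OF ij(1)]] by (auto dest: inj_onD)
  qed
  have "h ` topspace X = (\<Union>i<n. h ` e i)" using eU by blast
  also have "\<dots> = (\<Union>i<n. g i ` e i)" using h(2) by auto
  finally have "h ` topspace X = topspace X" using gU by simp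
  then have B: "h \<in> Bij (topspace X)" using inj h(1) by (simp add: Bij_def bij_betw_def)
  have eq: "graph (topspace X) h = (\<Union>i<n. Id_on (e i) O graph (topspace X) (g i))"
  proof (intro equalityI subsetI)
    fix p assume "p \<in> graph (topspace X) h"
    then obtain x where x: "p = (x, h x)" "x \<in> topspace X" by (auto simp: graph_def)
    then obtain i where i: "i < n" "x \<in> e i" using eU by blast
    then have "(x, h x) \<in> Id_on (e i) O graph (topspace X) (g i)"
      using x h(2) by (intro relcompI[of x x]) (auto simp: mem_graph_iff)
    then show "p \<in> (\<Union>i<n. Id_on (e i) O graph (topspace X) (g i))" using i x by blast
  next
    fix p assume "p \<in> (\<Union>i<n. Id_on (e i) O graph (topspace X) (g i))"
    then show "p \<in> graph (topspace X) h" using h(2) by (auto simp: mem_graph_iff graph_def)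
  qed
  have "(\<Union>i<n. Id_on (e i) O graph (topspace X) (g i)) \<in> M"
  proof (rule finite_union)
    have "Id_on (e i) O graph (topspace X) (g i) \<in> M" if "i < n" for i
      using comp Id_on_iff e[OF that] full_mapsD(2)[OF g[OF that]] by blast
    then show "(\<lambda>i. Id_on (e i) O graph (topspace X) (g i)) ` {..<n} \<subseteq> M" by blast
    show "partial_bij (\<Union>i<n. Id_on (e i) O graph (topspace X) (g i))"
      using partial_bij_graph[OF inj] eq by simp
  qed simp
  then show ?thesis using B eq by (simp add: full_maps_def)
qed

theorem cantor_group_full_maps:
  assumes "is_cantor_space X" "countable M"
  shows "cantor_group X (full_maps X M)"
proof (intro cantor_group.intro stone_group.intro cantor_group_axioms.intro)
  show "is_stone_space X" by (rule stone)
  show "subgroup (full_maps X M) (homeo_group X)" by (rule subgroup_full_maps)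
  show "is_cantor_space X" by fact
  have "graph (topspace X) ` full_maps X M \<subseteq> M" using full_mapsD(2) by blast
  then have "countable (graph (topspace X) ` full_maps X M)" using assms(2) countable_subset by blast
  moreover have "inj_on (graph (topspace X)) (full_maps X M)"
    by (rule inj_onI) (use graph_inject full_mapsD(5) in blast)
  ultimately show "countable (full_maps X M)" using countable_image_inj_on by blast
qed (fact support_full_map full_maps_glue)+

end

section \<open>From pseudogroups to Tarski inverse monoids\<close>

text \<open>Products in \<open>S\<close> stand for composition of maps, whereas relation composition reads from left to
  right; hence \<open>\<rho>\<close> reverses the factors.\<close>

locale pseudogroup_model = pseudogroup X M + monoid S
  for X :: "'b topology" and M and S (structure) +
  fixes \<rho> :: "'a \<Rightarrow> ('b \<times> 'b) set"
  assumes rho_bij: "bij_betw \<rho> (carrier S) M"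
    and rho_mult: "a \<in> carrier S \<Longrightarrow> b \<in> carrier S \<Longrightarrow> \<rho> (a \<otimes> b) = \<rho> b O \<rho> a"
    and rho_one: "\<rho> \<one> = Id_on (topspace X)"
begin

definition lift :: "('b \<times> 'b) set \<Rightarrow> 'a" where
  "lift r = inv_into (carrier S) \<rho> r"

definition dom :: "'a \<Rightarrow> 'b set" where
  "dom e = Domain (\<rho> e)"

lemma rho_mem: "a \<in> carrier S \<Longrightarrow> \<rho> a \<in> M"
  using rho_bij by (auto simp: bij_betw_def)

lemma rho_inject: "a \<in> carrier S \<Longrightarrow> b \<in> carrier S \<Longrightarrow> \<rho> a = \<rho> b \<longleftrightarrow> a = b"
  using rho_bij by (auto simp: bij_betw_def inj_on_def)

lemma rho_lift: "r \<in> M \<Longrightarrow> \<rho> (lift r) = r"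
  using rho_bij by (auto simp: lift_def bij_betw_def f_inv_into_f)

lemma lift_closed: "r \<in> M \<Longrightarrow> lift r \<in> carrier S"
  using rho_bij by (auto simp: lift_def bij_betw_def inv_into_into)

lemma rho_pbij: "a \<in> carrier S \<Longrightarrow> partial_bij (\<rho> a)"
  using pbij rho_mem by blast

text \<open>The first equation gives \<open>r\<inverse> \<subseteq> q\<close> for a partial bijection \<open>r\<close>, and the second gives the converse
  inclusion.\<close>

lemma inverse_pair_iff:
  assumes "s \<in> carrier S" "t \<in> carrier S"
  shows "s = s \<otimes> t \<otimes> s \<and> t = t \<otimes> s \<otimes> t \<longleftrightarrow> \<rho> t = (\<rho> s)\<inverse>"
proof -
  have "s = s \<otimes> t \<otimes> s \<longleftrightarrow> \<rho> s = \<rho> s O (\<rho> t O \<rho> s)"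
    using assms rho_inject[of s "s \<otimes> t \<otimes> s"] by (simp add: rho_mult)
  moreover have "t = t \<otimes> s \<otimes> t \<longleftrightarrow> \<rho> t = \<rho> t O (\<rho> s O \<rho> t)"
    using assms rho_inject[of t "t \<otimes> s \<otimes> t"] by (simp add: rho_mult)
  moreover have "r = r O (q O r) \<and> q = q O (r O q) \<longleftrightarrow> q = r\<inverse>"
    if "partial_bij r" "partial_bij q" for r q :: "('b \<times> 'b) set"
  proof
    have sub: "u\<inverse> \<subseteq> v" if uv: "partial_bij u" "u = u O (v O u)" for u v :: "('b \<times> 'b) set"
    proof clarify
      fix x y assume "(x, y) \<in> u"
      then obtain y' x' where "(x, y') \<in> u" "(y', x') \<in> v" "(x', y) \<in> u" using uv(2) by blast
      then show "(y, x) \<in> v" using partial_bijD[OF uv(1)] \<open>(x, y) \<in> u\<close> by metis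
    qed
    assume "r = r O (q O r) \<and> q = q O (r O q)"
    then have "r\<inverse> \<subseteq> q" "q\<inverse> \<subseteq> r" using sub[of r q] sub[of q r] that by blast+
    then show "q = r\<inverse>" by auto
  next
    assume q: "q = r\<inverse>"
    have "u = u O (u\<inverse> O u)" if u: "partial_bij u" for u :: "('b \<times> 'b) set"
    proof
      show "u \<subseteq> u O (u\<inverse> O u)" by auto
      show "u O (u\<inverse> O u) \<subseteq> u"
      proof clarify
        fix x y a b assume "(x, a) \<in> u" "(b, a) \<in> u" "(b, y) \<in> u"
        then show "(x, y) \<in> u" using partial_bijD(2)[OF u] by metis
      qed
    qed
    from this[of r] this[of q] that show "r = r O (q O r) \<and> q = q O (r O q)" by (simp add: q)
  qed
  ultimately show ?thesis using rho_pbij assms by metis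
qed

lemma inverse_monoid_model: "inverse_monoid S"
proof (intro inverse_monoid.intro inverse_monoid_axioms.intro)
  show "monoid S" by unfold_locales
  fix s assume s: "s \<in> carrier S"
  show "\<exists>!t. t \<in> carrier S \<and> s = s \<otimes> t \<otimes> s \<and> t = t \<otimes> s \<otimes> t"
  proof
    note c = conv[OF rho_mem[OF s]]
    show "lift ((\<rho> s)\<inverse>) \<in> carrier S \<and> s = s \<otimes> lift ((\<rho> s)\<inverse>) \<otimes> s \<and>
        lift ((\<rho> s)\<inverse>) = lift ((\<rho> s)\<inverse>) \<otimes> s \<otimes> lift ((\<rho> s)\<inverse>)"
      using inverse_pair_iff[OF s lift_closed[OF c]] rho_lift[OF c] lift_closed[OF c] by blast
    fix t assume "t \<in> carrier S \<and> s = s \<otimes> t \<otimes> s \<and> t = t \<otimes> s \<otimes> t"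
    then have "t \<in> carrier S" "\<rho> t = \<rho> (lift ((\<rho> s)\<inverse>))"
      using inverse_pair_iff[OF s] rho_lift[OF c] by blast+
    then show "t = lift ((\<rho> s)\<inverse>)" using rho_inject[OF _ lift_closed[OF c]] by blast
  qed
next
  have "lift {} \<otimes> s = lift {} \<and> s \<otimes> lift {} = lift {}" if "s \<in> carrier S" for s
    using that lift_closed[OF empty_mem] rho_lift[OF empty_mem]
    by (simp add: rho_inject[symmetric] rho_mult)
  then show "\<exists>z\<in>carrier S. \<forall>s\<in>carrier S. z \<otimes> s = z \<and> s \<otimes> z = z"
    using lift_closed[OF empty_mem] by blast
qed

lemma star: 
  assumes s: "s \<in> carrier S"
  shows "star S s \<in> carrier S" "\<rho> (star S s) = (\<rho> s)\<inverse>"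
proof -
  have "star S s \<in> carrier S \<and> s = s \<otimes> star S s \<otimes> s \<and> star S s = star S s \<otimes> s \<otimes> star S s"
    unfolding star_def using inverse_monoid.unique_inverse[OF inverse_monoid_model s] by (rule theI')
  then show "star S s \<in> carrier S" "\<rho> (star S s) = (\<rho> s)\<inverse>" using inverse_pair_iff[OF s] by auto
qed

lemma zero_of_eq: "zero_of S = lift {}"
  unfolding zero_of_def
proof (rule the_equality)
  have *: "lift {} \<otimes> s = lift {} \<and> s \<otimes> lift {} = lift {}" if "s \<in> carrier S" for s
    using that lift_closed[OF empty_mem] rho_lift[OF empty_mem]
    by (simp add: rho_inject[symmetric] rho_mult)
  then show "lift {} \<in> carrier S \<and> (\<forall>s\<in>carrier S. lift {} \<otimes> s = lift {} \<and> s \<otimes> lift {} = lift {})"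
    using lift_closed[OF empty_mem] by blast
  fix z assume "z \<in> carrier S \<and> (\<forall>s\<in>carrier S. z \<otimes> s = z \<and> s \<otimes> z = z)"
  then show "z = lift {}" using * lift_closed[OF empty_mem] by metis
qed

lemma idempotents_iff: "e \<in> idempotents S \<longleftrightarrow> e \<in> carrier S \<and> \<rho> e \<subseteq> Id"
proof -
  have "\<rho> e O \<rho> e = \<rho> e \<longleftrightarrow> \<rho> e \<subseteq> Id" if e: "e \<in> carrier S"
  proof
    assume eq: "\<rho> e O \<rho> e = \<rho> e"
    show "\<rho> e \<subseteq> Id"
    proof (rule subrelI)
      fix x y assume xy: "(x, y) \<in> \<rho> e"
      then obtain z where "(x, z) \<in> \<rho> e" "(z, y) \<in> \<rho> e" using eq by blast
      then show "(x, y) \<in> Id" using xy partial_bijD[OF rho_pbij[OF e]] by (metis pair_in_Id_conv)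
    qed
  next
    assume "\<rho> e \<subseteq> Id"
    then show "\<rho> e O \<rho> e = \<rho> e" by auto
  qed
  moreover have "e \<otimes> e = e \<longleftrightarrow> \<rho> e O \<rho> e = \<rho> e" if "e \<in> carrier S"
    using that rho_inject[of "e \<otimes> e" e] by (simp add: rho_mult)
  ultimately show ?thesis unfolding idempotents_def by blast
qed

lemma rho_idem: "e \<in> idempotents S \<Longrightarrow> \<rho> e = Id_on (dom e)"
  unfolding idempotents_iff dom_def by (auto simp: Id_on_def)

lemma dom_clopen: "e \<in> carrier S \<Longrightarrow> clopenin X (dom e)"
  unfolding dom_def using clopen_Domain rho_mem by blast

lemma dom_subset: "e \<in> idempotents S \<Longrightarrow> dom e \<subseteq> topspace X"
  using clopenin_subset[OF dom_clopen] by (simp add: idempotents_iff)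

lemma dom_inject: "e \<in> idempotents S \<Longrightarrow> f \<in> idempotents S \<Longrightarrow> dom e = dom f \<longleftrightarrow> e = f"
  using rho_idem rho_inject idempotents_iff by metis

definition idem :: "'b set \<Rightarrow> 'a" where
  "idem U = lift (Id_on U)"

lemma rho_idem_of: "clopenin X U \<Longrightarrow> \<rho> (idem U) = Id_on U"
  using rho_lift Id_on_iff by (simp add: idem_def)

lemma idem_mem: "clopenin X U \<Longrightarrow> idem U \<in> idempotents S"
  unfolding idempotents_iff using rho_idem_of lift_closed Id_on_iff by (auto simp: idem_def)

lemma dom_idem: "clopenin X U \<Longrightarrow> dom (idem U) = U"
  by (simp add: dom_def rho_idem_of)

lemma idem_dom: "e \<in> idempotents S \<Longrightarrow> idem (dom e) = e"
  using dom_inject dom_idem idem_mem dom_clopen idempotents_iff by metis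

lemma one_idempotent: "\<one> \<in> idempotents S" and dom_one: "dom \<one> = topspace X"
  unfolding idempotents_iff dom_def by (auto simp: rho_one)

lemma dom_mult: "e \<in> idempotents S \<Longrightarrow> f \<in> idempotents S \<Longrightarrow> e \<otimes> f \<in> idempotents S \<and> dom (e \<otimes> f) = dom e \<inter> dom f"
proof -
  assume ef: "e \<in> idempotents S" "f \<in> idempotents S"
  then have c: "e \<in> carrier S" "f \<in> carrier S" by (auto simp: idempotents_iff)
  have "\<rho> (e \<otimes> f) = Id_on (dom e \<inter> dom f)"
    using rho_idem[OF ef(1)] rho_idem[OF ef(2)] rho_mult[OF c] by auto
  then show ?thesis using c by (auto simp: idempotents_iff dom_def[of "e \<otimes> f"])
qed

subsection \<open>The natural order\<close>

lemma natural_poset_simps [simp]: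
  "carrier (natural_poset S) = carrier S" "le (natural_poset S) s t \<longleftrightarrow> s = t \<otimes> star S s \<otimes> s"
  by (simp_all add: natural_poset_def)

lemma natural_le_iff:
  assumes s: "s \<in> carrier S" and t: "t \<in> carrier S"
  shows "s = t \<otimes> star S s \<otimes> s \<longleftrightarrow> \<rho> s \<subseteq> \<rho> t"
proof -
  have "s = t \<otimes> star S s \<otimes> s \<longleftrightarrow> \<rho> s = \<rho> s O ((\<rho> s)\<inverse> O \<rho> t)"
    using s t star[OF s] rho_inject[of s "t \<otimes> star S s \<otimes> s"] by (simp add: rho_mult)
  also have "\<dots> \<longleftrightarrow> \<rho> s \<subseteq> \<rho> t"
  proof
    assume *: "\<rho> s = \<rho> s O ((\<rho> s)\<inverse> O \<rho> t)"
    show "\<rho> s \<subseteq> \<rho> t"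
    proof clarify
      fix x y assume "(x, y) \<in> \<rho> s"
      then have "(x, y) \<in> \<rho> s O ((\<rho> s)\<inverse> O \<rho> t)" using equalityD1[OF *] by (rule subsetD[rotated])
      then obtain a b where "(x, a) \<in> \<rho> s" "(b, a) \<in> \<rho> s" "(b, y) \<in> \<rho> t" by auto
      then show "(x, y) \<in> \<rho> t" using partial_bijD(2)[OF rho_pbij[OF s]] by metis
    qed
  next
    assume *: "\<rho> s \<subseteq> \<rho> t"
    show "\<rho> s = \<rho> s O ((\<rho> s)\<inverse> O \<rho> t)"
    proof (intro equalityI subsetI; clarify)
      fix x y assume "(x, y) \<in> \<rho> s"
      then show "(x, y) \<in> \<rho> s O ((\<rho> s)\<inverse> O \<rho> t)" using * by blast
    next
      fix x a b y assume xy: "(x, a) \<in> \<rho> s" "(b, a) \<in> \<rho> s" "(b, y) \<in> \<rho> t"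
      then have "(b, a) \<in> \<rho> t" "x = b" using * partial_bijD(2)[OF rho_pbij[OF s]] by blast+
      then show "(x, y) \<in> \<rho> s" using xy partial_bijD(1)[OF rho_pbij[OF t]] by metis
    qed
  qed
  finally show ?thesis .
qed

text \<open>An upper bound of \<open>a\<close> and \<open>b\<close> forces the union of their relations to be a partial bijection, so
  that the union itself belongs to \<open>M\<close>. This also shows that multiplication distributes over joins,
  as relation composition distributes over unions.\<close>

lemma is_join_iff:
  assumes a: "a \<in> carrier S" and b: "b \<in> carrier S"
  shows "is_join S a b c \<longleftrightarrow> c \<in> carrier S \<and> \<rho> c = \<rho> a \<union> \<rho> b"
proof -
  have U: "u \<in> Upper (natural_poset S) {a, b} \<longleftrightarrow> u \<in> carrier S \<and> \<rho> a \<union> \<rho> b \<subseteq> \<rho> u" for u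
    using a b natural_le_iff by (auto simp: Upper_def)
  show ?thesis
  proof
    assume "is_join S a b c"
    then have L: "c \<in> Upper (natural_poset S) {a, b}"
        "\<forall>u\<in>Upper (natural_poset S) {a, b}. c = u \<otimes> star S c \<otimes> c"
      unfolding is_join_def least_def natural_poset_simps by auto
    have c: "c \<in> carrier S" "\<rho> a \<union> \<rho> b \<subseteq> \<rho> c" using L(1) unfolding U by auto
    have least: "\<rho> c \<subseteq> \<rho> u" if "u \<in> carrier S" "\<rho> a \<union> \<rho> b \<subseteq> \<rho> u" for u
      using L(2) U[of u] that natural_le_iff[OF c(1) that(1)] by blast
    have "\<rho> a \<union> \<rho> b \<in> M"
      using union[OF rho_mem[OF a] rho_mem[OF b]] partial_bij_subset[OF rho_pbij[OF c(1)] c(2)] by blast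
    then have "\<rho> c \<subseteq> \<rho> a \<union> \<rho> b" using least[of "lift (\<rho> a \<union> \<rho> b)"] lift_closed rho_lift by simp
    then show "c \<in> carrier S \<and> \<rho> c = \<rho> a \<union> \<rho> b" using c by blast
  next
    assume c: "c \<in> carrier S \<and> \<rho> c = \<rho> a \<union> \<rho> b"
    show "is_join S a b c"
      unfolding is_join_def least_def
    proof (intro conjI ballI)
      show "Upper (natural_poset S) {a, b} \<subseteq> carrier (natural_poset S)" by (auto simp: Upper_def)
      show "c \<in> Upper (natural_poset S) {a, b}" using U c by simp
      fix u assume "u \<in> Upper (natural_poset S) {a, b}"
      then show "c \<sqsubseteq>\<^bsub>natural_poset S\<^esub> u" using U[of u] c natural_le_iff by simp
    qed
  qed
qed

lemma compatible_iff:
  assumes a: "a \<in> carrier S" and b: "b \<in> carrier S"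
  shows "compatible S a b \<longleftrightarrow> partial_bij (\<rho> a \<union> \<rho> b)"
proof -
  have "compatible S a b \<longleftrightarrow> (\<rho> b)\<inverse> O \<rho> a \<subseteq> Id \<and> \<rho> b O (\<rho> a)\<inverse> \<subseteq> Id"
    using a b star[OF a] star[OF b] by (simp add: compatible_def idempotents_iff rho_mult)
  also have "\<dots> \<longleftrightarrow> partial_bij (\<rho> a \<union> \<rho> b)"
  proof
    assume *: "(\<rho> b)\<inverse> O \<rho> a \<subseteq> Id \<and> \<rho> b O (\<rho> a)\<inverse> \<subseteq> Id"
    then have "\<And>x y z. (x, y) \<in> \<rho> b \<Longrightarrow> (x, z) \<in> \<rho> a \<Longrightarrow> y = z" "\<And>x y z. (y, x) \<in> \<rho> b \<Longrightarrow> (z, x) \<in> \<rho> a \<Longrightarrow> y = z"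
      by blast+
    with partial_bijD[OF rho_pbij[OF a]] partial_bijD[OF rho_pbij[OF b]]
    show "partial_bij (\<rho> a \<union> \<rho> b)" by (intro partial_bijI) (metis UnE)+
  next
    assume "partial_bij (\<rho> a \<union> \<rho> b)"
    from partial_bijD[OF this] show "(\<rho> b)\<inverse> O \<rho> a \<subseteq> Id \<and> \<rho> b O (\<rho> a)\<inverse> \<subseteq> Id" by blast
  qed
  finally show ?thesis .
qed

lemma meet_exists:
  assumes a: "a \<in> carrier S" and b: "b \<in> carrier S"
  shows "\<exists>c. is_meet S a b c"
proof -
  have "\<rho> a O (\<rho> b)\<inverse> \<in> M" using comp conv rho_mem a b by blast
  then obtain U where U: "clopenin X U" "Id_on U \<subseteq> \<rho> a O (\<rho> b)\<inverse>"
    "\<And>V. clopenin X V \<Longrightarrow> Id_on V \<subseteq> \<rho> a O (\<rho> b)\<inverse> \<Longrightarrow> V \<subseteq> U"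
    using fixed by metis
  define c where "c = lift (Id_on U O \<rho> a)"
  have "Id_on U O \<rho> a \<in> M" using comp Id_on_iff U(1) rho_mem[OF a] by blast
  then have c: "c \<in> carrier S" "\<rho> c = Id_on U O \<rho> a" using lift_closed rho_lift by (auto simp: c_def)
  have L: "u \<in> Lower (natural_poset S) {a, b} \<longleftrightarrow> u \<in> carrier S \<and> \<rho> u \<subseteq> \<rho> a \<inter> \<rho> b" for u
    using a b natural_le_iff by (auto simp: Lower_def)
  have "\<rho> c \<subseteq> \<rho> b"
  proof
    fix p assume "p \<in> \<rho> c"
    then obtain x y where xy: "p = (x, y)" "x \<in> U" "(x, y) \<in> \<rho> a" unfolding c by blast
    then obtain z where "(x, z) \<in> \<rho> a" "(x, z) \<in> \<rho> b" using U(2) by blast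
    then show "p \<in> \<rho> b" using xy partial_bijD(1)[OF rho_pbij[OF a]] by metis
  qed
  moreover have "\<rho> u \<subseteq> \<rho> c" if u: "u \<in> carrier S" "\<rho> u \<subseteq> \<rho> a \<inter> \<rho> b" for u
  proof -
    have "Id_on (Domain (\<rho> u)) \<subseteq> \<rho> a O (\<rho> b)\<inverse>" using u(2) by auto
    then have "Domain (\<rho> u) \<subseteq> U" using U(3) clopen_Domain[OF rho_mem[OF u(1)]] by blast
    then show ?thesis using u(2) unfolding c by auto
  qed
  ultimately have "is_meet S a b c"
    unfolding is_meet_def greatest_def using L c natural_le_iff by (auto simp: Lower_def)
  then show ?thesis by blast
qed

lemma distributive_inverse_monoid_model: "distributive_inverse_monoid S"
proof (intro distributive_inverse_monoid.intro distributive_inverse_monoid_axioms.intro)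
  show "inverse_monoid S" by (rule inverse_monoid_model)
  show "\<exists>c. is_join S a b c" if ab: "a \<in> carrier S" "b \<in> carrier S" "compatible S a b" for a b
  proof -
    have "\<rho> a \<union> \<rho> b \<in> M" using union rho_mem compatible_iff ab by blast
    then show ?thesis using is_join_iff[OF ab(1,2)] lift_closed rho_lift by blast
  qed
next
  fix s a b c assume abc: "s \<in> carrier S" "a \<in> carrier S" "b \<in> carrier S" "is_join S a b c"
  then have c: "c \<in> carrier S" "\<rho> c = \<rho> a \<union> \<rho> b" using is_join_iff by auto
  show "is_join S (s \<otimes> a) (s \<otimes> b) (s \<otimes> c)" "is_join S (a \<otimes> s) (b \<otimes> s) (c \<otimes> s)"
    using abc c by (simp_all add: is_join_iff rho_mult relcomp_distrib relcomp_distrib2)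
qed

text \<open>An element that takes \<open>x\<close> to \<open>y \<noteq> x\<close> does not commute with the identity of a clopen set that
  contains \<open>x\<close> and not \<open>y\<close>.\<close>

lemma fundamental_model: "fundamental S"
  unfolding fundamental_def
proof (intro ballI impI)
  fix s assume s: "s \<in> carrier S" and comm: "\<forall>e\<in>idempotents S. s \<otimes> e = e \<otimes> s"
  have "x = y" if xy: "(x, y) \<in> \<rho> s" for x y
  proof (rule ccontr)
    assume "x \<noteq> y"
    then obtain U where U: "clopenin X U" "x \<in> U" "y \<notin> U"
      using stone_space_separate[OF stone] in_topspace[OF rho_mem[OF s] xy] by metis
    have "\<rho> (s \<otimes> idem U) = \<rho> (idem U \<otimes> s)" using comm idem_mem[OF U(1)] by simp
    then have "Id_on U O \<rho> s = \<rho> s O Id_on U"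
      using s idem_mem[OF U(1)] rho_idem_of[OF U(1)] by (simp add: rho_mult idempotents_iff)
    moreover have "(x, y) \<in> Id_on U O \<rho> s" using xy U(2) by blast
    ultimately show False using U(3) by blast
  qed
  then show "s \<in> idempotents S" using s by (auto simp: idempotents_iff)
qed

subsection \<open>The Boolean algebra of idempotents\<close>

abbreviation "E \<equiv> idem_poset S"

lemma idem_poset_carrier [simp]: "carrier E = idempotents S"
  by (simp add: idem_poset_def)

lemma idem_poset_le: "e \<in> idempotents S \<Longrightarrow> f \<in> idempotents S \<Longrightarrow> e \<sqsubseteq>\<^bsub>E\<^esub> f \<longleftrightarrow> dom e \<subseteq> dom f"
  using dom_mult dom_inject by (simp add: idem_poset_def) (metis inf.absorb_iff1)

lemma idem_poset_least_upper:
  assumes "e \<in> idempotents S" "f \<in> idempotents S"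
  shows "least E (idem (dom e \<union> dom f)) (Upper E {e, f})"
proof -
  have c: "clopenin X (dom e \<union> dom f)"
    using assms by (auto simp: idempotents_iff intro!: dom_clopen clopenin_Un)
  show ?thesis
  proof (rule least_UpperI)
    fix y assume "y \<in> Upper E {e, f}"
    then have "y \<in> idempotents S" "e \<sqsubseteq>\<^bsub>E\<^esub> y" "f \<sqsubseteq>\<^bsub>E\<^esub> y" using assms by (auto simp: Upper_def)
    then show "idem (dom e \<union> dom f) \<sqsubseteq>\<^bsub>E\<^esub> y"
      using assms idem_mem[OF c] dom_idem[OF c] by (simp add: idem_poset_le)
  qed (use assms idem_mem[OF c] dom_idem[OF c] in \<open>auto simp: idem_poset_le\<close>)
qed

lemma idem_poset_greatest_lower:
  assumes "e \<in> idempotents S" "f \<in> idempotents S"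
  shows "greatest E (e \<otimes> f) (Lower E {e, f})"
proof (rule greatest_LowerI)
  fix y assume "y \<in> Lower E {e, f}"
  then have "y \<in> idempotents S" "y \<sqsubseteq>\<^bsub>E\<^esub> e" "y \<sqsubseteq>\<^bsub>E\<^esub> f" using assms by (auto simp: Lower_def)
  then show "y \<sqsubseteq>\<^bsub>E\<^esub> e \<otimes> f" using assms dom_mult[OF assms] by (simp add: idem_poset_le)
qed (use assms dom_mult[OF assms] in \<open>auto simp: idem_poset_le\<close>)

lemma partial_order_idem_poset: "partial_order E"
proof
  fix x y assume "x \<sqsubseteq>\<^bsub>E\<^esub> y" "y \<sqsubseteq>\<^bsub>E\<^esub> x" "x \<in> carrier E" "y \<in> carrier E"
  then show "x .=\<^bsub>E\<^esub> y" using dom_inject by (auto simp: idem_poset_le) (simp add: idem_poset_def)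
next
  fix x y z assume "x \<sqsubseteq>\<^bsub>E\<^esub> y" "y \<sqsubseteq>\<^bsub>E\<^esub> z" "x \<in> carrier E" "y \<in> carrier E" "z \<in> carrier E"
  then show "x \<sqsubseteq>\<^bsub>E\<^esub> z" by (auto simp: idem_poset_le)
next
  fix x assume "x \<in> carrier E"
  then show "x \<sqsubseteq>\<^bsub>E\<^esub> x" by (auto simp: idem_poset_le)
qed (auto simp: idem_poset_def)

lemma bounded_lattice_idem_poset: "Lattice.bounded_lattice E"
proof -
  interpret partial_order E by (rule partial_order_idem_poset)
  show ?thesis
  proof
    show "\<exists>s. least E s (Upper E {x, y})" if "x \<in> carrier E" "y \<in> carrier E" for x y
      using idem_poset_least_upper that by auto
    show "\<exists>s. greatest E s (Lower E {x, y})" if "x \<in> carrier E" "y \<in> carrier E" for x y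
      using idem_poset_greatest_lower that by auto
    have "least E (idem {}) (carrier E)"
      using idem_mem[OF clopenin_empty] dom_idem[OF clopenin_empty] by (auto simp: least_def idem_poset_le)
    then show "\<exists>x. least E x (carrier E)" by blast
    have "greatest E \<one> (carrier E)"
      using one_idempotent dom_one dom_subset by (simp add: greatest_def idem_poset_le)
    then show "\<exists>x. greatest E x (carrier E)" by blast
  qed
qed

lemma idem_poset_ops:
  assumes "e \<in> idempotents S" "f \<in> idempotents S"
  shows "e \<squnion>\<^bsub>E\<^esub> f = idem (dom e \<union> dom f)" "e \<sqinter>\<^bsub>E\<^esub> f = e \<otimes> f"
    "dom (e \<squnion>\<^bsub>E\<^esub> f) = dom e \<union> dom f" "dom (e \<sqinter>\<^bsub>E\<^esub> f) = dom e \<inter> dom f"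
proof -
  interpret Lattice.bounded_lattice E by (rule bounded_lattice_idem_poset)
  have "least E (e \<squnion>\<^bsub>E\<^esub> f) (Upper E {e, f})"
    unfolding join_def using assms by (intro sup_of_two_least) simp_all
  then show j: "e \<squnion>\<^bsub>E\<^esub> f = idem (dom e \<union> dom f)" using least_unique idem_poset_least_upper[OF assms] by blast
  have "greatest E (e \<sqinter>\<^bsub>E\<^esub> f) (Lower E {e, f})"
    unfolding meet_def using assms by (intro inf_of_two_greatest) simp_all
  then show m: "e \<sqinter>\<^bsub>E\<^esub> f = e \<otimes> f" using greatest_unique idem_poset_greatest_lower[OF assms] by blast
  show "dom (e \<squnion>\<^bsub>E\<^esub> f) = dom e \<union> dom f"
    using j assms by (simp add: idempotents_iff dom_idem clopenin_Un dom_clopen)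
  show "dom (e \<sqinter>\<^bsub>E\<^esub> f) = dom e \<inter> dom f" using m dom_mult[OF assms] by simp
qed

lemma idem_poset_bounds: "\<bottom>\<^bsub>E\<^esub> = idem {}" "\<top>\<^bsub>E\<^esub> = \<one>"
proof -
  interpret Lattice.bounded_lattice E by (rule bounded_lattice_idem_poset)
  have "idem {} \<sqsubseteq>\<^bsub>E\<^esub> x" if "x \<in> carrier E" for x
    using that idem_mem[OF clopenin_empty] dom_idem[OF clopenin_empty] by (simp add: idem_poset_le)
  then show "\<bottom>\<^bsub>E\<^esub> = idem {}" using bottom_eq[of "idem {}"] idem_mem[OF clopenin_empty] by simp
  have "x \<sqsubseteq>\<^bsub>E\<^esub> \<one>" if "x \<in> carrier E" for x
    using that one_idempotent dom_one dom_subset by (simp add: idem_poset_le)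
  then show "\<top>\<^bsub>E\<^esub> = \<one>" using top_eq[of "\<one>"] one_idempotent by simp
qed

lemma boolean_lattice_idem_poset: "boolean_lattice E"
proof -
  interpret Lattice.bounded_lattice E by (rule bounded_lattice_idem_poset)
  show ?thesis
  proof
    fix x y z assume c: "x \<in> carrier E" "y \<in> carrier E" "z \<in> carrier E"
    note d = meet_closed[OF c(1,2)] meet_closed[OF c(1,3)] join_closed[OF c(2,3)]
    note cl = c d meet_closed[OF c(1) d(3)] join_closed[OF d(1,2)]
    note mem = cl[unfolded idem_poset_carrier]
    have "dom (x \<sqinter>\<^bsub>E\<^esub> (y \<squnion>\<^bsub>E\<^esub> z)) = dom ((x \<sqinter>\<^bsub>E\<^esub> y) \<squnion>\<^bsub>E\<^esub> (x \<sqinter>\<^bsub>E\<^esub> z))"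
      using mem by (simp add: idem_poset_ops(3,4) Int_Un_distrib)
    then show "x \<sqinter>\<^bsub>E\<^esub> (y \<squnion>\<^bsub>E\<^esub> z) = (x \<sqinter>\<^bsub>E\<^esub> y) \<squnion>\<^bsub>E\<^esub> (x \<sqinter>\<^bsub>E\<^esub> z)"
      using dom_inject[OF mem(7,8)] by blast
  next
    fix x assume x: "x \<in> carrier E"
    define U where "U = topspace X - dom x"
    have dx: "clopenin X (dom x)" using x dom_clopen by (simp add: idempotents_iff)
    then have U: "clopenin X U" unfolding U_def using clopenin_Diff[OF clopenin_topspace] by blast
    have xU: "x \<in> idempotents S" "idem U \<in> idempotents S" using x idem_mem[OF U] by auto
    have "dom (x \<sqinter>\<^bsub>E\<^esub> idem U) = dom (idem {})" "dom (x \<squnion>\<^bsub>E\<^esub> idem U) = dom \<one>"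
      unfolding idem_poset_ops(3,4)[OF xU] dom_idem[OF U] dom_idem[OF clopenin_empty] dom_one
      using clopenin_subset[OF dx] by (auto simp: U_def)
    moreover have "x \<sqinter>\<^bsub>E\<^esub> idem U \<in> idempotents S" "x \<squnion>\<^bsub>E\<^esub> idem U \<in> idempotents S"
      using meet_closed[of x "idem U"] join_closed[of x "idem U"] xU by simp_all
    ultimately have "x \<sqinter>\<^bsub>E\<^esub> idem U = \<bottom>\<^bsub>E\<^esub>" "x \<squnion>\<^bsub>E\<^esub> idem U = \<top>\<^bsub>E\<^esub>"
      using dom_inject idem_mem[OF clopenin_empty] one_idempotent unfolding idem_poset_bounds by blast+
    then show "\<exists>y\<in>carrier E. x \<sqinter>\<^bsub>E\<^esub> y = \<bottom>\<^bsub>E\<^esub> \<and> x \<squnion>\<^bsub>E\<^esub> y = \<top>\<^bsub>E\<^esub>"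
      using idem_mem[OF U] by auto
  qed
qed

theorem tarski_inverse_monoid_model:
  assumes "is_cantor_space X" "countable M"
  shows "tarski_inverse_monoid S"
proof (intro tarski_inverse_monoid.intro boolean_inverse_meet_monoid.intro boolean_inverse_monoid.intro
    boolean_inverse_meet_monoid_axioms.intro boolean_inverse_monoid_axioms.intro tarski_inverse_monoid_axioms.intro)
  show "distributive_inverse_monoid S" by (rule distributive_inverse_monoid_model)
  show "boolean_lattice E" by (rule boolean_lattice_idem_poset)
  show "\<exists>c. is_meet S a b c" if "a \<in> carrier S" "b \<in> carrier S" for a b using meet_exists that by blast
  show cS: "countable (carrier S)"
    using assms(2) rho_bij by (metis bij_betw_def countable_image_inj_on)
  show "countable_atomless_boolean_lattice E"
  proof (intro countable_atomless_boolean_lattice.intro countable_atomless_boolean_lattice_axioms.intro)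
    show "boolean_lattice E" by (rule boolean_lattice_idem_poset)
    show "countable (carrier E)" using cS by (rule countable_subset[rotated]) (auto simp: idempotents_iff)
    have "dom (idem {}) \<noteq> dom \<one>"
      using assms(1) unfolding is_cantor_space_iff dom_idem[OF clopenin_empty] dom_one by blast
    then show "\<bottom>\<^bsub>E\<^esub> \<noteq> \<top>\<^bsub>E\<^esub>" by (auto simp: idem_poset_bounds)
    fix x assume x: "x \<in> carrier E" "x \<noteq> \<bottom>\<^bsub>E\<^esub>"
    have "dom x \<noteq> {}"
    proof
      assume "dom x = {}"
      then have "x = idem {}" using idem_dom[of x] x(1) by simp
      then show False using x(2) by (simp add: idem_poset_bounds)
    qed
    moreover have "clopenin X (dom x)" using x dom_clopen by (simp add: idempotents_iff)
    ultimately obtain V where V: "clopenin X V" "V \<noteq> {}" "V \<subset> dom x"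
      using assms(1) unfolding is_cantor_space_iff by meson
    have "idem V \<sqsubset>\<^bsub>E\<^esub> x"
      using V x idem_mem[OF V(1)] dom_idem[OF V(1)] by (auto simp: lless_def idem_poset_le) (auto simp: idem_poset_def)
    moreover have "idem V \<noteq> \<bottom>\<^bsub>E\<^esub>"
      using V dom_idem[OF V(1)] dom_idem[OF clopenin_empty] by (auto simp: idem_poset_bounds)
    ultimately show "\<exists>y\<in>carrier E. y \<noteq> \<bottom>\<^bsub>E\<^esub> \<and> y \<sqsubset>\<^bsub>E\<^esub> x" using idem_mem[OF V(1)] by auto
  qed
qed

end

section \<open>Calculation in inverse monoids\<close>

context inverse_monoid
begin

lemma star_closed [simp]: "s \<in> carrier S \<Longrightarrow> star S s \<in> carrier S"
  and star_inverse: "s \<in> carrier S \<Longrightarrow> s = s \<otimes> star S s \<otimes> s \<and> star S s = star S s \<otimes> s \<otimes> star S s"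
  using theI'[OF unique_inverse] unfolding star_def by blast+

lemma mult_star: "s \<in> carrier S \<Longrightarrow> s \<otimes> (star S s \<otimes> s) = s"
  "s \<in> carrier S \<Longrightarrow> star S s \<otimes> (s \<otimes> star S s) = star S s"
  using star_inverse[of s] by (simp_all add: m_assoc)

lemma star_eqI:
  assumes "s \<in> carrier S" "t \<in> carrier S" "s \<otimes> (t \<otimes> s) = s" "t \<otimes> (s \<otimes> t) = t"
  shows "star S s = t"
  using unique_inverse[OF assms(1)] star_inverse[OF assms(1)] star_closed[OF assms(1)] assms m_assoc by metis

lemma star_star [simp]: "s \<in> carrier S \<Longrightarrow> star S (star S s) = s"
  by (rule star_eqI) (simp_all add: mult_star)

lemma idem_closed: "e \<in> idempotents S \<Longrightarrow> e \<in> carrier S"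
  and idem_mult_self: "e \<in> idempotents S \<Longrightarrow> e \<otimes> e = e"
  by (auto simp: idempotents_def)

lemma star_idem: "e \<in> idempotents S \<Longrightarrow> star S e = e"
  by (rule star_eqI) (simp_all add: idem_closed idem_mult_self)

lemma one_idem [simp]: "\<one> \<in> idempotents S"
  by (simp add: idempotents_def)

text \<open>Uniqueness of inverses makes \<open>x = (e f)\<^sup>\<star>\<close> equal to \<open>f x e\<close>, which is idempotent; so \<open>e f\<close>, the
  inverse of \<open>x\<close>, is idempotent as well.\<close>

lemma idem_mult:
  assumes e: "e \<in> idempotents S" and f: "f \<in> idempotents S"
  shows "e \<otimes> f \<in> idempotents S"
proof -
  note [simp] = idem_closed[OF e] idem_closed[OF f]
  define x where "x = star S (e \<otimes> f)"
  have x [simp]: "x \<in> carrier S" by (simp add: x_def)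
  have ee: "e \<otimes> (e \<otimes> y) = e \<otimes> y" "f \<otimes> (f \<otimes> y) = f \<otimes> y" if "y \<in> carrier S" for y
    using that idem_mult_self[OF e] idem_mult_self[OF f] by (simp_all add: m_assoc[symmetric])
  have one: "x \<otimes> (e \<otimes> (f \<otimes> x)) = x" "e \<otimes> (f \<otimes> (x \<otimes> (e \<otimes> f))) = e \<otimes> f"
    using mult_star[of "e \<otimes> f"] by (simp_all add: x_def m_assoc)
  have two: "x \<otimes> (e \<otimes> (f \<otimes> (x \<otimes> y))) = x \<otimes> y" if "y \<in> carrier S" for y
  proof -
    have "x \<otimes> (e \<otimes> (f \<otimes> (x \<otimes> y))) = (x \<otimes> (e \<otimes> (f \<otimes> x))) \<otimes> y" using that by (simp add: m_assoc)
    then show ?thesis by (simp add: one)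
  qed
  have "star S (e \<otimes> f) = f \<otimes> (x \<otimes> e)"
    by (rule star_eqI) (simp_all add: m_assoc ee one two)
  then have fxe: "f \<otimes> (x \<otimes> e) = x" by (simp add: x_def)
  have "x \<otimes> x = (f \<otimes> (x \<otimes> e)) \<otimes> (f \<otimes> (x \<otimes> e))" by (simp add: fxe)
  also have "\<dots> = f \<otimes> (x \<otimes> e)" by (simp add: m_assoc two)
  finally have "x \<in> idempotents S" by (simp add: idempotents_def fxe)
  then have "star S x \<in> idempotents S" using star_idem by simp
  then show ?thesis by (simp add: x_def)
qed

lemma idem_commute:
  assumes e: "e \<in> idempotents S" and f: "f \<in> idempotents S"
  shows "e \<otimes> f = f \<otimes> e"
proof -
  note [simp] = idem_closed[OF e] idem_closed[OF f]
  have ee: "e \<otimes> (e \<otimes> y) = e \<otimes> y" "f \<otimes> (f \<otimes> y) = f \<otimes> y" if "y \<in> carrier S" for y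
    using that idem_mult_self[OF e] idem_mult_self[OF f] by (simp_all add: m_assoc[symmetric])
  have "star S (e \<otimes> f) = f \<otimes> e"
    using idem_mult_self[OF idem_mult[OF e f]] idem_mult_self[OF idem_mult[OF f e]]
    by (intro star_eqI) (simp_all add: m_assoc ee)
  then show ?thesis using star_idem[OF idem_mult[OF e f]] by simp
qed

lemma idem_left_commute:
  "e \<in> idempotents S \<Longrightarrow> f \<in> idempotents S \<Longrightarrow> x \<in> carrier S \<Longrightarrow> e \<otimes> (f \<otimes> x) = f \<otimes> (e \<otimes> x)"
  using idem_commute[of e f] m_assoc[of e f x] m_assoc[of f e x] by (simp add: idem_closed)

lemma idem_absorb: "e \<in> idempotents S \<Longrightarrow> x \<in> carrier S \<Longrightarrow> e \<otimes> (e \<otimes> x) = e \<otimes> x"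
  using idem_mult_self[of e] m_assoc[of e e x] by (simp add: idem_closed)

lemma star_mult_idem: "s \<in> carrier S \<Longrightarrow> star S s \<otimes> s \<in> idempotents S"
  and mult_star_idem: "s \<in> carrier S \<Longrightarrow> s \<otimes> star S s \<in> idempotents S"
  by (simp_all add: idempotents_def m_assoc mult_star)

lemma mult_star_absorb: "s \<in> carrier S \<Longrightarrow> x \<in> carrier S \<Longrightarrow> s \<otimes> (star S s \<otimes> (s \<otimes> x)) = s \<otimes> x"
  "s \<in> carrier S \<Longrightarrow> x \<in> carrier S \<Longrightarrow> star S s \<otimes> (s \<otimes> (star S s \<otimes> x)) = star S s \<otimes> x"
  using mult_star[of s] m_assoc[of s "star S s \<otimes> s" x] m_assoc[of "star S s" "s \<otimes> star S s" x]
  by (simp_all add: m_assoc)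

lemma star_mult:
  assumes [simp]: "a \<in> carrier S" "b \<in> carrier S"
  shows "star S (a \<otimes> b) = star S b \<otimes> star S a"
proof (rule star_eqI)
  have c: "b \<otimes> (star S b \<otimes> (star S a \<otimes> (a \<otimes> x))) = star S a \<otimes> (a \<otimes> (b \<otimes> (star S b \<otimes> x)))"
    if [simp]: "x \<in> carrier S" for x
    using idem_left_commute[OF mult_star_idem[of b] star_mult_idem[of a], of x] by (simp add: m_assoc)
  show "a \<otimes> b \<otimes> (star S b \<otimes> star S a \<otimes> (a \<otimes> b)) = a \<otimes> b"
    by (simp add: m_assoc c mult_star mult_star_absorb)
  show "star S b \<otimes> star S a \<otimes> (a \<otimes> b \<otimes> (star S b \<otimes> star S a)) = star S b \<otimes> star S a"
    by (simp add: m_assoc c[symmetric] mult_star mult_star_absorb)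
qed simp_all

lemma conj_mult:
  assumes "s \<in> carrier S" "e \<in> idempotents S" "f \<in> idempotents S"
  shows "(star S s \<otimes> e \<otimes> s) \<otimes> (star S s \<otimes> f \<otimes> s) = star S s \<otimes> (e \<otimes> f) \<otimes> s"
proof -
  note [simp] = assms(1) idem_closed[OF assms(2)] idem_closed[OF assms(3)]
  have "e \<otimes> (s \<otimes> (star S s \<otimes> (f \<otimes> s))) = s \<otimes> (star S s \<otimes> (e \<otimes> (f \<otimes> s)))"
    using idem_left_commute[OF assms(2) mult_star_idem[of s], of "f \<otimes> s"] by (simp add: m_assoc)
  then show ?thesis by (simp add: m_assoc mult_star_absorb)
qed

lemma conj_idem: "s \<in> carrier S \<Longrightarrow> e \<in> idempotents S \<Longrightarrow> star S s \<otimes> e \<otimes> s \<in> idempotents S"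
  using conj_mult[of s e e] idem_mult_self[of e] by (simp add: idempotents_def)

lemma conj_idem': "s \<in> carrier S \<Longrightarrow> e \<in> idempotents S \<Longrightarrow> s \<otimes> e \<otimes> star S s \<in> idempotents S"
  using conj_idem[of "star S s" e] by simp

lemma idem_shift:
  assumes [simp]: "s \<in> carrier S" and e: "e \<in> idempotents S"
  shows "s \<otimes> e = (s \<otimes> e \<otimes> star S s) \<otimes> s"
proof -
  note [simp] = idem_closed[OF e]
  have "s \<otimes> (e \<otimes> (star S s \<otimes> s)) = s \<otimes> ((star S s \<otimes> s) \<otimes> e)"
    using idem_commute[OF e star_mult_idem[of s]] by simp
  then show ?thesis by (simp add: m_assoc mult_star_absorb)
qed

lemma zero_exists_bottom:
  obtains z where "z \<in> idempotents S" "\<And>s. s \<in> carrier S \<Longrightarrow> z \<otimes> s = z" "\<And>s. s \<in> carrier S \<Longrightarrow> s \<otimes> z = z"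
  using zero_exists unfolding idempotents_def by blast

abbreviation "E \<equiv> idem_poset S"

lemma idem_poset_simps [simp]:
  "carrier E = idempotents S" "e \<sqsubseteq>\<^bsub>E\<^esub> f \<longleftrightarrow> e = e \<otimes> f"
  by (simp_all add: idem_poset_def)

lemma natural_poset_simps [simp]:
  "carrier (natural_poset S) = carrier S" "s \<sqsubseteq>\<^bsub>natural_poset S\<^esub> t \<longleftrightarrow> s = t \<otimes> star S s \<otimes> s"
  by (simp_all add: natural_poset_def)

lemma natural_le_one: "s \<in> carrier S \<Longrightarrow> s = \<one> \<otimes> star S s \<otimes> s \<longleftrightarrow> s \<in> idempotents S"
  using star_mult_idem[of s] star_idem[of s] idem_mult_self[of s] by auto

lemma is_join_idem:
  assumes e: "e \<in> idempotents S" and f: "f \<in> idempotents S" and j: "is_join S e f c"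
  shows "c \<in> idempotents S" "least E c (Upper E {e, f})"
proof -
  have le: "d \<sqsubseteq>\<^bsub>natural_poset S\<^esub> d' \<longleftrightarrow> d \<sqsubseteq>\<^bsub>E\<^esub> d'" if "d \<in> idempotents S" "d' \<in> idempotents S" for d d'
    using that star_idem[OF that(1)] idem_commute[OF that] idem_mult_self[OF that(1)]
    by (simp add: m_assoc idem_closed)
  have c: "c \<in> Upper (natural_poset S) {e, f}"
    and least: "\<And>u. u \<in> Upper (natural_poset S) {e, f} \<Longrightarrow> c \<sqsubseteq>\<^bsub>natural_poset S\<^esub> u"
    using j unfolding is_join_def least_def by blast+
  have "\<one> \<in> Upper (natural_poset S) {e, f}"
    using e f by (auto simp: Upper_def star_idem idem_mult_self idem_closed)
  then have "c \<sqsubseteq>\<^bsub>natural_poset S\<^esub> \<one>" by (rule least)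
  then show cE: "c \<in> idempotents S" using c natural_le_one[of c] by (auto simp: Upper_def)
  show "least E c (Upper E {e, f})"
  proof (rule least_UpperI)
    show "x \<sqsubseteq>\<^bsub>E\<^esub> c" if "x \<in> {e, f}" for x
      using that c e f le[OF _ cE] by (auto simp: Upper_def idem_closed simp del: natural_poset_simps(2) idem_poset_simps(2))
    fix y assume "y \<in> Upper E {e, f}"
    then have y: "y \<in> idempotents S" "e \<sqsubseteq>\<^bsub>E\<^esub> y" "f \<sqsubseteq>\<^bsub>E\<^esub> y" using e f by (auto simp: Upper_def)
    then have "y \<in> Upper (natural_poset S) {e, f}"
      using le[OF e y(1)] le[OF f y(1)] by (auto simp: Upper_def idem_closed simp del: natural_poset_simps(2) idem_poset_simps(2))
    then show "c \<sqsubseteq>\<^bsub>E\<^esub> y" using least le[OF cE y(1)] by blast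
  qed (use e f cE in auto)
qed

end

section \<open>The Stone representation of a Boolean inverse monoid\<close>

text \<open>The partial action on ultrafilters: \<open>s\<close> is defined at \<open>F\<close> when \<open>s\<^sup>\<star>s \<in> F\<close>, and then sends \<open>F\<close> to
  the upward closure of \<open>s F s\<^sup>\<star>\<close>, which is \<open>{e. s\<^sup>\<star>es \<in> F}\<close>.\<close>

definition push :: "('a, 'm) monoid_scheme \<Rightarrow> 'a \<Rightarrow> 'a set \<Rightarrow> 'a set" where
  "push S s F = {e \<in> idempotents S. star S s \<otimes>\<^bsub>S\<^esub> e \<otimes>\<^bsub>S\<^esub> s \<in> F}"

definition stone_rep :: "('a, 'm) monoid_scheme \<Rightarrow> 'a \<Rightarrow> ('a set \<times> 'a set) set" where
  "stone_rep S s = {(F, G). F \<in> ultrafilters (idem_poset S) \<and> star S s \<otimes>\<^bsub>S\<^esub> s \<in> F \<and> G = push S s F}"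

context boolean_inverse_monoid
begin

sublocale B: boolean_lattice E by (rule boolean_idempotents)

lemma idem_meet: 
  assumes e: "e \<in> idempotents S" and f: "f \<in> idempotents S"
  shows "e \<sqinter>\<^bsub>E\<^esub> f = e \<otimes> f"
proof -
  note [simp] = idem_closed[OF e] idem_closed[OF f]
  have "greatest E (e \<otimes> f) (Lower E {e, f})"
  proof (rule greatest_LowerI)
    show "e \<otimes> f \<sqsubseteq>\<^bsub>E\<^esub> x" if "x \<in> {e, f}" for x
    proof -
      have "e \<otimes> f \<otimes> e = e \<otimes> f"
        using idem_commute[OF f e] idem_absorb[OF e, of f] by (simp add: m_assoc)
      moreover have "e \<otimes> f \<otimes> f = e \<otimes> f" using idem_mult_self[OF f] by (simp add: m_assoc)
      ultimately show ?thesis using that by auto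
    qed
    fix y assume "y \<in> Lower E {e, f}"
    then have "y \<in> idempotents S" "y = y \<otimes> e" "y = y \<otimes> f" using e f by (auto simp: Lower_def)
    then show "y \<sqsubseteq>\<^bsub>E\<^esub> e \<otimes> f" using m_assoc[of y e f] idem_closed[of y] by simp
  qed (use e f idem_mult in auto)
  moreover have "greatest E (e \<sqinter>\<^bsub>E\<^esub> f) (Lower E {e, f})"
    unfolding meet_def using e f by (intro B.inf_of_two_greatest) simp_all
  ultimately show ?thesis using B.greatest_unique by blast
qed

lemma idem_join:
  assumes "e \<in> idempotents S" "f \<in> idempotents S" "is_join S e f c"
  shows "e \<squnion>\<^bsub>E\<^esub> f = c"
proof -
  have "least E (e \<squnion>\<^bsub>E\<^esub> f) (Upper E {e, f})"
    unfolding join_def using assms by (intro B.sup_of_two_least) simp_all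
  then show ?thesis using B.least_unique is_join_idem(2)[OF assms] by blast
qed

lemma idem_top: "\<top>\<^bsub>E\<^esub> = \<one>"
proof -
  have "x \<sqsubseteq>\<^bsub>E\<^esub> \<one>" if "x \<in> carrier E" for x using that idem_closed[of x] by simp
  then show ?thesis using B.top_eq[of "\<one>"] by simp
qed

lemma idem_bottom: "s \<in> carrier S \<Longrightarrow> \<bottom>\<^bsub>E\<^esub> \<otimes> s = \<bottom>\<^bsub>E\<^esub>" "s \<in> carrier S \<Longrightarrow> s \<otimes> \<bottom>\<^bsub>E\<^esub> = \<bottom>\<^bsub>E\<^esub>"
proof -
  obtain z where z: "z \<in> idempotents S" "\<And>s. s \<in> carrier S \<Longrightarrow> z \<otimes> s = z" "\<And>s. s \<in> carrier S \<Longrightarrow> s \<otimes> z = z"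
    using zero_exists_bottom by blast
  have "z \<sqsubseteq>\<^bsub>E\<^esub> x" if "x \<in> carrier E" for x using that z(2)[of x] idem_closed[of x] by simp
  then have "z = \<bottom>\<^bsub>E\<^esub>" using B.bottom_eq[of z] z(1) by simp
  then show "s \<in> carrier S \<Longrightarrow> \<bottom>\<^bsub>E\<^esub> \<otimes> s = \<bottom>\<^bsub>E\<^esub>" "s \<in> carrier S \<Longrightarrow> s \<otimes> \<bottom>\<^bsub>E\<^esub> = \<bottom>\<^bsub>E\<^esub>" using z by auto
qed

lemma idem_join_exists:
  assumes "e \<in> idempotents S" "f \<in> idempotents S"
  shows "is_join S e f (e \<squnion>\<^bsub>E\<^esub> f)"
proof -
  have "compatible S e f"
    using assms idem_mult by (simp add: compatible_def star_idem)
  then obtain c where "is_join S e f c" using compatible_join assms idem_closed by blast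
  then show ?thesis using idem_join assms by simp
qed

lemma conj_join:
  assumes s: "s \<in> carrier S" and e: "e \<in> idempotents S" and f: "f \<in> idempotents S"
  shows "star S s \<otimes> (e \<squnion>\<^bsub>E\<^esub> f) \<otimes> s = (star S s \<otimes> e \<otimes> s) \<squnion>\<^bsub>E\<^esub> (star S s \<otimes> f \<otimes> s)"
proof -
  have "is_join S (star S s \<otimes> e) (star S s \<otimes> f) (star S s \<otimes> (e \<squnion>\<^bsub>E\<^esub> f))"
    using mult_join_left[OF star_closed[OF s] idem_closed[OF e] idem_closed[OF f] idem_join_exists[OF e f]] .
  then have "is_join S (star S s \<otimes> e \<otimes> s) (star S s \<otimes> f \<otimes> s) (star S s \<otimes> (e \<squnion>\<^bsub>E\<^esub> f) \<otimes> s)"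
    using s e f by (intro mult_join_right) (simp_all add: idem_closed)
  then show ?thesis using idem_join conj_idem s e f by metis
qed

subsection \<open>Ultrafilters of idempotents\<close>

abbreviation "UF \<equiv> ultrafilters E"

lemma UF_subset: "F \<in> UF \<Longrightarrow> e \<in> F \<Longrightarrow> e \<in> idempotents S"
  using B.proper_filterD(1)[OF ultrafilter_proper] by auto

lemma UF_mult_iff: "F \<in> UF \<Longrightarrow> e \<in> idempotents S \<Longrightarrow> f \<in> idempotents S \<Longrightarrow> e \<otimes> f \<in> F \<longleftrightarrow> e \<in> F \<and> f \<in> F"
  using B.ultrafilter_meet_iff[of F e f] by (simp add: idem_meet)

lemma UF_one: "F \<in> UF \<Longrightarrow> \<one> \<in> F"
  using B.proper_filter_top[OF ultrafilter_proper] idem_top by simp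

lemma UF_bottom: "F \<in> UF \<Longrightarrow> \<bottom>\<^bsub>E\<^esub> \<notin> F"
  using B.proper_filterD(3)[OF ultrafilter_proper] by simp

text \<open>The map \<open>e \<mapsto> s\<^sup>\<star>es\<close> preserves meets, joins and the bottom element, and takes the top element to
  \<open>s\<^sup>\<star>s\<close>; so the preimage of an ultrafilter that contains \<open>s\<^sup>\<star>s\<close> is an ultrafilter.\<close>

lemma push_UF:
  assumes F: "F \<in> UF" and s [simp]: "s \<in> carrier S" and d: "star S s \<otimes> s \<in> F"
  shows "push S s F \<in> UF"
proof (rule B.ultrafilterI)
  show "proper_filter E (push S s F)"
    unfolding proper_filter_def
  proof (intro conjI ballI impI)
    show "push S s F \<subseteq> carrier E" by (auto simp: push_def)
    have "\<one> \<in> push S s F" using d by (simp add: push_def)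
    then show "push S s F \<noteq> {}" by blast
    show "\<bottom>\<^bsub>E\<^esub> \<notin> push S s F" using UF_bottom[OF F] by (simp add: push_def idem_bottom)
  next
    fix x y assume x: "x \<in> push S s F" and y: "y \<in> carrier E" and xy: "x \<sqsubseteq>\<^bsub>E\<^esub> y"
    then have xE: "x \<in> idempotents S" "star S s \<otimes> x \<otimes> s \<in> F" "y \<in> idempotents S" by (auto simp: push_def)
    have "(star S s \<otimes> x \<otimes> s) \<otimes> (star S s \<otimes> y \<otimes> s) \<in> F"
      using conj_mult[OF s xE(1,3)] xy xE(2) by simp
    then have "star S s \<otimes> y \<otimes> s \<in> F" using UF_mult_iff[OF F] conj_idem xE s by blast
    then show "y \<in> push S s F" using xE by (simp add: push_def)
  next
    fix x y assume "x \<in> push S s F" "y \<in> push S s F"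
    then have xE: "x \<in> idempotents S" "star S s \<otimes> x \<otimes> s \<in> F" "y \<in> idempotents S" "star S s \<otimes> y \<otimes> s \<in> F"
      by (auto simp: push_def)
    then have "star S s \<otimes> (x \<otimes> y) \<otimes> s \<in> F"
      using conj_mult[OF s xE(1,3)] UF_mult_iff[OF F conj_idem[OF s xE(1)] conj_idem[OF s xE(3)]] by simp
    then show "x \<sqinter>\<^bsub>E\<^esub> y \<in> push S s F" using xE idem_mult by (simp add: push_def idem_meet)
  qed
next
  fix x y assume "x \<in> carrier E" "y \<in> carrier E" "x \<squnion>\<^bsub>E\<^esub> y = \<top>\<^bsub>E\<^esub>"
  then have xy: "x \<in> idempotents S" "y \<in> idempotents S" "x \<squnion>\<^bsub>E\<^esub> y = \<one>" by (auto simp: idem_top)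
  have "(star S s \<otimes> x \<otimes> s) \<squnion>\<^bsub>E\<^esub> (star S s \<otimes> y \<otimes> s) \<in> F"
    using conj_join[OF s xy(1,2)] xy(3) d by simp
  then show "x \<in> push S s F \<or> y \<in> push S s F"
    using B.ultrafilter_join_iff[OF F, of "star S s \<otimes> x \<otimes> s" "star S s \<otimes> y \<otimes> s"] conj_idem[OF s] xy(1,2)
    by (simp add: push_def)
qed

lemma stone_rep_iff:
  "(F, G) \<in> stone_rep S s \<longleftrightarrow> F \<in> UF \<and> star S s \<otimes> s \<in> F \<and> G = push S s F"
  by (simp add: stone_rep_def)

lemma Domain_stone_rep: "s \<in> carrier S \<Longrightarrow> Domain (stone_rep S s) = basic_open E (star S s \<otimes> s)"
  by (auto simp: stone_rep_def basic_open_def)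

lemma stone_rep_idem:
  assumes e: "e \<in> idempotents S"
  shows "stone_rep S e = Id_on (basic_open E e)"
proof -
  have "push S e F = F" if F: "F \<in> UF" "e \<in> F" for F
  proof -
    have "e \<otimes> f \<otimes> e \<in> F \<longleftrightarrow> f \<in> F" if f: "f \<in> idempotents S" for f
      using UF_mult_iff[OF F(1) idem_mult[OF e f] e] UF_mult_iff[OF F(1) e f] F(2) by blast
    then show ?thesis using UF_subset[OF F(1)] by (auto simp: push_def star_idem[OF e])
  qed
  then show ?thesis
    using idem_mult_self[OF e] by (auto simp: stone_rep_def basic_open_def star_idem[OF e])
qed

lemma stone_rep_star_subset:
  assumes s [simp]: "s \<in> carrier S" and FG: "(F, G) \<in> stone_rep S s"
  shows "(G, F) \<in> stone_rep S (star S s)"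
proof -
  have F: "F \<in> UF" "star S s \<otimes> s \<in> F" and G: "G = push S s F" using FG by (auto simp: stone_rep_iff)
  have "G \<in> UF" using push_UF[OF F(1) s F(2)] G by simp
  moreover have "s \<otimes> star S s \<in> G"
    using F(2) mult_star_idem[OF s] by (simp add: G push_def m_assoc mult_star)
  moreover have "e \<in> push S (star S s) G \<longleftrightarrow> e \<in> F" for e
  proof (cases "e \<in> idempotents S")
    case True
    note [simp] = idem_closed[OF True]
    let ?d = "star S s \<otimes> s"
    have "star S s \<otimes> (s \<otimes> e \<otimes> star S s) \<otimes> s = (?d \<otimes> e) \<otimes> ?d" by (simp add: m_assoc)
    then have "e \<in> push S (star S s) G \<longleftrightarrow> (?d \<otimes> e) \<otimes> ?d \<in> F"
      using True conj_idem'[OF s True] by (simp add: G push_def)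
    then show ?thesis
      using UF_mult_iff[OF F(1) idem_mult[OF star_mult_idem True] star_mult_idem, of s s]
        UF_mult_iff[OF F(1) star_mult_idem True, of s] F(2) by simp
  next
    case False
    then show ?thesis using UF_subset[OF F(1)] by (auto simp: push_def)
  qed
  then have "F = push S (star S s) G" by blast
  ultimately show ?thesis by (simp add: stone_rep_iff)
qed

lemma stone_rep_star: "s \<in> carrier S \<Longrightarrow> stone_rep S (star S s) = (stone_rep S s)\<inverse>"
  using stone_rep_star_subset[of s] stone_rep_star_subset[of "star S s"] by auto

lemma stone_rep_mult:
  assumes [simp]: "s \<in> carrier S" "t \<in> carrier S"
  shows "stone_rep S (s \<otimes> t) = stone_rep S t O stone_rep S s"
proof -
  have eq: "star S (s \<otimes> t) \<otimes> e \<otimes> (s \<otimes> t) = star S t \<otimes> (star S s \<otimes> e \<otimes> s) \<otimes> t" if "e \<in> carrier S" for e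
    using that by (simp add: star_mult m_assoc)
  have dom: "star S (s \<otimes> t) \<otimes> (s \<otimes> t) \<in> F \<longleftrightarrow> star S t \<otimes> t \<in> F \<and> star S s \<otimes> s \<in> push S t F"
    if F: "F \<in> UF" for F
  proof -
    have st: "star S (s \<otimes> t) \<otimes> (s \<otimes> t) = star S t \<otimes> (star S s \<otimes> s) \<otimes> t" using eq[of \<one>] by simp
    have "(star S t \<otimes> \<one> \<otimes> t) \<otimes> (star S t \<otimes> (star S s \<otimes> s) \<otimes> t) = star S t \<otimes> (star S s \<otimes> s) \<otimes> t"
      using conj_mult[of t \<one> "star S s \<otimes> s"] star_mult_idem[of s] by simp
    then have "star S t \<otimes> (star S s \<otimes> s) \<otimes> t \<in> F \<Longrightarrow> star S t \<otimes> t \<in> F"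
      using UF_mult_iff[OF F conj_idem[of t \<one>] conj_idem[of t "star S s \<otimes> s"]] star_mult_idem[of s] by simp
    then show ?thesis using star_mult_idem[of s] unfolding st by (auto simp: push_def)
  qed
  have push: "push S (s \<otimes> t) F = push S s (push S t F)" for F
    using eq conj_idem[of s] idem_closed by (auto simp: push_def)
  show ?thesis
  proof (intro equalityI subrelI)
    fix F H assume "(F, H) \<in> stone_rep S (s \<otimes> t)"
    then have "F \<in> UF" "star S t \<otimes> t \<in> F" "star S s \<otimes> s \<in> push S t F" "H = push S s (push S t F)"
      using dom push by (auto simp: stone_rep_iff)
    then show "(F, H) \<in> stone_rep S t O stone_rep S s"
      using push_UF by (intro relcompI[of _ "push S t F"]) (auto simp: stone_rep_iff)
  next
    fix F H assume "(F, H) \<in> stone_rep S t O stone_rep S s"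
    then show "(F, H) \<in> stone_rep S (s \<otimes> t)" using dom push by (auto simp: stone_rep_iff)
  qed
qed

lemma single_valued_stone_rep: "single_valued (stone_rep S s)"
  by (auto simp: single_valued_def stone_rep_iff)

lemma partial_bij_stone_rep: "s \<in> carrier S \<Longrightarrow> partial_bij (stone_rep S s)"
  using single_valued_stone_rep[of s] single_valued_stone_rep[of "star S s"]
  by (simp add: partial_bij_def stone_rep_star)

lemma basic_open_inject:
  "e \<in> idempotents S \<Longrightarrow> f \<in> idempotents S \<Longrightarrow> basic_open E e = basic_open E f \<longleftrightarrow> e = f"
  using B.eq_iff_ultrafilters[of e f] by (auto simp: basic_open_def set_eq_iff)

lemma stone_rep_mono:
  assumes "a \<in> carrier S" "c \<in> carrier S" "a = c \<otimes> star S a \<otimes> a"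
  shows "stone_rep S a \<subseteq> stone_rep S c"
proof -
  have "stone_rep S a = stone_rep S (c \<otimes> (star S a \<otimes> a))" using assms m_assoc by (metis star_closed)
  also have "\<dots> = stone_rep S (star S a \<otimes> a) O stone_rep S c" using assms by (simp add: stone_rep_mult)
  also have "\<dots> \<subseteq> stone_rep S c" by (auto simp: stone_rep_idem[OF star_mult_idem[OF assms(1)]])
  finally show ?thesis .
qed

lemma star_mult_below:
  assumes [simp]: "a \<in> carrier S" "c \<in> carrier S" and le: "a = c \<otimes> star S a \<otimes> a"
  shows "star S c \<otimes> a = star S a \<otimes> a"
proof -
  let ?d = "star S a \<otimes> a" and ?e = "star S c \<otimes> c"
  have a: "a = c \<otimes> ?d" using le by (simp add: m_assoc)
  have ed: "?e \<otimes> ?d = star S c \<otimes> a" using a by (simp add: m_assoc)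
  have "star S a = ?d \<otimes> star S c"
    using arg_cong[OF a, of "star S"] star_idem[OF star_mult_idem[of a]] by (simp add: star_mult)
  then have "?d = (?d \<otimes> star S c) \<otimes> (c \<otimes> ?d)" using a by simp
  also have "\<dots> = ?d \<otimes> (?e \<otimes> ?d)" by (simp add: m_assoc)
  also have "\<dots> = ?e \<otimes> ?d"
    using idem_left_commute[OF star_mult_idem[of a] star_mult_idem[of c], of ?d] idem_mult_self[OF star_mult_idem[of a]]
    by simp
  finally show ?thesis using ed by simp
qed

text \<open>Multiplying the join \<open>c\<close> of \<open>a\<close> and \<open>b\<close> by \<open>c\<^sup>\<star>\<close> shows that \<open>c\<^sup>\<star>c\<close> is the join of \<open>a\<^sup>\<star>a\<close> and \<open>b\<^sup>\<star>b\<close>. An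
  ultrafilter in the domain of \<open>c\<close> thus lies in the domain of \<open>a\<close> or in that of \<open>b\<close>, where \<open>c\<close> agrees
  with \<open>a\<close> or \<open>b\<close>.\<close>

lemma stone_rep_join:
  assumes [simp]: "a \<in> carrier S" "b \<in> carrier S" and j: "is_join S a b c"
  shows "stone_rep S c = stone_rep S a \<union> stone_rep S b"
proof -
  have "c \<in> Upper (natural_poset S) {a, b}" using j by (simp add: is_join_def least_def)
  then have c [simp]: "c \<in> carrier S" and le: "a = c \<otimes> star S a \<otimes> a" "b = c \<otimes> star S b \<otimes> b"
    by (auto simp: Upper_def)
  have sub: "stone_rep S a \<subseteq> stone_rep S c" "stone_rep S b \<subseteq> stone_rep S c"
    using stone_rep_mono le by simp_all
  have "is_join S (star S c \<otimes> a) (star S c \<otimes> b) (star S c \<otimes> c)" using j by (intro mult_join_left) simp_all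
  then have "is_join S (star S a \<otimes> a) (star S b \<otimes> b) (star S c \<otimes> c)"
    using star_mult_below[of a c] star_mult_below[of b c] le by simp
  then have d: "(star S a \<otimes> a) \<squnion>\<^bsub>E\<^esub> (star S b \<otimes> b) = star S c \<otimes> c"
    using idem_join star_mult_idem by simp
  have "stone_rep S c \<subseteq> stone_rep S a \<union> stone_rep S b"
  proof (rule subrelI)
    fix F H assume FH: "(F, H) \<in> stone_rep S c"
    then have F: "F \<in> UF" "star S c \<otimes> c \<in> F" by (auto simp: stone_rep_iff)
    then have "star S a \<otimes> a \<in> F \<or> star S b \<otimes> b \<in> F"
      using B.ultrafilter_join_iff[OF F(1), of "star S a \<otimes> a" "star S b \<otimes> b"] d star_mult_idem by simp
    then obtain G where G: "(F, G) \<in> stone_rep S a \<union> stone_rep S b" using F(1) by (auto simp: stone_rep_iff)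
    then have "(F, G) \<in> stone_rep S c" using sub by blast
    then have "G = H" using FH single_valued_stone_rep[of c] by (auto dest: single_valuedD)
    then show "(F, H) \<in> stone_rep S a \<union> stone_rep S b" using G by simp
  qed
  then show ?thesis using sub by blast
qed

text \<open>If \<open>s\<close> and \<open>t\<close> act alike, then \<open>s e s\<^sup>\<star> = t e t\<^sup>\<star>\<close> for all idempotents \<open>e\<close>, by Stone duality. Hence
  \<open>t\<^sup>\<star>s\<close> commutes with all idempotents, so it is idempotent when the monoid is fundamental; thus
  \<open>s = t t\<^sup>\<star>s\<close> lies below \<open>t\<close> and has the same domain.\<close>

lemma stone_rep_inject:
  assumes fund: "fundamental S" and [simp]: "s \<in> carrier S" "t \<in> carrier S"
    and eq: "stone_rep S s = stone_rep S t"
  shows "s = t"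
proof -
  have conj: "s \<otimes> e \<otimes> star S s = t \<otimes> e \<otimes> star S t" if e: "e \<in> idempotents S" for e
  proof -
    note [simp] = idem_closed[OF e]
    have "stone_rep S (s \<otimes> e \<otimes> star S s) = stone_rep S (t \<otimes> e \<otimes> star S t)"
      by (simp add: stone_rep_mult stone_rep_star eq)
    then show ?thesis
      using conj_idem'[of s e] conj_idem'[of t e] e by (simp add: stone_rep_idem basic_open_inject)
  qed
  have ran: "s \<otimes> star S s = t \<otimes> star S t" using conj[of \<one>] by simp
  have dom: "star S s \<otimes> s = star S t \<otimes> t"
    using Domain_stone_rep[of s] Domain_stone_rep[of t] eq star_mult_idem basic_open_inject by simp
  have "star S t \<otimes> s \<otimes> e = e \<otimes> (star S t \<otimes> s)" if e: "e \<in> idempotents S" for e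
  proof -
    note [simp] = idem_closed[OF e]
    have "s \<otimes> e = t \<otimes> e \<otimes> star S t \<otimes> s" using idem_shift[of s e] conj[OF e] e by simp
    then have "star S t \<otimes> s \<otimes> e = (star S t \<otimes> t) \<otimes> (e \<otimes> (star S t \<otimes> s))" by (simp add: m_assoc)
    also have "\<dots> = e \<otimes> ((star S t \<otimes> t) \<otimes> (star S t \<otimes> s))"
      by (rule idem_left_commute) (use e star_mult_idem in simp_all)
    finally show ?thesis by (simp add: m_assoc mult_star_absorb)
  qed
  then have g: "star S t \<otimes> s \<in> idempotents S" using fund unfolding fundamental_def by simp
  let ?g = "star S t \<otimes> s"
  have "s = (s \<otimes> star S s) \<otimes> s" by (simp add: m_assoc mult_star)
  also have "\<dots> = t \<otimes> ?g" by (simp add: ran m_assoc)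
  finally have s: "s = t \<otimes> ?g" .
  have "star S t \<otimes> t = star S (t \<otimes> ?g) \<otimes> (t \<otimes> ?g)" using dom s by simp
  also have "\<dots> = ?g \<otimes> ((star S t \<otimes> t) \<otimes> ?g)"
    using star_mult[of t ?g] star_idem[OF g] by (simp add: m_assoc)
  also have "\<dots> = (star S t \<otimes> t) \<otimes> ?g"
    using idem_left_commute[OF g star_mult_idem[of t], of ?g] idem_mult_self[OF g] by simp
  finally have "t \<otimes> (star S t \<otimes> t) = t \<otimes> ((star S t \<otimes> t) \<otimes> ?g)" by simp
  then have "t = t \<otimes> ?g" by (simp add: m_assoc mult_star mult_star_absorb)
  then show ?thesis using s by simp
qed

end

section \<open>From Tarski inverse monoids to pseudogroups\<close>

context tarski_inverse_monoid
begin

lemma stone_rep_le_imp: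
  assumes fund: "fundamental S" and [simp]: "s \<in> carrier S" and e: "e \<in> idempotents S"
    and le: "stone_rep S e \<subseteq> stone_rep S s"
  shows "e = s \<otimes> star S e \<otimes> e"
proof -
  note [simp] = idem_closed[OF e]
  have "stone_rep S (s \<otimes> e) = stone_rep S e"
  proof
    show "stone_rep S (s \<otimes> e) \<subseteq> stone_rep S e"
    proof (rule subrelI)
      fix F G assume "(F, G) \<in> stone_rep S (s \<otimes> e)"
      then have "(F, F) \<in> stone_rep S e" "(F, G) \<in> stone_rep S s"
        by (auto simp: stone_rep_mult stone_rep_idem[OF e])
      then have "F = G" using le single_valued_stone_rep[of s] by (auto dest: single_valuedD)
      then show "(F, G) \<in> stone_rep S e" using \<open>(F, F) \<in> stone_rep S e\<close> by simp
    qed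
    show "stone_rep S e \<subseteq> stone_rep S (s \<otimes> e)"
      using le by (auto simp: stone_rep_mult stone_rep_idem[OF e])
  qed
  then have "s \<otimes> e = e" using stone_rep_inject[OF fund, of "s \<otimes> e" e] by simp
  then show ?thesis using idem_mult_self[OF e] by (simp add: star_idem[OF e] m_assoc)
qed

text \<open>The largest clopen set on which \<open>s\<close> acts as the identity belongs to the meet of \<open>s\<close> and \<open>1\<close>.\<close>

lemma stone_rep_fixed:
  assumes fund: "fundamental S" and s: "s \<in> carrier S"
  shows "\<exists>U. clopenin (stone_space E) U \<and> Id_on U \<subseteq> stone_rep S s \<and>
    (\<forall>V. clopenin (stone_space E) V \<and> Id_on V \<subseteq> stone_rep S s \<longrightarrow> V \<subseteq> U)"
proof -
  obtain m where m: "is_meet S s \<one> m" using binary_meets s by blast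
  have L: "m \<in> Lower (natural_poset S) {s, \<one>}"
    and great: "\<And>u. u \<in> Lower (natural_poset S) {s, \<one>} \<Longrightarrow> u = m \<otimes> star S u \<otimes> u"
    using m unfolding is_meet_def greatest_def by auto
  have mc: "m \<in> carrier S" and ms: "m = s \<otimes> star S m \<otimes> m" and m1: "m = \<one> \<otimes> star S m \<otimes> m"
    using L s by (auto simp: Lower_def)
  have mE: "m \<in> idempotents S" using natural_le_one[OF mc] m1 by simp
  have "clopenin (stone_space E) (basic_open E m)" using B.clopenin_basic_open mE by simp
  moreover have "Id_on (basic_open E m) \<subseteq> stone_rep S s"
    using stone_rep_mono[OF mc s ms] stone_rep_idem[OF mE] by simp
  moreover have "V \<subseteq> basic_open E m"
    if V: "clopenin (stone_space E) V" "Id_on V \<subseteq> stone_rep S s" for V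
  proof -
    obtain e where e: "e \<in> idempotents S" "V = basic_open E e"
      using V(1) B.clopenin_stone_space_iff by auto
    have "e = s \<otimes> star S e \<otimes> e" using stone_rep_le_imp[OF fund s e(1)] V(2) e by (simp add: stone_rep_idem)
    then have "e \<in> Lower (natural_poset S) {s, \<one>}"
      using e(1) by (auto simp: Lower_def idem_closed star_idem idem_mult_self)
    then have "stone_rep S e \<subseteq> stone_rep S m" using stone_rep_mono[OF _ mc great] idem_closed[OF e(1)] by blast
    then show ?thesis using e mE by (simp add: stone_rep_idem)
  qed
  ultimately show ?thesis by blast
qed

text \<open>Closure under unions is where faithfulness enters: if the union of the actions of \<open>a\<close> and \<open>b\<close> is
  a partial bijection, then \<open>ab\<^sup>\<star>\<close> and \<open>a\<^sup>\<star>b\<close> act as identities, so they are idempotent, and \<open>a\<close> and \<open>b\<close>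
  have a join.\<close>

theorem stone_rep_pseudogroup:
  assumes fund: "fundamental S"
  shows "pseudogroup (stone_space E) (stone_rep S ` carrier S)"
proof
  show "is_stone_space (stone_space E)" by (rule B.is_stone_space_stone_space)
next
  fix r assume "r \<in> stone_rep S ` carrier S"
  then obtain s where s: "s \<in> carrier S" "r = stone_rep S s" by blast
  show "partial_bij r" using s partial_bij_stone_rep by simp
  show "r\<inverse> \<in> stone_rep S ` carrier S" using s stone_rep_star[OF s(1)] star_closed by blast
  show "\<exists>U. clopenin (stone_space E) U \<and> Id_on U \<subseteq> r \<and>
    (\<forall>V. clopenin (stone_space E) V \<and> Id_on V \<subseteq> r \<longrightarrow> V \<subseteq> U)"
    using stone_rep_fixed[OF fund s(1)] s(2) by simp
next
  fix U show "Id_on U \<in> stone_rep S ` carrier S \<longleftrightarrow> clopenin (stone_space E) U"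
  proof
    assume "Id_on U \<in> stone_rep S ` carrier S"
    then obtain s where s: "s \<in> carrier S" "stone_rep S s = Id_on U" by force
    have "U = basic_open E (star S s \<otimes> s)" using Domain_stone_rep[OF s(1)] s(2) by simp
    then show "clopenin (stone_space E) U" using B.clopenin_basic_open star_mult_idem[OF s(1)] by simp
  next
    assume "clopenin (stone_space E) U"
    then obtain e where "e \<in> idempotents S" "U = basic_open E e" using B.clopenin_stone_space_iff by auto
    then show "Id_on U \<in> stone_rep S ` carrier S" using stone_rep_idem idem_closed by (metis imageI)
  qed
next
  fix r r' assume "r \<in> stone_rep S ` carrier S" "r' \<in> stone_rep S ` carrier S"
  then obtain a b where a: "a \<in> carrier S" "r = stone_rep S a" and b: "b \<in> carrier S" "r' = stone_rep S b" by blast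
  have "r O r' = stone_rep S (b \<otimes> a)" using a b stone_rep_mult by simp
  then show "r O r' \<in> stone_rep S ` carrier S" using a b by simp
  assume pb: "partial_bij (r \<union> r')"
  have idem: "x \<in> idempotents S" if x: "x \<in> carrier S" "stone_rep S x \<subseteq> Id" for x
  proof -
    have "stone_rep S x = Id_on (Domain (stone_rep S x))" using x(2) by auto
    then have "stone_rep S x = stone_rep S (star S x \<otimes> x)"
      using Domain_stone_rep[OF x(1)] stone_rep_idem[OF star_mult_idem[OF x(1)]] by simp
    then have "x = star S x \<otimes> x" using stone_rep_inject[OF fund x(1)] x(1) by simp
    then show ?thesis using star_mult_idem[OF x(1)] by simp
  qed
  have "r'\<inverse> O r \<subseteq> Id"
  proof (rule subrelI)
    fix x y assume "(x, y) \<in> r'\<inverse> O r"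
    then obtain z where "(z, x) \<in> r'" "(z, y) \<in> r" by blast
    then have "x = y" using partial_bijD(1)[OF pb, of z x y] by blast
    then show "(x, y) \<in> Id" by simp
  qed
  moreover have "r' O r\<inverse> \<subseteq> Id"
  proof (rule subrelI)
    fix x y assume "(x, y) \<in> r' O r\<inverse>"
    then obtain z where "(x, z) \<in> r'" "(y, z) \<in> r" by blast
    then have "x = y" using partial_bijD(2)[OF pb, of x z y] by blast
    then show "(x, y) \<in> Id" by simp
  qed
  ultimately have "stone_rep S (a \<otimes> star S b) \<subseteq> Id" "stone_rep S (star S a \<otimes> b) \<subseteq> Id"
    using a b by (simp_all add: stone_rep_mult stone_rep_star)
  then have "compatible S a b" using idem a b by (simp add: compatible_def)
  then obtain c where c: "is_join S a b c" using compatible_join a b by blast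
  then have "c \<in> carrier S" by (auto simp: is_join_def least_def Upper_def)
  then show "r \<union> r' \<in> stone_rep S ` carrier S" using stone_rep_join[OF a(1) b(1) c] a b by auto
qed

theorem stone_rep_model:
  assumes "fundamental S"
  shows "pseudogroup_model (stone_space E) (stone_rep S ` carrier S) S (stone_rep S)"
proof (intro pseudogroup_model.intro pseudogroup_model_axioms.intro)
  show "pseudogroup (stone_space E) (stone_rep S ` carrier S)" using assms by (rule stone_rep_pseudogroup)
  show "monoid S" by unfold_locales
  have "inj_on (stone_rep S) (carrier S)" using stone_rep_inject[OF assms] by (auto intro: inj_onI)
  then show "bij_betw (stone_rep S) (carrier S) (stone_rep S ` carrier S)" by (simp add: bij_betw_def)
  show "stone_rep S (a \<otimes> b) = stone_rep S b O stone_rep S a" if "a \<in> carrier S" "b \<in> carrier S" for a b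
    using stone_rep_mult that by simp
  have "basic_open E \<one> = topspace (stone_space E)"
    using UF_one by (auto simp: basic_open_def B.topspace_stone_space)
  then show "stone_rep S \<one> = Id_on (topspace (stone_space E))" using stone_rep_idem[OF one_idem] by simp
qed

subsection \<open>The natural action of the units\<close>

lemma inv_unit: "u \<in> Units S \<Longrightarrow> star S u = inv u"
  by (rule star_eqI) (simp_all add: Units_closed)

text \<open>For a unit \<open>u\<close> every \<open>e\<close> equals \<open>u(u\<^sup>\<star>eu)u\<^sup>\<star>\<close>, so that \<open>uFu\<^sup>\<star>\<close> is already upward closed.\<close>

lemma graph_natural_action:
  assumes u: "u \<in> Units S"
  shows "graph UF (natural_action S u) = stone_rep S u"
proof -
  note [simp] = Units_closed[OF u] Units_inv_closed[OF u]
  have "(\<lambda>e. u \<otimes> e \<otimes> inv u) ` F = push S u F" if F: "F \<in> UF" for F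
  proof (intro equalityI subsetI)
    fix x assume "x \<in> (\<lambda>e. u \<otimes> e \<otimes> inv u) ` F"
    then obtain e where e: "e \<in> F" "x = u \<otimes> e \<otimes> inv u" by blast
    have eE: "e \<in> idempotents S" using UF_subset[OF F e(1)] .
    then have "inv u \<otimes> x \<otimes> u = e"
      using u idem_closed[OF eE] e(2) by (simp add: m_assoc) (simp add: m_assoc[symmetric])
    then show "x \<in> push S u F"
      using e conj_idem'[OF _ eE, of u] inv_unit[OF u] by (simp add: push_def)
  next
    fix x assume x: "x \<in> push S u F"
    then have xE: "x \<in> idempotents S" "inv u \<otimes> x \<otimes> u \<in> F" using inv_unit[OF u] by (auto simp: push_def)
    have "u \<otimes> (inv u \<otimes> x \<otimes> u) \<otimes> inv u = x"
      using u idem_closed[OF xE(1)] by (simp add: m_assoc) (simp add: m_assoc[symmetric])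
    then show "x \<in> (\<lambda>e. u \<otimes> e \<otimes> inv u) ` F" using xE(2) by (metis imageI)
  qed
  then have "natural_action S u F = push S u F" if "F \<in> UF" for F using that by (simp add: natural_action_def)
  moreover have "star S u \<otimes> u = \<one>" using u inv_unit[OF u] by simp
  ultimately show ?thesis using UF_one by (auto simp: mem_graph_iff stone_rep_iff)
qed

lemma natural_action_Bij:
  assumes u: "u \<in> Units S"
  shows "natural_action S u \<in> Bij UF"
proof -
  have g: "graph UF (natural_action S u) = stone_rep S u" using graph_natural_action[OF u] .
  have g': "graph UF (natural_action S (inv u)) = (stone_rep S u)\<inverse>"
    using graph_natural_action[OF Units_inv_Units[OF u]] stone_rep_star[of u] inv_unit[OF u] u by (simp add: Units_closed)
  have inv: "G = natural_action S u F \<and> F \<in> UF \<longleftrightarrow> F = natural_action S (inv u) G \<and> G \<in> UF" for F G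
    using g g' mem_graph_iff[of F G UF "natural_action S u"] mem_graph_iff[of G F UF "natural_action S (inv u)"]
    by (metis converse_iff)
  have "bij_betw (natural_action S u) UF UF"
    by (rule bij_betwI[where g="natural_action S (inv u)"]) (use inv in blast)+
  then show ?thesis by (simp add: Bij_def natural_action_def)
qed

lemma unit_homeos_eq_full_maps:
  assumes fund: "fundamental S"
  shows "unit_homeos S = full_maps (stone_space E) (stone_rep S ` carrier S)"
proof
  show "unit_homeos S \<subseteq> full_maps (stone_space E) (stone_rep S ` carrier S)"
    using natural_action_Bij graph_natural_action Units_closed
    by (auto simp: unit_homeos_def full_maps_def B.topspace_stone_space)
  show "full_maps (stone_space E) (stone_rep S ` carrier S) \<subseteq> unit_homeos S"
  proof
    fix g assume "g \<in> full_maps (stone_space E) (stone_rep S ` carrier S)"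
    then obtain s where g: "g \<in> Bij UF" and s: "s \<in> carrier S" "graph UF g = stone_rep S s"
      by (auto simp: full_maps_def B.topspace_stone_space)
    have b: "inj_on g UF" "g ` UF = UF" using g by (auto simp: Bij_def bij_betw_def)
    have one: "stone_rep S \<one> = Id_on UF" using stone_rep_idem[OF one_idem] UF_one by (auto simp: basic_open_def)
    have "stone_rep S (star S s \<otimes> s) = graph UF g O (graph UF g)\<inverse>"
      "stone_rep S (s \<otimes> star S s) = (graph UF g)\<inverse> O graph UF g"
      using s by (simp_all add: stone_rep_mult stone_rep_star)
    moreover have "graph UF g O (graph UF g)\<inverse> = Id_on UF" using b(1) by (auto simp: graph_def inj_on_def)
    moreover have "(graph UF g)\<inverse> O graph UF g = Id_on (g ` UF)" by (auto simp: graph_def)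
    ultimately have "star S s \<otimes> s = \<one>" "s \<otimes> star S s = \<one>"
      using stone_rep_inject[OF fund] one s b(2) by simp_all
    then have u: "s \<in> Units S" using s by (auto simp: Units_def)
    have "natural_action S s = g"
    proof (rule graph_inject[THEN iffD1])
      show "natural_action S s \<in> extensional UF" by (simp add: natural_action_def)
      show "g \<in> extensional UF" using g by (simp add: Bij_def)
      show "graph UF (natural_action S s) = graph UF g" using graph_natural_action[OF u] s by simp
    qed
    then show "g \<in> unit_homeos S" using u by (auto simp: unit_homeos_def)
  qed
qed

theorem naturally_faithful:
  assumes fund: "fundamental S"
  shows "naturally_faithful S"
proof (intro faithful_action.intro group_action.intro faithful_action_axioms.intro group_hom.intro group_hom_axioms.intro)
  show "group (units_of S)" by (rule units_group)
  show "group (BijGroup UF)" by (rule group_BijGroup)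
  show "natural_action S \<in> hom (units_of S) (BijGroup UF)"
  proof (rule homI)
    show "natural_action S u \<in> carrier (BijGroup UF)" if "u \<in> carrier (units_of S)" for u
      using that natural_action_Bij by (simp add: units_of_def BijGroup_def)
    fix u v assume "u \<in> carrier (units_of S)" "v \<in> carrier (units_of S)"
    then have uv: "u \<in> Units S" "v \<in> Units S" by (simp_all add: units_of_def)
    note B = natural_action_Bij[OF uv(1)] natural_action_Bij[OF uv(2)]
    have im: "natural_action S v ` UF = UF" using B(2) by (simp add: Bij_def bij_betw_def)
    have "natural_action S (u \<otimes> v) = compose UF (natural_action S u) (natural_action S v)"
    proof (rule graph_inject[THEN iffD1])
      show "natural_action S (u \<otimes> v) \<in> extensional UF" by (simp add: natural_action_def)
      have "graph UF (compose UF (natural_action S u) (natural_action S v)) =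
          graph UF (natural_action S v) O graph UF (natural_action S u)"
        using im by (auto simp: graph_def compose_def)
      then show "graph UF (natural_action S (u \<otimes> v)) = graph UF (compose UF (natural_action S u) (natural_action S v))"
        using uv by (simp add: graph_natural_action stone_rep_mult Units_closed)
    qed simp
    then show "natural_action S (u \<otimes>\<^bsub>units_of S\<^esub> v) = natural_action S u \<otimes>\<^bsub>BijGroup UF\<^esub> natural_action S v"
      using B by (simp add: units_of_def BijGroup_def)
  qed
  show "inj_on (natural_action S) (carrier (units_of S))"
  proof (rule inj_onI)
    fix u v assume uv: "u \<in> carrier (units_of S)" "v \<in> carrier (units_of S)" "natural_action S u = natural_action S v"
    then have "u \<in> Units S" "v \<in> Units S" by (simp_all add: units_of_def)
    then show "u = v"
      using uv(3) graph_natural_action stone_rep_inject[OF fund] Units_closed by metis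
  qed
qed

lemma stone_space_cantor: "is_cantor_space (stone_space E)"
  using countable_atomless_boolean_lattice.is_cantor_space_stone_space[OF atomless_idempotents] .

theorem unit_homeos_cantor_group:
  assumes fund: "fundamental S"
  shows "cantor_group (stone_space E) (unit_homeos S)"
  unfolding unit_homeos_eq_full_maps[OF fund]
  using pseudogroup.cantor_group_full_maps[OF stone_rep_pseudogroup[OF fund] stone_space_cantor]
    countable_monoid by simp

end

section \<open>The pseudogroup generated by a Stone group\<close>

text \<open>The partial bijections between clopen sets that agree with elements of \<open>G\<close> near each point of
  their domain. By compactness these are the finite unions of restrictions of elements of \<open>G\<close> to
  clopen sets; the local form makes the closure properties immediate.\<close>

definition generated_pseudogroup :: "'a topology \<Rightarrow> ('a \<Rightarrow> 'a) set \<Rightarrow> ('a \<times> 'a) set set" where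
  "generated_pseudogroup X G =
     {r. partial_bij r \<and> clopenin X (Domain r) \<and> clopenin X (Range r) \<and>
         (\<forall>x\<in>Domain r. \<exists>g\<in>G. \<exists>U. clopenin X U \<and> x \<in> U \<and> graph U g \<subseteq> r)}"

lemma generated_pseudogroup_finite_union:
  assumes X: "compact_space X" and r: "r \<in> generated_pseudogroup X G"
  obtains A where "finite A" "A \<subseteq> {graph U g | U g. clopenin X U \<and> g \<in> G}" "r = \<Union>A"
proof -
  let ?P = "\<lambda>U. U \<inter> Domain r = {} \<or> (\<exists>g\<in>G. graph U g \<subseteq> r)"
  have cl: "clopenin X (Domain r)"
    and loc: "\<And>x. x \<in> Domain r \<Longrightarrow> \<exists>g\<in>G. \<exists>U. clopenin X U \<and> x \<in> U \<and> graph U g \<subseteq> r"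
    and pb: "partial_bij r"
    using r by (auto simp: generated_pseudogroup_def)
  have "\<exists>n e. clopen_partition X n e \<and> (\<forall>i<n. ?P (e i))"
  proof (rule clopen_partition_of_local[OF X, of ?P])
    fix x assume "x \<in> topspace X"
    show "\<exists>U. clopenin X U \<and> x \<in> U \<and> ?P U"
    proof (cases "x \<in> Domain r")
      case True
      then show ?thesis using loc by blast
    next
      case False
      then show ?thesis
        using \<open>x \<in> topspace X\<close> clopenin_Diff[OF clopenin_topspace cl]
        by (intro exI[of _ "topspace X - Domain r"]) blast
    qed
  next
    fix U V assume "?P U" "V \<subseteq> U"
    then show "?P V" unfolding graph_def by blast
  qed
  then obtain n e where e: "clopen_partition X n e" "\<And>i. i < n \<Longrightarrow> ?P (e i)" by blast
  define J where "J = {i. i < n \<and> e i \<inter> Domain r \<noteq> {}}"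
  have "\<forall>i\<in>J. \<exists>g. g \<in> G \<and> graph (e i) g \<subseteq> r" using e(2) unfolding J_def by blast
  then obtain g where g: "\<And>i. i \<in> J \<Longrightarrow> g i \<in> G" "\<And>i. i \<in> J \<Longrightarrow> graph (e i) (g i) \<subseteq> r" by metis
  have ec: "\<And>i. i < n \<Longrightarrow> clopenin X (e i)" "(\<Union>i<n. e i) = topspace X"
    using e(1) by (auto simp: clopen_partition_def)
  have "r = (\<Union>i\<in>J. graph (e i) (g i))"
  proof
    show "r \<subseteq> (\<Union>i\<in>J. graph (e i) (g i))"
    proof (rule subrelI)
      fix x y assume xy: "(x, y) \<in> r"
      then have "x \<in> topspace X" using clopenin_subset[OF cl] by blast
      then obtain i where i: "i < n" "x \<in> e i" using ec(2) by blast
      then have "i \<in> J" using xy by (auto simp: J_def)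
      then have "(x, g i x) \<in> r" using g(2) i(2) by (auto simp: graph_def)
      then have "y = g i x" using partial_bijD(1)[OF pb xy] by blast
      then show "(x, y) \<in> (\<Union>i\<in>J. graph (e i) (g i))" using \<open>i \<in> J\<close> i(2) by (auto simp: mem_graph_iff)
    qed
  qed (use g(2) in blast)
  moreover have "finite J" by (simp add: J_def)
  moreover have "(\<lambda>i. graph (e i) (g i)) ` J \<subseteq> {graph U g | U g. clopenin X U \<and> g \<in> G}"
    using ec(1) g(1) unfolding J_def by blast
  ultimately show thesis using that[of "(\<lambda>i. graph (e i) (g i)) ` J"] by simp
qed

context stone_group
begin

abbreviation "L \<equiv> generated_pseudogroup X G"

lemma compact: "compact_space X"
  using stone by (simp add: is_stone_space_def)

lemma element:
  assumes "g \<in> G"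
  shows "g \<in> Bij (topspace X)" "homeomorphic_map X X g" "inj_on g (topspace X)" "g ` topspace X = topspace X"
    "x \<in> topspace X \<Longrightarrow> g x \<in> topspace X"
proof -
  show g: "g \<in> Bij (topspace X)" "homeomorphic_map X X g"
    using subgroup_homeo assms unfolding subgroup_homeo_group_iff by auto
  then show "inj_on g (topspace X)" "g ` topspace X = topspace X" by (auto simp: Bij_def bij_betw_def)
  then show "x \<in> topspace X \<Longrightarrow> g x \<in> topspace X" by blast
qed

lemma identity_mem: "(\<lambda>x\<in>topspace X. x) \<in> G"
  and compose_mem: "g \<in> G \<Longrightarrow> h \<in> G \<Longrightarrow> compose (topspace X) g h \<in> G"
  and inverse_mem: "g \<in> G \<Longrightarrow> (\<lambda>x\<in>topspace X. inv_into (topspace X) g x) \<in> G"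
  using subgroup_homeo unfolding subgroup_homeo_group_iff by auto

lemma clopenin_image: "g \<in> G \<Longrightarrow> clopenin X U \<Longrightarrow> clopenin X (g ` U)"
  using homeomorphic_map_clopenin[OF element(2), of g U] clopenin_subset by blast

lemma clopenin_preimage:
  assumes "g \<in> G" "clopenin X U"
  shows "clopenin X {x \<in> topspace X. g x \<in> U}"
proof -
  have "continuous_map X X g" using element(2)[OF assms(1)] homeomorphic_imp_continuous_map by blast
  then show ?thesis using assms(2)
    unfolding clopenin_def by (simp add: openin_continuous_map_preimage closedin_continuous_map_preimage)
qed

lemma localD:
  assumes "r \<in> L"
  shows "partial_bij r" "clopenin X (Domain r)" "clopenin X (Range r)"
    "\<And>x. x \<in> Domain r \<Longrightarrow> \<exists>g\<in>G. \<exists>U. clopenin X U \<and> x \<in> U \<and> graph U g \<subseteq> r"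
  using assms by (auto simp: generated_pseudogroup_def)

lemma local_converse:
  assumes r: "r \<in> L"
  shows "r\<inverse> \<in> L"
proof -
  have "\<exists>h\<in>G. \<exists>V. clopenin X V \<and> y \<in> V \<and> graph V h \<subseteq> r\<inverse>" if "y \<in> Domain (r\<inverse>)" for y
  proof -
    obtain x where xy: "(x, y) \<in> r" using \<open>y \<in> Domain (r\<inverse>)\<close> by blast
    then obtain g U where g: "g \<in> G" "clopenin X U" "x \<in> U" "graph U g \<subseteq> r" using localD(4)[OF r, of x] by blast
    let ?h = "\<lambda>x\<in>topspace X. inv_into (topspace X) g x"
    have "(x, g x) \<in> r" using g(3,4) by (auto simp: graph_def)
    then have "y = g x" using partial_bijD(1)[OF localD(1)[OF r] xy] by blast
    moreover have "graph (g ` U) ?h \<subseteq> r\<inverse>"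
    proof (rule subrelI)
      fix v u assume "(v, u) \<in> graph (g ` U) ?h"
      then obtain w where w: "w \<in> U" "v = g w" "u = ?h (g w)" by (auto simp: mem_graph_iff)
      have wX: "w \<in> topspace X" using clopenin_subset[OF g(2)] w(1) by blast
      then have "u = w" using w(3) element(5)[OF g(1) wX] inv_into_f_f[OF element(3)[OF g(1)]] by simp
      then show "(v, u) \<in> r\<inverse>" using w g(4) by (auto simp: graph_def)
    qed
    ultimately show ?thesis using inverse_mem[OF g(1)] clopenin_image[OF g(1,2)] g(3) by blast
  qed
  then show ?thesis
    using localD(1-3)[OF r] partial_bij_converse by (simp add: generated_pseudogroup_def)
qed

text \<open>Preimages of clopen sets are open by locality; the complement of the preimage of \<open>V\<close> within the
  clopen domain is the preimage of the complement of \<open>V\<close>.\<close>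

lemma local_preimage_clopen:
  assumes r: "r \<in> L" and V: "clopenin X V"
  shows "clopenin X {x. \<exists>y\<in>V. (x, y) \<in> r}"
proof -
  have op: "openin X {x. \<exists>y\<in>V. (x, y) \<in> r}" if V: "clopenin X V" for V
  proof (subst openin_subopen, intro ballI)
    fix x assume "x \<in> {x. \<exists>y\<in>V. (x, y) \<in> r}"
    then obtain y where xy: "y \<in> V" "(x, y) \<in> r" by blast
    then obtain g U where g: "g \<in> G" "clopenin X U" "x \<in> U" "graph U g \<subseteq> r" using localD(4)[OF r, of x] by blast
    have "(x, g x) \<in> r" using g(3,4) by (auto simp: graph_def)
    then have y: "y = g x" using partial_bijD(1)[OF localD(1)[OF r] xy(2)] by blast
    let ?T = "U \<inter> {x \<in> topspace X. g x \<in> V}"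
    have "openin X ?T" using clopenin_Int[OF g(2) clopenin_preimage[OF g(1) V]] by (simp add: clopenin_def)
    moreover have "x \<in> ?T" using g(3) y xy(1) clopenin_subset[OF g(2)] by blast
    moreover have "?T \<subseteq> {x. \<exists>y\<in>V. (x, y) \<in> r}" using g(4) by (auto simp: graph_def)
    ultimately show "\<exists>T. openin X T \<and> x \<in> T \<and> T \<subseteq> {x. \<exists>y\<in>V. (x, y) \<in> r}" by blast
  qed
  let ?W = "topspace X - V"
  have ran: "Range r \<subseteq> topspace X" and dom: "Domain r \<subseteq> topspace X"
    using clopenin_subset localD(2,3)[OF r] by blast+
  have "{x. \<exists>y\<in>V. (x, y) \<in> r} = Domain r - {x. \<exists>y\<in>?W. (x, y) \<in> r}"
    using ran partial_bijD(1)[OF localD(1)[OF r]] by blast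
  moreover have "closedin X (Domain r - {x. \<exists>y\<in>?W. (x, y) \<in> r})"
    using op[OF clopenin_Diff[OF clopenin_topspace V]] localD(2)[OF r] by (simp add: clopenin_def closedin_diff)
  ultimately show ?thesis using op[OF V] by (simp add: clopenin_def)
qed

lemma local_comp:
  assumes r: "r \<in> L" and s: "s \<in> L"
  shows "r O s \<in> L"
proof -
  have D: "clopenin X (Domain (p O q))" if "p \<in> L" "q \<in> L" for p q
  proof -
    have "Domain (p O q) = {x. \<exists>y\<in>Domain q. (x, y) \<in> p}" by blast
    then show ?thesis using local_preimage_clopen[OF that(1) localD(2)[OF that(2)]] by simp
  qed
  have "Range (r O s) = Domain (s\<inverse> O r\<inverse>)" by blast
  then have "clopenin X (Range (r O s))" using D[OF local_converse[OF s] local_converse[OF r]] by simp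
  moreover have "\<exists>k\<in>G. \<exists>W. clopenin X W \<and> x \<in> W \<and> graph W k \<subseteq> r O s" if "x \<in> Domain (r O s)" for x
  proof -
    obtain y z where xyz: "(x, y) \<in> r" "(y, z) \<in> s" using \<open>x \<in> Domain (r O s)\<close> by blast
    obtain g U where g: "g \<in> G" "clopenin X U" "x \<in> U" "graph U g \<subseteq> r" using localD(4)[OF r, of x] xyz by blast
    obtain h V where h: "h \<in> G" "clopenin X V" "y \<in> V" "graph V h \<subseteq> s" using localD(4)[OF s, of y] xyz by blast
    have "(x, g x) \<in> r" using g(3,4) by (auto simp: graph_def)
    then have y: "y = g x" using partial_bijD(1)[OF localD(1)[OF r] xyz(1)] by blast
    let ?W = "U \<inter> {x \<in> topspace X. g x \<in> V}"
    have "clopenin X ?W" using clopenin_Int[OF g(2) clopenin_preimage[OF g(1) h(2)]] .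
    moreover have "x \<in> ?W" using g(3) y h(3) clopenin_subset[OF g(2)] by blast
    moreover have "graph ?W (compose (topspace X) h g) \<subseteq> r O s"
    proof (rule subrelI)
      fix u v assume "(u, v) \<in> graph ?W (compose (topspace X) h g)"
      then have "u \<in> U" "g u \<in> V" "v = h (g u)" by (auto simp: mem_graph_iff compose_def)
      then have "(u, g u) \<in> r" "(g u, v) \<in> s" using g(4) h(4) by (auto simp: graph_def)
      then show "(u, v) \<in> r O s" by blast
    qed
    ultimately show ?thesis using compose_mem[OF h(1) g(1)] by blast
  qed
  ultimately show ?thesis
    using D[OF r s] partial_bij_relcomp[OF localD(1)[OF r] localD(1)[OF s]]
    by (simp add: generated_pseudogroup_def)
qed

text \<open>Let \<open>U\<close> be the union of all clopen sets on which \<open>r\<close> is the identity. To see that it is closed,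
  take a point outside \<open>U\<close> near which \<open>r\<close> agrees with \<open>g \<in> G\<close>. The point lies in the support of \<open>g\<close>,
  which is clopen, and \<open>U\<close> does not meet the support near the point, because the points moved by
  \<open>g\<close> are dense in its support.\<close>

lemma local_fixed:
  assumes r: "r \<in> L"
  shows "\<exists>U. clopenin X U \<and> Id_on U \<subseteq> r \<and> (\<forall>V. clopenin X V \<and> Id_on V \<subseteq> r \<longrightarrow> V \<subseteq> U)"
proof -
  define U where "U = \<Union>{V. clopenin X V \<and> Id_on V \<subseteq> r}"
  have Ur: "(u, u) \<in> r" if "u \<in> U" for u using that unfolding U_def by blast
  have op: "openin X U" unfolding U_def by (rule openin_Union) (simp add: clopenin_def)
  have "openin X (topspace X - U)"
  proof (subst openin_subopen, intro ballI)
    fix x assume x: "x \<in> topspace X - U"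
    show "\<exists>T. openin X T \<and> x \<in> T \<and> T \<subseteq> topspace X - U"
    proof (cases "x \<in> Domain r")
      case False
      have "openin X (topspace X - Domain r)"
        using clopenin_Diff[OF clopenin_topspace localD(2)[OF r]] by (simp add: clopenin_def)
      moreover have "topspace X - Domain r \<subseteq> topspace X - U" using Ur by blast
      ultimately show ?thesis using x False by blast
    next
      case True
      then obtain g W where g: "g \<in> G" "clopenin X W" "x \<in> W" "graph W g \<subseteq> r" using localD(4)[OF r] by blast
      let ?S = "homeo_support X g"
      have S: "clopenin X ?S" using support_clopen[OF g(1)] .
      have still: "g w = w" if "w \<in> W - ?S" for w
      proof -
        have "w \<in> topspace X" using that clopenin_subset[OF g(2)] by blast
        moreover have "{x \<in> topspace X. g x \<noteq> x} \<subseteq> ?S"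
          unfolding homeo_support_def by (rule closure_of_subset) blast
        ultimately show ?thesis using that by blast
      qed
      have "clopenin X (W - ?S)" using clopenin_Diff[OF g(2) S] .
      moreover have "Id_on (W - ?S) \<subseteq> r"
      proof (rule subrelI)
        fix u v assume "(u, v) \<in> Id_on (W - ?S)"
        then have "u \<in> W" "v = g u" using still by auto
        then show "(u, v) \<in> r" using g(4) by (auto simp: graph_def)
      qed
      ultimately have "W - ?S \<subseteq> U" unfolding U_def by blast
      then have xS: "x \<in> W \<inter> ?S" using x g(3) by blast
      have "W \<inter> ?S \<inter> U = {}"
      proof (rule ccontr)
        assume "W \<inter> ?S \<inter> U \<noteq> {}"
        then obtain u where u: "u \<in> W \<inter> U" "u \<in> ?S" by blast
        have "openin X (W \<inter> U)" using op g(2) by (simp add: clopenin_def openin_Int)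
        then obtain v where v: "v \<in> W \<inter> U" "g v \<noteq> v"
          using u unfolding homeo_support_def in_closure_of by blast
        have "(v, v) \<in> r" "(v, g v) \<in> r" using v(1) Ur g(4) by (auto simp: graph_def)
        then show False using partial_bijD(1)[OF localD(1)[OF r]] v(2) by blast
      qed
      moreover have "openin X (W \<inter> ?S)" using clopenin_Int[OF g(2) S] by (simp add: clopenin_def)
      ultimately show ?thesis using xS openin_subset[of X "W \<inter> ?S"] by blast
    qed
  qed
  then have "clopenin X U" using op openin_subset[OF op] by (simp add: clopenin_def closedin_def)
  moreover have "Id_on U \<subseteq> r" using Ur by (auto simp: Id_on_def)
  ultimately show ?thesis unfolding U_def by blast
qed

theorem pseudogroup_generated: "pseudogroup X L"
proof
  show "is_stone_space X" by (rule stone)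
  show "partial_bij r" if "r \<in> L" for r using localD(1)[OF that] .
  show "r O s \<in> L" if "r \<in> L" "s \<in> L" for r s using local_comp that .
  show "r\<inverse> \<in> L" if "r \<in> L" for r using local_converse[OF that] .
  show "\<exists>U. clopenin X U \<and> Id_on U \<subseteq> r \<and> (\<forall>V. clopenin X V \<and> Id_on V \<subseteq> r \<longrightarrow> V \<subseteq> U)" if "r \<in> L" for r
    using local_fixed[OF that] .
  show "Id_on U \<in> L \<longleftrightarrow> clopenin X U" for U
  proof
    show "clopenin X U" if "Id_on U \<in> L" using localD(2)[OF that] by simp
    assume U: "clopenin X U"
    have "graph U (\<lambda>x\<in>topspace X. x) \<subseteq> Id_on U" using clopenin_subset[OF U] by (auto simp: graph_def)
    moreover have "Range (Id_on U) = U" by auto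
    ultimately show "Id_on U \<in> L"
      using U identity_mem partial_bij_Id_on unfolding generated_pseudogroup_def by auto
  qed
  show "r \<union> s \<in> L" if rs: "r \<in> L" "s \<in> L" "partial_bij (r \<union> s)" for r s
  proof -
    have "\<exists>g\<in>G. \<exists>U. clopenin X U \<and> x \<in> U \<and> graph U g \<subseteq> r \<union> s" if "x \<in> Domain (r \<union> s)" for x
      using that localD(4)[OF rs(1), of x] localD(4)[OF rs(2), of x] by blast
    then show ?thesis
      using rs(3) localD(2,3)[OF rs(1)] localD(2,3)[OF rs(2)]
      by (simp add: generated_pseudogroup_def Domain_Un_eq Range_Un_eq clopenin_Un)
  qed
qed

text \<open>Fullness of \<open>G\<close> says that passing to the generated pseudogroup adds no new global maps.\<close>

theorem full_maps_generated: "full_maps X L = G"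
proof
  show "G \<subseteq> full_maps X L"
  proof
    fix g assume g: "g \<in> G"
    have "Domain (graph (topspace X) g) = topspace X" "Range (graph (topspace X) g) = g ` topspace X"
      by (auto simp: graph_def)
    then have "graph (topspace X) g \<in> L"
      using g partial_bij_graph[OF element(3)[OF g]] clopenin_topspace[of X] element(4)[OF g]
      unfolding generated_pseudogroup_def by auto
    then show "g \<in> full_maps X L" using element(1)[OF g] by (simp add: full_maps_def)
  qed
  show "full_maps X L \<subseteq> G"
  proof
    fix h assume h: "h \<in> full_maps X L"
    then have hB: "h \<in> Bij (topspace X)" and hL: "graph (topspace X) h \<in> L" by (auto simp: full_maps_def)
    have inj: "inj_on h (topspace X)" and im: "h ` topspace X = topspace X"
      using hB by (auto simp: Bij_def bij_betw_def)
    let ?P = "\<lambda>U. \<exists>g\<in>G. \<forall>u\<in>U. h u = g u"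
    have "\<exists>n e. clopen_partition X n e \<and> (\<forall>i<n. ?P (e i))"
    proof (rule clopen_partition_of_local[OF compact, of ?P])
      fix x assume "x \<in> topspace X"
      then have "x \<in> Domain (graph (topspace X) h)" by (auto simp: graph_def)
      then obtain g U where g: "g \<in> G" "clopenin X U" "x \<in> U" "graph U g \<subseteq> graph (topspace X) h"
        using localD(4)[OF hL] by blast
      have "h u = g u" if "u \<in> U" for u using g(4) that by (auto simp: graph_def)
      then show "\<exists>U. clopenin X U \<and> x \<in> U \<and> ?P U" using g by blast
    qed blast
    then obtain n e where e: "clopen_partition X n e" "\<And>i. i < n \<Longrightarrow> ?P (e i)" by blast
    then obtain g where g: "\<And>i. i < n \<Longrightarrow> g i \<in> G" "\<And>i x. i < n \<Longrightarrow> x \<in> e i \<Longrightarrow> h x = g i x" by metis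
    have ec: "\<And>i. i < n \<Longrightarrow> clopenin X (e i) \<and> e i \<noteq> {}" "(\<Union>i<n. e i) = topspace X"
      and ed: "disjoint_family_on e {..<n}"
      using e(1) by (auto simp: clopen_partition_def)
    have img: "g i ` e i = h ` e i" if "i < n" for i using g(2)[OF that] by force
    have "clopen_partition X n (\<lambda>i. g i ` e i)"
      unfolding clopen_partition_def
    proof (intro conjI allI impI)
      fix i assume "i < n"
      then show "clopenin X (g i ` e i)" "g i ` e i \<noteq> {}" using ec(1) clopenin_image g(1) by blast+
    next
      have "h ` e i \<inter> h ` e j = {}" if "i < n" "j < n" "i \<noteq> j" for i j
      proof -
        have "e i \<inter> e j = {}" "e i \<subseteq> topspace X" "e j \<subseteq> topspace X"
          using ed ec that unfolding disjoint_family_on_def by blast+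
        then show ?thesis using inj_on_image_Int[OF inj, of "e i" "e j"] by simp
      qed
      then show "disjoint_family_on (\<lambda>i. g i ` e i) {..<n}"
        unfolding disjoint_family_on_def using img by simp
      have "(\<Union>i<n. g i ` e i) = (\<Union>i<n. h ` e i)" using img by simp
      also have "\<dots> = h ` (\<Union>i<n. e i)" by blast
      finally show "(\<Union>i<n. g i ` e i) = topspace X" using ec(2) im by simp
    qed
    then show "h \<in> G" using full[OF e(1) g(1) _ _ g(2)] hB by (simp add: Bij_def)
  qed
qed

end

lemma (in cantor_group) countable_generated_pseudogroup: "countable (generated_pseudogroup X G)"
proof -
  let ?C = "{graph U g | U g. clopenin X U \<and> g \<in> G}"
  have "?C = (\<lambda>(U, g). graph U g) ` ({U. clopenin X U} \<times> G)" by auto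
  moreover have "countable ({U. clopenin X U} \<times> G)"
    using cantor countable_group unfolding is_cantor_space_iff by (intro countable_SIGMA) simp_all
  ultimately have "countable ?C" by simp
  then have "countable {A. finite A \<and> A \<subseteq> ?C}" by (rule countable_Collect_finite_subset)
  moreover have "generated_pseudogroup X G \<subseteq> Union ` {A. finite A \<and> A \<subseteq> ?C}"
  proof
    fix r assume "r \<in> generated_pseudogroup X G"
    then obtain A where "finite A" "A \<subseteq> ?C" "r = \<Union>A" by (rule generated_pseudogroup_finite_union[OF compact])
    then show "r \<in> Union ` {A. finite A \<and> A \<subseteq> ?C}" by blast
  qed
  ultimately show ?thesis by (meson countable_image countable_subset)
qed

section \<open>Minimality\<close>

context pseudogroup
begin

lemma total_full_map:
  assumes r: "r \<in> M" and dom: "Domain r = topspace X" and ran: "Range r = topspace X"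
  obtains g where "g \<in> full_maps X M" "graph (topspace X) g = r"
proof -
  define g where "g = (\<lambda>x\<in>topspace X. THE y. (x, y) \<in> r)"
  note pb = partial_bijD[OF pbij[OF r]]
  have g: "g x = y \<longleftrightarrow> (x, y) \<in> r" if "x \<in> topspace X" for x y
  proof -
    have "x \<in> Domain r" using that dom by simp
    then obtain z where z: "(x, z) \<in> r" by blast
    then have "(THE y. (x, y) \<in> r) = z" by (rule the_equality) (rule pb(1)[OF _ z])
    then have "g x = z" using that by (simp add: g_def)
    then show ?thesis using z pb(1)[OF z] by metis
  qed
  have gr: "graph (topspace X) g = r"
    unfolding set_eq_iff split_paired_All mem_graph_iff using g in_topspace[OF r] by metis
  have "inj_on g (topspace X)"
  proof (rule inj_onI)
    fix x y assume "x \<in> topspace X" "y \<in> topspace X" "g x = g y"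
    then have "(x, g y) \<in> r" "(y, g y) \<in> r" using g by metis+
    then show "x = y" by (rule pb(2))
  qed
  moreover have "g ` topspace X = topspace X"
  proof
    show "g ` topspace X \<subseteq> topspace X" using g in_topspace[OF r] by blast
    show "topspace X \<subseteq> g ` topspace X"
    proof
      fix y assume "y \<in> topspace X"
      then have "y \<in> Range r" using ran by simp
      then obtain x where x: "(x, y) \<in> r" by blast
      then have "x \<in> topspace X" using in_topspace[OF r] by blast
      moreover from this have "g x = y" using g x by blast
      ultimately show "y \<in> g ` topspace X" by blast
    qed
  qed
  ultimately have "g \<in> Bij (topspace X)" by (simp add: Bij_def bij_betw_def g_def)
  then show thesis using that r gr by (simp add: full_maps_def)
qed

text \<open>If \<open>r\<close> moves \<open>x\<close>, restrict it to a clopen neighbourhood \<open>D\<close> of \<open>x\<close> that is disjoint from its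
  image \<open>R\<close>. The involution that swaps \<open>D\<close> and \<open>R\<close> along \<open>r\<close> is a global map.\<close>

lemma moving_element_extends:
  assumes r: "r \<in> M" and xy: "(x, y) \<in> r" "x \<noteq> y"
  obtains g W where "g \<in> full_maps X M" "clopenin X W" "x \<in> W" "graph W g \<subseteq> r" "g x = y"
proof -
  have X: "x \<in> topspace X" "y \<in> topspace X" using in_topspace[OF r xy(1)] by auto
  obtain A where A: "clopenin X A" "x \<in> A" "y \<notin> A" using stone_space_separate[OF stone X xy(2)] .
  define t where "t = Id_on A O r O Id_on (topspace X - A)"
  have "Id_on A \<in> M" "Id_on (topspace X - A) \<in> M"
    using Id_on_iff A(1) clopenin_Diff[OF clopenin_topspace A(1)] by auto
  then have t: "t \<in> M" unfolding t_def using comp r by blast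
  have tr: "t \<subseteq> r" and tA: "Domain t \<subseteq> A" "Range t \<subseteq> topspace X - A" unfolding t_def by auto
  have txy: "(x, y) \<in> t" using xy A X unfolding t_def by auto
  define C where "C = topspace X - (Domain t \<union> Range t)"
  have C: "clopenin X C"
    unfolding C_def using clopenin_Diff[OF clopenin_topspace clopenin_Un[OF clopen_Domain[OF t] clopen_Range[OF t]]] .
  define k where "k = t \<union> t\<inverse> \<union> Id_on C"
  note pb = partial_bijD[OF pbij[OF t]]
  have sv: "b = c" if ab: "(a, b) \<in> k" "(a, c) \<in> k" for a b c
  proof -
    consider "a \<in> Domain t" | "a \<in> Range t" | "a \<in> C" using ab(1) unfolding k_def by blast
    then show ?thesis
    proof cases
      case 1
      then have "a \<notin> Range t" "a \<notin> C" using tA unfolding C_def by blast+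
      then have "(a, b) \<in> t" "(a, c) \<in> t" using ab unfolding k_def by blast+
      then show ?thesis using pb(1) by blast
    next
      case 2
      then have "a \<notin> Domain t" "a \<notin> C" using tA unfolding C_def by blast+
      then have "(b, a) \<in> t" "(c, a) \<in> t" using ab unfolding k_def by blast+
      then show ?thesis using pb(2) by blast
    next
      case 3
      then have "a \<notin> Domain t" "a \<notin> Range t" unfolding C_def by blast+
      then show ?thesis using ab unfolding k_def by blast
    qed
  qed
  have sym: "k\<inverse> = k" unfolding k_def by auto
  have pk: "partial_bij k"
  proof (rule partial_bijI)
    show "b = c" if "(a, b) \<in> k" "(a, c) \<in> k" for a b c using sv that .
    show "b = c" if "(b, a) \<in> k" "(c, a) \<in> k" for a b c
      using sv[of a b c] that sym by (metis converse_iff)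
  qed
  have "t \<union> t\<inverse> \<in> M" using union[OF t conv[OF t]] partial_bij_subset[OF pk] unfolding k_def by blast
  then have kM: "k \<in> M" using union[of "t \<union> t\<inverse>" "Id_on C"] Id_on_iff C pk unfolding k_def by blast
  have "Domain k = Domain t \<union> Range t \<union> C" unfolding k_def by auto
  then have Dk: "Domain k = topspace X"
    using clopenin_subset[OF clopen_Domain[OF t]] clopenin_subset[OF clopen_Range[OF t]] unfolding C_def by blast
  then have "Range k = topspace X" using sym by (metis Domain_converse)
  then obtain g where g: "g \<in> full_maps X M" "graph (topspace X) g = k"
    using total_full_map[OF kM Dk] by blast
  have "graph (Domain t) g \<subseteq> t"
  proof (rule subrelI)
    fix u v assume "(u, v) \<in> graph (Domain t) g"
    then have u: "u \<in> Domain t" "v = g u" by (auto simp: mem_graph_iff)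
    then obtain w where w: "(u, w) \<in> t" by blast
    have "u \<in> topspace X" using u clopenin_subset[OF clopen_Domain[OF t]] by blast
    then have "(u, v) \<in> k" using g(2) u by (auto simp: mem_graph_iff)
    moreover have "(u, w) \<in> k" using w unfolding k_def by blast
    ultimately show "(u, v) \<in> t" using sv w by blast
  qed
  moreover from this have "(x, g x) \<in> t" using txy by (auto simp: graph_def)
  then have "g x = y" using pb(1) txy by blast
  ultimately show thesis using that g(1) clopen_Domain[OF t] txy tr by blast
qed

end

locale dense_pseudogroup = pseudogroup X M for X :: "'a topology" and M +
  assumes cantor: "is_cantor_space X"
    and countable: "countable M"
    and dense: "x \<in> topspace X \<Longrightarrow> clopenin X U \<Longrightarrow> U \<noteq> {} \<Longrightarrow> \<exists>r\<in>M. \<exists>u\<in>U. (x, u) \<in> r"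
begin

sublocale G: cantor_group X "full_maps X M"
  using cantor_group_full_maps cantor countable .

theorem minimal_full_maps: "minimal_cantor_group X (full_maps X M)"
proof (intro minimal_cantor_group.intro minimal_cantor_group_axioms.intro)
  show "cantor_group X (full_maps X M)" by (rule G.cantor_group_axioms)
  fix x assume x: "x \<in> topspace X"
  have "y \<in> X closure_of {g x | g. g \<in> full_maps X M}" if y: "y \<in> topspace X" for y
    unfolding in_closure_of
  proof (intro conjI allI impI)
    fix T assume T: "y \<in> T \<and> openin X T"
    then obtain U where U: "clopenin X U" "y \<in> U" "U \<subseteq> T" using stone_space_clopen_base[OF stone] by metis
    show "\<exists>z. z \<in> {g x | g. g \<in> full_maps X M} \<and> z \<in> T"
    proof (cases "x \<in> U")
      case True
      have "(\<lambda>x\<in>topspace X. x) x = x" using x by simp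
      then show ?thesis using G.identity_mem True U by (metis (mono_tags, lifting) mem_Collect_eq subsetD)
    next
      case False
      obtain r u where r: "r \<in> M" "u \<in> U" "(x, u) \<in> r" using dense[OF x U(1)] U(2) by blast
      then have "x \<noteq> u" using False by blast
      then obtain g where "g \<in> full_maps X M" "g x = u" using moving_element_extends[OF r(1,3)] by metis
      then show ?thesis using r(2) U(3) by blast
    qed
  qed (rule y)
  then show "X closure_of {g x | g. g \<in> full_maps X M} = topspace X"
    by (intro equalityI closure_of_subset_topspace subsetI)
qed

text \<open>An element defined at \<open>x\<close> agrees near \<open>x\<close> with a total element if it moves \<open>x\<close>. Otherwise it
  factors near \<open>x\<close> through another point \<open>u\<close> of the orbit of \<open>x\<close>, as an element \<open>t\<close> that takes \<open>x\<close> to \<open>u\<close>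
  followed by one that takes \<open>u\<close> back to \<open>x\<close>, and both factors move their points. The point \<open>u\<close> exists
  because \<open>x\<close> is not isolated and its orbit is dense.\<close>

theorem generated_full_maps: "generated_pseudogroup X (full_maps X M) = M"
proof
  show "generated_pseudogroup X (full_maps X M) \<subseteq> M"
  proof
    fix r assume r: "r \<in> generated_pseudogroup X (full_maps X M)"
    then obtain A where A: "finite A" "A \<subseteq> {graph U g | U g. clopenin X U \<and> g \<in> full_maps X M}" "r = \<Union>A"
      by (rule generated_pseudogroup_finite_union[OF G.compact])
    have "graph U g \<in> M" if "clopenin X U" "g \<in> full_maps X M" for U g
    proof -
      have "graph U g = Id_on U O graph (topspace X) g"
        using clopenin_subset[OF that(1)] by (auto simp: mem_graph_iff intro!: relcompI[OF Id_onI])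
      then show ?thesis using comp Id_on_iff that(1) full_mapsD(2)[OF that(2)] by simp
    qed
    then have "A \<subseteq> M" using A(2) by blast
    then show "r \<in> M" using finite_union[OF A(1)] A(3) r by (simp add: generated_pseudogroup_def)
  qed
  show "M \<subseteq> generated_pseudogroup X (full_maps X M)"
  proof
    fix r assume r: "r \<in> M"
    have "\<exists>g\<in>full_maps X M. \<exists>U. clopenin X U \<and> x \<in> U \<and> graph U g \<subseteq> r" if x: "x \<in> Domain r" for x
    proof -
      obtain y where xy: "(x, y) \<in> r" using x by blast
      then have X: "x \<in> topspace X" using in_topspace[OF r] by blast
      show ?thesis
      proof (cases "x = y")
        case False
        then show ?thesis using moving_element_extends[OF r xy] by metis
      next
        case True
        have "topspace X \<noteq> {}" using X by blast
        then obtain V where V: "clopenin X V" "V \<noteq> {}" "V \<subset> topspace X"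
          using cantor clopenin_topspace[of X] unfolding is_cantor_space_iff by metis
        obtain U where U: "clopenin X U" "U \<noteq> {}" "x \<notin> U"
        proof (cases "x \<in> V")
          case True
          then show thesis using that[OF clopenin_Diff[OF clopenin_topspace V(1)]] V(3) by blast
        next
          case False
          then show thesis using that V by blast
        qed
        obtain t u where t: "t \<in> M" "u \<in> U" "(x, u) \<in> t" using dense[OF X U(1,2)] by blast
        have xu: "x \<noteq> u" using t(2) U(3) by blast
        obtain g W where g: "g \<in> full_maps X M" "clopenin X W" "x \<in> W" "graph W g \<subseteq> t" "g x = u"
          using moving_element_extends[OF t(1,3) xu] .
        have "t\<inverse> O r \<in> M" "(u, x) \<in> t\<inverse> O r" using comp conv t r xy True by blast+
        then obtain h V where h: "h \<in> full_maps X M" "clopenin X V" "u \<in> V" "graph V h \<subseteq> t\<inverse> O r"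
          using moving_element_extends[of "t\<inverse> O r" u x] xu by metis
        let ?W = "W \<inter> {w \<in> topspace X. g w \<in> V}"
        have "clopenin X ?W" using clopenin_Int[OF g(2) G.clopenin_preimage[OF g(1) h(2)]] .
        moreover have "x \<in> ?W" using g(3,5) h(3) X by simp
        moreover have "graph ?W (compose (topspace X) h g) \<subseteq> r"
        proof (rule subrelI)
          fix a b assume "(a, b) \<in> graph ?W (compose (topspace X) h g)"
          then have "a \<in> W" "g a \<in> V" "b = h (g a)" by (auto simp: mem_graph_iff compose_def)
          then have "(a, g a) \<in> t" "(g a, b) \<in> t\<inverse> O r" using g(4) h(4) by (auto simp: graph_def)
          then obtain c where "(c, g a) \<in> t" "(c, b) \<in> r" by blast
          then show "(a, b) \<in> r" using partial_bijD(2)[OF pbij[OF t(1)] \<open>(a, g a) \<in> t\<close>] by blast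
        qed
        ultimately show ?thesis using G.compose_mem[OF h(1) g(1)] by blast
      qed
    qed
    then show "r \<in> generated_pseudogroup X (full_maps X M)"
      using pbij[OF r] clopen_Domain[OF r] clopen_Range[OF r] by (simp add: generated_pseudogroup_def)
  qed
qed

end

context pseudogroup_model
begin

text \<open>The elements whose domain consists of points with an orbit that meets \<open>U\<close> form a
  \<open>\<or>\<close>-ideal.\<close>

lemma zero_simplifying_imp_dense:
  assumes zs: "zero_simplifying S" and x: "x \<in> topspace X" and U: "clopenin X U" "U \<noteq> {}"
  shows "\<exists>r\<in>M. \<exists>u\<in>U. (x, u) \<in> r"
proof -
  define Q where "Q = {x. \<exists>r\<in>M. \<exists>u\<in>U. (x, u) \<in> r}"
  define I where "I = {s \<in> carrier S. dom s \<subseteq> Q}"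
  have "u \<in> Q" if "u \<in> U" for u
    using Id_on_iff[of U] U(1) that unfolding Q_def by (intro CollectI bexI[of _ "Id_on U"] bexI[of _ u]) auto
  then have "dom (idem U) \<subseteq> Q" using U(1) by (auto simp: dom_idem)
  then have IU: "idem U \<in> I" using idem_mem[OF U(1)] by (simp add: I_def idempotents_iff)
  have "vee_ideal S I"
    unfolding vee_ideal_def
  proof (intro conjI ballI allI impI)
    show "I \<noteq> {}" "I \<subseteq> carrier S" using IU by (auto simp: I_def)
    fix a s assume a: "a \<in> I" and s: "s \<in> carrier S"
    have aS: "a \<in> carrier S" and aQ: "dom a \<subseteq> Q" using a by (auto simp: I_def)
    have "dom (s \<otimes> a) \<subseteq> dom a" using aS s by (auto simp: dom_def rho_mult)
    then show "s \<otimes> a \<in> I" using aS s aQ by (auto simp: I_def)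
    have "dom (a \<otimes> s) \<subseteq> Q"
    proof
      fix z assume "z \<in> dom (a \<otimes> s)"
      then obtain y where "(z, y) \<in> \<rho> s" "y \<in> dom a" using aS s by (auto simp: dom_def rho_mult)
      moreover then obtain r u where "r \<in> M" "u \<in> U" "(y, u) \<in> r" using aQ unfolding Q_def by blast
      ultimately have "\<rho> s O r \<in> M" "(z, u) \<in> \<rho> s O r" "u \<in> U" using comp rho_mem[OF s] by blast+
      then show "z \<in> Q" unfolding Q_def by blast
    qed
    then show "a \<otimes> s \<in> I" using aS s by (simp add: I_def)
  next
    fix a b c assume "a \<in> I" "b \<in> I" "compatible S a b \<and> is_join S a b c"
    then have "c \<in> carrier S" "\<rho> c = \<rho> a \<union> \<rho> b" "dom a \<subseteq> Q" "dom b \<subseteq> Q"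
      using is_join_iff by (auto simp: I_def)
    then show "c \<in> I" by (auto simp: I_def dom_def)
  qed
  moreover have "I \<noteq> {zero_of S}"
  proof
    assume "I = {zero_of S}"
    then have "idem U = lift {}" using IU zero_of_eq by simp
    then have "Id_on U = {}" using rho_idem_of[OF U(1)] rho_lift[OF empty_mem] by simp
    then show False using U(2) by (auto simp: Id_on_def)
  qed
  ultimately have "\<one> \<in> I" using zs unfolding zero_simplifying_def by blast
  then have "x \<in> Q" using x dom_one by (auto simp: I_def)
  then show ?thesis by (simp add: Q_def)
qed

text \<open>A nonzero \<open>\<or>\<close>-ideal contains the identity of a nonempty clopen set \<open>U\<close>, hence the identities of
  the preimages of \<open>U\<close> under elements of \<open>M\<close>. These preimages cover the space when the orbits are
  dense, and by compactness the identity element is a finite join of identities of clopen subsets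
  of them.\<close>

lemma dense_imp_zero_simplifying:
  assumes dense: "\<And>x U. x \<in> topspace X \<Longrightarrow> clopenin X U \<Longrightarrow> U \<noteq> {} \<Longrightarrow> \<exists>r\<in>M. \<exists>u\<in>U. (x, u) \<in> r"
  shows "zero_simplifying S"
  unfolding zero_simplifying_def
proof (intro allI impI)
  fix I assume I: "vee_ideal S I"
  have sub: "I \<subseteq> carrier S" and ne: "I \<noteq> {}"
    and mult: "\<And>a s. a \<in> I \<Longrightarrow> s \<in> carrier S \<Longrightarrow> s \<otimes> a \<in> I \<and> a \<otimes> s \<in> I"
    and join: "\<And>a b c. a \<in> I \<Longrightarrow> b \<in> I \<Longrightarrow> compatible S a b \<Longrightarrow> is_join S a b c \<Longrightarrow> c \<in> I"
    using I unfolding vee_ideal_def by blast+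
  have zero: "lift {} \<in> I"
  proof -
    obtain a where a: "a \<in> I" using ne by blast
    have "\<rho> (lift {} \<otimes> a) = \<rho> (lift {})"
      using a sub lift_closed[OF empty_mem] rho_lift[OF empty_mem] by (auto simp: rho_mult)
    then have "lift {} \<otimes> a = lift {}" using rho_inject a sub lift_closed[OF empty_mem] by blast
    then show ?thesis using mult[OF a lift_closed[OF empty_mem]] by simp
  qed
  show "I = {zero_of S} \<or> I = carrier S"
  proof (cases "I = {lift {}}")
    case False
    then obtain a where a: "a \<in> I" "a \<noteq> lift {}" using zero by blast
    have aS: "a \<in> carrier S" using a sub by blast
    then have "\<rho> a \<noteq> {}" using a(2) rho_inject[OF aS lift_closed[OF empty_mem]] rho_lift[OF empty_mem] by simp
    then have Une: "dom a \<noteq> {}" by (auto simp: dom_def)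
    have Uc: "clopenin X (dom a)" using dom_clopen[OF aS] .
    have idem_eqI: "idem V = b" if "clopenin X V" "b \<in> carrier S" "\<rho> b = Id_on V" for V b
      using that rho_idem_of[OF that(1)] idem_mem[OF that(1)] rho_inject idempotents_iff by metis
    have "\<rho> a O (\<rho> a)\<inverse> = Id_on (dom a)"
      using partial_bijD(2)[OF rho_pbij[OF aS]] by (auto simp: dom_def)
    then have "idem (dom a) = star S a \<otimes> a"
      using star[OF aS] aS by (intro idem_eqI[OF Uc]) (simp_all add: rho_mult)
    then have IU: "idem (dom a) \<in> I" using mult[OF a(1)] star[OF aS] by simp
    let ?P = "\<lambda>V. clopenin X V \<and> idem V \<in> I"
    have "\<exists>n e. clopen_partition X n e \<and> (\<forall>i<n. ?P (e i))"
    proof (rule clopen_partition_of_local)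
      show "compact_space X" using stone by (simp add: is_stone_space_def)
      fix x assume "x \<in> topspace X"
      then obtain r u where r: "r \<in> M" "u \<in> dom a" "(x, u) \<in> r" using dense[OF _ Uc Une] by blast
      define s where "s = lift r"
      have s: "s \<in> carrier S" "\<rho> s = r" using r(1) lift_closed rho_lift by (auto simp: s_def)
      let ?b = "star S s \<otimes> idem (dom a) \<otimes> s"
      let ?V = "{x. \<exists>u\<in>dom a. (x, u) \<in> r}"
      have uS: "idem (dom a) \<in> carrier S" using IU sub by blast
      have "\<rho> ?b = r O (Id_on (dom a) O r\<inverse>)"
        using s star[OF s(1)] uS rho_idem_of[OF Uc] by (simp add: rho_mult)
      also have "\<dots> = Id_on ?V" using partial_bijD(2)[OF pbij[OF r(1)]] by auto
      finally have b: "\<rho> ?b = Id_on ?V" .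
      have bS: "?b \<in> carrier S" using s star[OF s(1)] uS by simp
      then have V: "clopenin X ?V" using rho_mem[OF bS] b Id_on_iff by simp
      have "?b \<in> I" using mult IU star[OF s(1)] s(1) by blast
      then have "idem ?V \<in> I" using idem_eqI[OF V bS b] by simp
      then show "\<exists>U. clopenin X U \<and> x \<in> U \<and> ?P U" using V r by blast
    next
      fix V W assume V: "?P V" and W: "clopenin X W" "W \<subseteq> V"
      have c: "idem V \<in> carrier S" "idem W \<in> carrier S" using V W idem_mem by (auto simp: idempotents_iff)
      have "Id_on V O Id_on W = Id_on W" using W(2) by auto
      then have "idem W = idem W \<otimes> idem V"
        using c V W by (intro idem_eqI) (simp_all add: rho_mult rho_idem_of)
      then show "?P W" using mult[of "idem V" "idem W"] V W c by simp
    qed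
    then obtain n e where e: "clopen_partition X n e" "\<And>i. i < n \<Longrightarrow> ?P (e i)" by blast
    have "?P (\<Union>i<k. e i)" if "k \<le> n" for k
      using that
    proof (induction k)
      case 0
      have "idem {} = lift {}"
        using rho_lift[OF empty_mem] lift_closed[OF empty_mem] by (intro idem_eqI) (simp_all add: clopenin_empty)
      then show ?case using zero clopenin_empty by simp
    next
      case (Suc k)
      let ?A = "\<Union>i<k. e i"
      have A: "clopenin X ?A" "idem ?A \<in> I" and B: "clopenin X (e k)" "idem (e k) \<in> I"
        using Suc e(2)[of k] by simp_all
      have eq: "(\<Union>i<Suc k. e i) = ?A \<union> e k" by (auto simp: lessThan_Suc)
      note AB = clopenin_Un[OF A(1) B(1)]
      have c: "idem ?A \<in> carrier S" "idem (e k) \<in> carrier S" "idem (?A \<union> e k) \<in> carrier S"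
        using idem_mem[OF A(1)] idem_mem[OF B(1)] idem_mem[OF AB] by (auto simp: idempotents_iff)
      have un: "Id_on (?A \<union> e k) = Id_on ?A \<union> Id_on (e k)" by auto
      have "is_join S (idem ?A) (idem (e k)) (idem (?A \<union> e k))"
        unfolding is_join_iff[OF c(1,2)] using c(3) rho_idem_of[OF A(1)] rho_idem_of[OF B(1)] rho_idem_of[OF AB] un
        by simp
      moreover have "compatible S (idem ?A) (idem (e k))"
        unfolding compatible_iff[OF c(1,2)] rho_idem_of[OF A(1)] rho_idem_of[OF B(1)]
        using partial_bij_Id_on[of "?A \<union> e k"] un by simp
      ultimately have "idem (?A \<union> e k) \<in> I" using join A(2) B(2) by blast
      then show ?case using eq AB by simp
    qed
    then have "idem (\<Union>i<n. e i) \<in> I" by simp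
    then have "idem (topspace X) \<in> I" using e(1) by (simp add: clopen_partition_def)
    moreover have "idem (topspace X) = \<one>" by (rule idem_eqI) (simp_all add: clopenin_topspace rho_one)
    ultimately have "\<one> \<in> I" by simp
    then have "carrier S \<subseteq> I" using mult[of "\<one>"] r_one by (metis subsetI)
    then show ?thesis using sub by blast
  qed (simp add: zero_of_eq)
qed

end

lemma (in minimal_cantor_group) dense_generated:
  assumes "x \<in> topspace X" "clopenin X U" "U \<noteq> {}"
  shows "\<exists>r\<in>generated_pseudogroup X G. \<exists>u\<in>U. (x, u) \<in> r"
proof -
  obtain u where u: "u \<in> U" using assms(3) by blast
  then have "u \<in> X closure_of {g x | g. g \<in> G}"
    unfolding dense_orbits[OF assms(1)] using clopenin_subset[OF assms(2)] by blast
  then obtain g where g: "g \<in> G" "g x \<in> U"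
    using u assms(2) unfolding in_closure_of clopenin_def by auto
  have "g \<in> full_maps X (generated_pseudogroup X G)" using g(1) by (simp only: full_maps_generated)
  then have gL: "graph (topspace X) g \<in> generated_pseudogroup X G" by (simp only: full_maps_def mem_Collect_eq)
  have "(x, g x) \<in> graph (topspace X) g" using assms(1) by (simp add: mem_graph_iff)
  then have "\<exists>u\<in>U. (x, u) \<in> graph (topspace X) g" using g(2) by (rule bexI)
  then show ?thesis using gL by (rule bexI)
qed

section \<open>Realization of the global maps as units\<close>

context pseudogroup_model
begin

sublocale B: boolean_lattice E by (rule boolean_lattice_idem_poset)

text \<open>The clopen neighbourhoods of \<open>x\<close>, read as idempotents. This is the canonical homeomorphism from a
  Stone space onto the Stone space of its clopen sets.\<close>

definition point_filter :: "'b \<Rightarrow> 'a set" where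
  "point_filter x = {e \<in> idempotents S. x \<in> dom e}"

lemma point_filter_ultra:
  assumes x: "x \<in> topspace X"
  shows "point_filter x \<in> ultrafilters E"
proof (rule B.ultrafilterI)
  show "proper_filter E (point_filter x)"
    unfolding proper_filter_def
  proof (intro conjI ballI impI)
    show "point_filter x \<subseteq> carrier E" by (auto simp: point_filter_def)
    show "point_filter x \<noteq> {}" using x one_idempotent dom_one by (auto simp: point_filter_def)
    show "\<bottom>\<^bsub>E\<^esub> \<notin> point_filter x" by (simp add: point_filter_def idem_poset_bounds dom_idem clopenin_empty)
    show "b \<in> point_filter x" if "a \<in> point_filter x" "b \<in> carrier E" "a \<sqsubseteq>\<^bsub>E\<^esub> b" for a b
      using that idem_poset_le[of a b] by (auto simp: point_filter_def)
    show "a \<sqinter>\<^bsub>E\<^esub> b \<in> point_filter x" if "a \<in> point_filter x" "b \<in> point_filter x" for a b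
      using that dom_mult[of a b] by (simp add: point_filter_def idem_poset_ops(2))
  qed
  fix a b assume "a \<in> carrier E" "b \<in> carrier E" "a \<squnion>\<^bsub>E\<^esub> b = \<top>\<^bsub>E\<^esub>"
  then have "a \<in> idempotents S" "b \<in> idempotents S" "dom a \<union> dom b = topspace X"
    using idem_poset_ops(3)[of a b] by (simp_all add: idem_poset_bounds dom_one)
  then show "a \<in> point_filter x \<or> b \<in> point_filter x" using x by (auto simp: point_filter_def)
qed

lemma ultrafilter_eq_point_filter:
  assumes F: "F \<in> ultrafilters E"
  shows "\<exists>x\<in>topspace X. F = point_filter x"
proof -
  note pf = ultrafilter_proper[OF F]
  have FE: "e \<in> idempotents S" if "e \<in> F" for e using B.proper_filterD(1)[OF pf] that by auto
  have one: "\<one> \<in> F" using B.proper_filter_top[OF pf] idem_poset_bounds by simp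
  have fin: "\<exists>e\<in>F. dom e \<subseteq> \<Inter>\<F>" if "finite \<F>" "\<F> \<subseteq> dom ` F" for \<F>
    using that
  proof (induction \<F>)
    case empty
    then show ?case using one by auto
  next
    case (insert D \<F>)
    then obtain e where e: "e \<in> F" "dom e \<subseteq> \<Inter>\<F>" by auto
    obtain d where d: "d \<in> F" "D = dom d" using insert.prems by auto
    have "d \<sqinter>\<^bsub>E\<^esub> e \<in> F" using B.proper_filterD(5)[OF pf] d(1) e(1) .
    moreover have "dom (d \<sqinter>\<^bsub>E\<^esub> e) \<subseteq> \<Inter>(insert D \<F>)"
      using idem_poset_ops(4)[OF FE[OF d(1)] FE[OF e(1)]] d(2) e(2) by auto
    ultimately show ?case by blast
  qed
  have fip: "\<Inter>\<F> \<noteq> {}" if \<F>: "finite \<F>" "\<F> \<subseteq> dom ` F" for \<F>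
  proof -
    obtain e where e: "e \<in> F" "dom e \<subseteq> \<Inter>\<F>" using fin[OF \<F>] by blast
    have "dom e \<noteq> {}"
    proof
      assume "dom e = {}"
      then have "e = \<bottom>\<^bsub>E\<^esub>" using idem_dom[OF FE[OF e(1)]] by (simp add: idem_poset_bounds)
      then show False using B.proper_filterD(3)[OF pf] e(1) by simp
    qed
    then show ?thesis using e(2) by blast
  qed
  have cl: "closedin X C" if "C \<in> dom ` F" for C
    using that dom_clopen FE by (auto simp: clopenin_def idempotents_iff)
  have "compact_space X" using stone by (simp add: is_stone_space_def)
  from this[unfolded compact_space_fip, rule_format, of "dom ` F"]
  have "\<Inter>(dom ` F) \<noteq> {}" using fip cl by presburger
  then obtain x where "x \<in> \<Inter>(dom ` F)" by (meson ex_in_conv)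
  then have x: "x \<in> dom e" if "e \<in> F" for e using that by (rule INT_D)
  have X: "x \<in> topspace X" using x[OF one] dom_one by simp
  have "F \<subseteq> point_filter x" unfolding point_filter_def using x FE by (intro subsetI CollectI conjI)
  then have "point_filter x = F"
    using F ultrafilter_proper[OF point_filter_ultra[OF X]] unfolding ultrafilters_def by simp
  then show ?thesis using X by blast
qed

theorem point_filter_homeomorphic: "homeomorphic_map X (stone_space E) point_filter"
proof (rule continuous_imp_homeomorphic_map)
  show "compact_space X" using stone by (simp add: is_stone_space_def)
  show "Hausdorff_space (stone_space E)" using B.is_stone_space_stone_space by (simp add: is_stone_space_def)
  show "point_filter ` topspace X = topspace (stone_space E)"
    using point_filter_ultra ultrafilter_eq_point_filter unfolding B.topspace_stone_space by blast
  show "inj_on point_filter (topspace X)"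
  proof (rule inj_onI, rule ccontr)
    fix x y assume xy: "x \<in> topspace X" "y \<in> topspace X" "point_filter x = point_filter y" "x \<noteq> y"
    obtain U where U: "clopenin X U" "x \<in> U" "y \<notin> U" using stone_space_separate[OF stone xy(1,2,4)] .
    then have "idem U \<in> point_filter x" "idem U \<notin> point_filter y"
      by (simp_all add: point_filter_def idem_mem dom_idem)
    then show False using xy(3) by simp
  qed
  show "continuous_map X (stone_space E) point_filter"
  proof (rule continuous_map_of_clopen_preimages[OF B.is_stone_space_stone_space])
    show "point_filter x \<in> topspace (stone_space E)" if "x \<in> topspace X" for x
      using point_filter_ultra[OF that] by (simp add: B.topspace_stone_space)
    fix V assume "clopenin (stone_space E) V"
    then obtain e where e: "e \<in> idempotents S" "V = basic_open E e" using B.clopenin_stone_space_iff by auto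
    have "{x \<in> topspace X. point_filter x \<in> V} = dom e"
      using e point_filter_ultra dom_subset[OF e(1)] by (auto simp: point_filter_def basic_open_def)
    then show "openin X {x \<in> topspace X. point_filter x \<in> V}"
      using dom_clopen e(1) by (simp add: clopenin_def idempotents_iff)
  qed
qed

lemma unit_iff: "u \<in> Units S \<longleftrightarrow> u \<in> carrier S \<and> Domain (\<rho> u) = topspace X \<and> Range (\<rho> u) = topspace X"
proof
  assume u: "u \<in> Units S"
  then have c: "u \<in> carrier S" "inv u \<in> carrier S" by (simp_all add: Units_closed)
  have "\<rho> (inv u) O \<rho> u = Id_on (topspace X)" "\<rho> u O \<rho> (inv u) = Id_on (topspace X)"
    using u c rho_mult[of u "inv u"] rho_mult[of "inv u" u] by (simp_all add: rho_one)
  then have "Id_on (topspace X) \<subseteq> \<rho> (inv u) O \<rho> u" "Id_on (topspace X) \<subseteq> \<rho> u O \<rho> (inv u)" by simp_all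
  then have "topspace X \<subseteq> Range (\<rho> u)" "topspace X \<subseteq> Domain (\<rho> u)" by blast+
  then show "u \<in> carrier S \<and> Domain (\<rho> u) = topspace X \<and> Range (\<rho> u) = topspace X"
    using c(1) clopenin_subset[OF clopen_Domain[OF rho_mem[OF c(1)]]] clopenin_subset[OF clopen_Range[OF rho_mem[OF c(1)]]]
    by blast
next
  assume u: "u \<in> carrier S \<and> Domain (\<rho> u) = topspace X \<and> Range (\<rho> u) = topspace X"
  then have c: "u \<in> carrier S" by simp
  note pb = partial_bijD[OF rho_pbij[OF c]]
  have "\<rho> u O (\<rho> u)\<inverse> = Id_on (topspace X)"
  proof -
    have "\<rho> u O (\<rho> u)\<inverse> = Id_on (Domain (\<rho> u))" using pb(2) by auto
    then show ?thesis using u by simp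
  qed
  moreover have "(\<rho> u)\<inverse> O \<rho> u = Id_on (topspace X)"
  proof -
    have "(\<rho> u)\<inverse> O \<rho> u = Id_on (Range (\<rho> u))" using pb(1) by auto
    then show ?thesis using u by simp
  qed
  ultimately have "\<rho> (star S u \<otimes> u) = \<rho> \<one>" "\<rho> (u \<otimes> star S u) = \<rho> \<one>"
    using star[OF c] c by (simp_all add: rho_mult rho_one)
  then have "star S u \<otimes> u = \<one>" "u \<otimes> star S u = \<one>"
    using rho_inject c star[OF c] by (metis m_closed one_closed)+
  then show "u \<in> Units S" using c star[OF c] by (auto simp: Units_def)
qed

text \<open>The homeomorphism is equivariant: \<open>u\<close> maps the filter of \<open>x\<close> to that of its image, because
  \<open>ueu\<^sup>\<star>\<close> is defined at \<open>g x\<close> exactly when \<open>e\<close> is defined at \<open>x\<close>.\<close>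

lemma natural_action_point_filter:
  assumes u: "u \<in> Units S" and g: "graph (topspace X) g = \<rho> u" and x: "x \<in> topspace X"
  shows "natural_action S u (point_filter x) = point_filter (g x)"
proof -
  have c: "u \<in> carrier S" "inv u \<in> carrier S" using u by (simp_all add: Units_closed)
  have iu: "\<rho> (inv u) = (\<rho> u)\<inverse>"
    using inverse_pair_iff[OF c, THEN iffD1] u c by simp
  have xg: "(x, y) \<in> \<rho> u \<longleftrightarrow> y = g x" for y
    using x by (simp add: g[symmetric] mem_graph_iff)
  interpret I: inverse_monoid S by (rule inverse_monoid_model)
  have su: "star S u = inv u" using rho_inject star[OF c(1)] c iu by metis
  have xu: "z = x" if "(z, g x) \<in> \<rho> u" for z
    using partial_bijD(2)[OF rho_pbij[OF c(1)] that] xg[of "g x"] by blast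
  have conj: "u \<otimes> e \<otimes> inv u \<in> idempotents S" "g x \<in> dom (u \<otimes> e \<otimes> inv u) \<longleftrightarrow> x \<in> dom e"
    if e: "e \<in> idempotents S" for e
  proof -
    have ec: "e \<in> carrier S" using e by (simp add: idempotents_iff)
    show "u \<otimes> e \<otimes> inv u \<in> idempotents S" using I.conj_idem'[OF c(1) e] su by simp
    have "\<rho> (u \<otimes> e \<otimes> inv u) = (\<rho> u)\<inverse> O (Id_on (dom e) O \<rho> u)"
      using c ec iu rho_idem[OF e] by (simp add: rho_mult)
    then have "g x \<in> dom (u \<otimes> e \<otimes> inv u) \<longleftrightarrow> (\<exists>z\<in>dom e. (z, g x) \<in> \<rho> u)"
      unfolding dom_def[of "u \<otimes> e \<otimes> inv u"] by auto
    also have "\<dots> \<longleftrightarrow> x \<in> dom e" using xu xg[of "g x"] by metis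
    finally show "g x \<in> dom (u \<otimes> e \<otimes> inv u) \<longleftrightarrow> x \<in> dom e" .
  qed
  have retract: "u \<otimes> (inv u \<otimes> e \<otimes> u) \<otimes> inv u = e" "inv u \<otimes> e \<otimes> u \<in> idempotents S"
    if e: "e \<in> idempotents S" for e
  proof -
    have ec: "e \<in> carrier S" using e by (simp add: idempotents_iff)
    have "u \<otimes> (inv u \<otimes> e \<otimes> u) \<otimes> inv u = (u \<otimes> inv u) \<otimes> e \<otimes> (u \<otimes> inv u)"
      using c ec by (simp only: m_assoc m_closed)
    then show "u \<otimes> (inv u \<otimes> e \<otimes> u) \<otimes> inv u = e" using u ec by simp
    show "inv u \<otimes> e \<otimes> u \<in> idempotents S" using I.conj_idem[OF c(1) e] su by simp
  qed
  have "natural_action S u (point_filter x) = (\<lambda>e. u \<otimes> e \<otimes> inv u) ` point_filter x"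
    using point_filter_ultra[OF x] by (simp add: natural_action_def)
  also have "\<dots> = point_filter (g x)"
  proof (intro equalityI subsetI)
    fix f assume "f \<in> (\<lambda>e. u \<otimes> e \<otimes> inv u) ` point_filter x"
    then show "f \<in> point_filter (g x)" using conj by (auto simp: point_filter_def)
  next
    fix f assume f: "f \<in> point_filter (g x)"
    then have fE: "f \<in> idempotents S" "g x \<in> dom f" by (auto simp: point_filter_def)
    have "x \<in> dom (inv u \<otimes> f \<otimes> u)" using conj(2)[OF retract(2)[OF fE(1)]] retract(1)[OF fE(1)] fE(2) by simp
    then have "inv u \<otimes> f \<otimes> u \<in> point_filter x" using retract(2)[OF fE(1)] by (simp add: point_filter_def)
    then show "f \<in> (\<lambda>e. u \<otimes> e \<otimes> inv u) ` point_filter x" using retract(1)[OF fE(1)] by (metis imageI)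
  qed
  finally show ?thesis .
qed

theorem occurs_full_maps:
  assumes "is_cantor_space X" "countable M"
  shows "occurs_as_units X (full_maps X M) S"
proof -
  interpret T: tarski_inverse_monoid S using tarski_inverse_monoid_model assms .
  have faithful: "naturally_faithful S" using T.naturally_faithful[OF fundamental_model] .
  note inj = homeomorphic_imp_injective_map[OF point_filter_homeomorphic]
  have im: "point_filter ` topspace X = ultrafilters E"
    using homeomorphic_imp_surjective_map[OF point_filter_homeomorphic] B.topspace_stone_space by simp
  have conj: "conjugate X (stone_space E) point_filter g = natural_action S u"
    if u: "u \<in> Units S" and g: "graph (topspace X) g = \<rho> u" for g u
  proof
    fix F
    show "conjugate X (stone_space E) point_filter g F = natural_action S u F"
    proof (cases "F \<in> ultrafilters E")
      case True
      then obtain x where x: "x \<in> topspace X" "F = point_filter x" using im by blast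
      then have "inv_into (topspace X) point_filter F = x" using inv_into_f_f[OF inj] by simp
      then show ?thesis
        using True natural_action_point_filter[OF u g x(1)] x(2)
        by (simp add: conjugate_def B.topspace_stone_space)
    next
      case False
      then show ?thesis by (simp add: conjugate_def natural_action_def B.topspace_stone_space)
    qed
  qed
  have "conjugate X (stone_space E) point_filter ` full_maps X M = unit_homeos S"
  proof
    show "conjugate X (stone_space E) point_filter ` full_maps X M \<subseteq> unit_homeos S"
    proof
      fix k assume "k \<in> conjugate X (stone_space E) point_filter ` full_maps X M"
      then obtain g where g: "g \<in> full_maps X M" "k = conjugate X (stone_space E) point_filter g" by blast
      let ?u = "lift (graph (topspace X) g)"
      have gM: "graph (topspace X) g \<in> M" using full_mapsD(2)[OF g(1)] .
      have "Domain (graph (topspace X) g) = topspace X" "Range (graph (topspace X) g) = g ` topspace X"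
        by (auto simp: graph_def)
      then have "?u \<in> Units S"
        unfolding unit_iff using lift_closed[OF gM] rho_lift[OF gM] full_mapsD(4)[OF g(1)] by simp
      then show "k \<in> unit_homeos S" using conj g(2) rho_lift[OF gM] by (auto simp: unit_homeos_def)
    qed
    show "unit_homeos S \<subseteq> conjugate X (stone_space E) point_filter ` full_maps X M"
    proof
      fix k assume "k \<in> unit_homeos S"
      then obtain u where u: "u \<in> Units S" "k = natural_action S u" by (auto simp: unit_homeos_def)
      then obtain g where "g \<in> full_maps X M" "graph (topspace X) g = \<rho> u"
        using total_full_map[of "\<rho> u"] rho_mem[of u] unfolding unit_iff by metis
      then show "k \<in> conjugate X (stone_space E) point_filter ` full_maps X M"
        using conj[OF u(1)] u(2) by (metis imageI)
    qed
  qed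
  with point_filter_homeomorphic have "cantor_group_iso X (full_maps X M) (stone_space E) (unit_homeos S)"
    unfolding cantor_group_iso_def by (intro exI conjI)
  with faithful show ?thesis unfolding occurs_as_units_def by (rule conjI)
qed

end

lemma countable_pseudogroup_nat_model:
  assumes "pseudogroup X M" "countable M"
  obtains S :: "nat monoid" and \<rho> where "pseudogroup_model X M S \<rho>"
proof -
  interpret pseudogroup X M by fact
  let ?c = "to_nat_on M"
  define d where "d = inv_into M ?c"
  have inj: "inj_on ?c M" using assms(2) by (rule inj_on_to_nat_on)
  have d: "d (?c r) = r" if "r \<in> M" for r unfolding d_def using inv_into_f_f[OF inj that] .
  define S :: "nat monoid" where
    "S = \<lparr>carrier = ?c ` M, mult = (\<lambda>a b. ?c (d b O d a)), one = ?c (Id_on (topspace X))\<rparr>"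
  have one: "Id_on (topspace X) \<in> M" using Id_on_iff clopenin_topspace by blast
  have unit: "Id_on (topspace X) O r = r" "r O Id_on (topspace X) = r" if "r \<in> M" for r
    using in_topspace[OF that] by auto
  have "monoid S"
  proof
    show "a \<otimes>\<^bsub>S\<^esub> b \<in> carrier S" if "a \<in> carrier S" "b \<in> carrier S" for a b
      using that comp d by (auto simp: S_def)
    show "a \<otimes>\<^bsub>S\<^esub> b \<otimes>\<^bsub>S\<^esub> c = a \<otimes>\<^bsub>S\<^esub> (b \<otimes>\<^bsub>S\<^esub> c)"
      if "a \<in> carrier S" "b \<in> carrier S" "c \<in> carrier S" for a b c
      using that comp d by (auto simp: S_def O_assoc)
    show "\<one>\<^bsub>S\<^esub> \<in> carrier S" using one by (simp add: S_def)
    show "\<one>\<^bsub>S\<^esub> \<otimes>\<^bsub>S\<^esub> a = a" "a \<otimes>\<^bsub>S\<^esub> \<one>\<^bsub>S\<^esub> = a" if "a \<in> carrier S" for a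
      using that one d unit by (auto simp: S_def)
  qed
  moreover have "pseudogroup_model_axioms X M S d"
  proof
    have "bij_betw ?c M (carrier S)" using inj by (simp add: bij_betw_def S_def)
    then show "bij_betw d (carrier S) M" unfolding d_def by (rule bij_betw_inv_into)
    show "d (a \<otimes>\<^bsub>S\<^esub> b) = d b O d a" if "a \<in> carrier S" "b \<in> carrier S" for a b
      using that comp d by (auto simp: S_def)
    show "d \<one>\<^bsub>S\<^esub> = Id_on (topspace X)" using one d by (simp add: S_def)
  qed
  ultimately show thesis using that[of S d] assms(1) by (simp add: pseudogroup_model_def)
qed

section \<open>Transport along a homeomorphism\<close>

text \<open>The construction of the generated pseudogroup is natural: conjugating the group by a
  homeomorphism \<open>\<theta>\<close> transports the relations by \<open>\<theta> \<times> \<theta>\<close>.\<close>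

lemma transport_generated:
  assumes h: "homeomorphic_map X Y \<theta>" and G: "G \<subseteq> Bij (topspace X)" and r: "r \<in> generated_pseudogroup X G"
  shows "map_prod \<theta> \<theta> ` r \<in> generated_pseudogroup Y (conjugate X Y \<theta> ` G)"
proof -
  have inj: "inj_on \<theta> (topspace X)" and im: "\<theta> ` topspace X = topspace Y"
    using homeomorphic_imp_injective_map[OF h] homeomorphic_imp_surjective_map[OF h] by auto
  have pb: "partial_bij r" and D: "clopenin X (Domain r)" and R: "clopenin X (Range r)"
    and loc: "\<And>x. x \<in> Domain r \<Longrightarrow> \<exists>g\<in>G. \<exists>U. clopenin X U \<and> x \<in> U \<and> graph U g \<subseteq> r"
    using r by (auto simp: generated_pseudogroup_def)
  have sub: "x \<in> topspace X \<and> y \<in> topspace X" if "(x, y) \<in> r" for x y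
    using that clopenin_subset[OF D] clopenin_subset[OF R] by blast
  let ?r = "map_prod \<theta> \<theta> ` r"
  have mem: "(\<theta> x, \<theta> y) \<in> ?r \<longleftrightarrow> (x, y) \<in> r" if "x \<in> topspace X" "y \<in> topspace X" for x y
  proof
    assume "(\<theta> x, \<theta> y) \<in> ?r"
    then obtain a b where "(a, b) \<in> r" "\<theta> a = \<theta> x" "\<theta> b = \<theta> y" by auto
    then show "(x, y) \<in> r" using sub that inj by (metis inj_onD)
  qed force
  have ex: "\<exists>x y. a = \<theta> x \<and> b = \<theta> y \<and> (x, y) \<in> r" if "(a, b) \<in> ?r" for a b using that by auto
  have "partial_bij ?r"
  proof (rule partial_bijI)
    fix a b c assume "(a, b) \<in> ?r" "(a, c) \<in> ?r"
    then obtain x y x' z where "a = \<theta> x" "b = \<theta> y" "(x, y) \<in> r" "a = \<theta> x'" "c = \<theta> z" "(x', z) \<in> r"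
      using ex by metis
    then show "b = c" using sub inj partial_bijD(1)[OF pb] by (metis inj_onD)
  next
    fix a b c assume "(b, a) \<in> ?r" "(c, a) \<in> ?r"
    then obtain x y x' z where "a = \<theta> x" "b = \<theta> y" "(y, x) \<in> r" "a = \<theta> x'" "c = \<theta> z" "(z, x') \<in> r"
      using ex by metis
    then show "b = c" using sub inj partial_bijD(2)[OF pb] by (metis inj_onD)
  qed
  moreover have "Domain ?r = \<theta> ` Domain r" "Range ?r = \<theta> ` Range r" by force+
  moreover have "clopenin Y (\<theta> ` Domain r)" "clopenin Y (\<theta> ` Range r)"
    using homeomorphic_map_clopenin[OF h] D R clopenin_subset by blast+
  moreover have "\<exists>k\<in>conjugate X Y \<theta> ` G. \<exists>V. clopenin Y V \<and> y \<in> V \<and> graph V k \<subseteq> ?r" if y: "y \<in> \<theta> ` Domain r" for y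
  proof -
    obtain x where x: "x \<in> Domain r" "y = \<theta> x" using y by blast
    then obtain g U where g: "g \<in> G" "clopenin X U" "x \<in> U" "graph U g \<subseteq> r" using loc by blast
    have UX: "U \<subseteq> topspace X" using clopenin_subset[OF g(2)] .
    have "graph (\<theta> ` U) (conjugate X Y \<theta> g) \<subseteq> ?r"
    proof (rule subrelI)
      fix a b assume "(a, b) \<in> graph (\<theta> ` U) (conjugate X Y \<theta> g)"
      then obtain u where u: "u \<in> U" "a = \<theta> u" "b = conjugate X Y \<theta> g (\<theta> u)" by (auto simp: mem_graph_iff)
      then have "u \<in> topspace X" "\<theta> u \<in> topspace Y" using UX im by blast+
      then have "b = \<theta> (g u)" using u(3) inv_into_f_f[OF inj] by (simp add: conjugate_def)
      moreover have "(u, g u) \<in> r" using u(1) g(4) by (auto simp: graph_def)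
      ultimately show "(a, b) \<in> ?r" using u(2) by force
    qed
    moreover have "clopenin Y (\<theta> ` U)" using homeomorphic_map_clopenin[OF h UX] g(2) by simp
    ultimately show ?thesis using g(1,3) x(2) by blast
  qed
  ultimately show ?thesis unfolding generated_pseudogroup_def by simp
qed

lemma conjugate_inverse:
  assumes "homeomorphic_maps X Y \<theta> \<eta>" and g: "g \<in> Bij (topspace X)"
  shows "conjugate Y X \<eta> (conjugate X Y \<theta> g) = g"
proof
  fix x
  have h: "homeomorphic_map X Y \<theta>" "homeomorphic_map Y X \<eta>" using assms(1) by (auto simp: homeomorphic_maps_map)
  have e: "\<And>x. x \<in> topspace X \<Longrightarrow> \<eta> (\<theta> x) = x" using assms(1) by (simp add: homeomorphic_maps_def)
  have i: "inj_on \<theta> (topspace X)" "\<theta> ` topspace X = topspace Y" "inj_on \<eta> (topspace Y)"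
    using h homeomorphic_imp_injective_map homeomorphic_imp_surjective_map by blast+
  show "conjugate Y X \<eta> (conjugate X Y \<theta> g) x = g x"
  proof (cases "x \<in> topspace X")
    case True
    have ty: "\<theta> x \<in> topspace Y" using i(2) True by blast
    have "inv_into (topspace Y) \<eta> x = \<theta> x" using inv_into_f_f[OF i(3) ty] e[OF True] by simp
    moreover have "inv_into (topspace X) \<theta> (\<theta> x) = x" using inv_into_f_f[OF i(1) True] .
    moreover have "g x \<in> topspace X" using g True by (auto simp: Bij_def bij_betw_def)
    ultimately show ?thesis using True ty e by (simp add: conjugate_def)
  next
    case False
    then show ?thesis using g by (auto simp: conjugate_def Bij_def extensional_def)
  qed
qed

lemma generated_pseudogroup_subset:
  assumes "r \<in> generated_pseudogroup X G"
  shows "r \<subseteq> topspace X \<times> topspace X"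
proof -
  have "clopenin X (Domain r)" "clopenin X (Range r)" using assms by (simp_all add: generated_pseudogroup_def)
  then have "Domain r \<subseteq> topspace X" "Range r \<subseteq> topspace X" using clopenin_subset by blast+
  then show ?thesis by auto
qed

lemma transport_generated_bij:
  assumes h: "homeomorphic_map X Y \<theta>" and G: "G \<subseteq> Bij (topspace X)"
    and H: "conjugate X Y \<theta> ` G = H" "H \<subseteq> Bij (topspace Y)"
  shows "bij_betw (image (map_prod \<theta> \<theta>)) (generated_pseudogroup X G) (generated_pseudogroup Y H)"
proof -
  obtain \<eta> where m: "homeomorphic_maps X Y \<theta> \<eta>" using h homeomorphic_map_maps by blast
  have e: "\<And>x. x \<in> topspace X \<Longrightarrow> \<eta> (\<theta> x) = x" "\<And>y. y \<in> topspace Y \<Longrightarrow> \<theta> (\<eta> y) = y"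
    using m by (simp_all add: homeomorphic_maps_def)
  have h': "homeomorphic_map Y X \<eta>" using m by (simp add: homeomorphic_maps_map)
  have G': "conjugate Y X \<eta> ` H = G"
    using conjugate_inverse[OF m] G unfolding H(1)[symmetric] by (force simp: image_image)
  have id1: "map_prod \<eta> \<eta> ` map_prod \<theta> \<theta> ` r = r" if "r \<subseteq> topspace X \<times> topspace X" for r
  proof -
    have "map_prod \<eta> \<eta> (map_prod \<theta> \<theta> p) = p" if "p \<in> r" for p
      using that \<open>r \<subseteq> topspace X \<times> topspace X\<close> e(1) by (cases p) auto
    then show ?thesis by (force simp: image_image)
  qed
  have id2: "map_prod \<theta> \<theta> ` map_prod \<eta> \<eta> ` r = r" if "r \<subseteq> topspace Y \<times> topspace Y" for r
  proof -
    have "map_prod \<theta> \<theta> (map_prod \<eta> \<eta> p) = p" if "p \<in> r" for p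
      using that \<open>r \<subseteq> topspace Y \<times> topspace Y\<close> e(2) by (cases p) auto
    then show ?thesis by (force simp: image_image)
  qed
  show ?thesis
  proof (rule bij_betwI[where g="image (map_prod \<eta> \<eta>)"])
    show "image (map_prod \<theta> \<theta>) \<in> generated_pseudogroup X G \<rightarrow> generated_pseudogroup Y H"
      using transport_generated[OF h G] H(1) by blast
    show "image (map_prod \<eta> \<eta>) \<in> generated_pseudogroup Y H \<rightarrow> generated_pseudogroup X G"
      using transport_generated[OF h' H(2)] G' by blast
    show "map_prod \<eta> \<eta> ` map_prod \<theta> \<theta> ` r = r" if "r \<in> generated_pseudogroup X G" for r
      using id1[OF generated_pseudogroup_subset[OF that]] .
    show "map_prod \<theta> \<theta> ` map_prod \<eta> \<eta> ` r = r" if "r \<in> generated_pseudogroup Y H" for r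
      using id2[OF generated_pseudogroup_subset[OF that]] .
  qed
qed

lemma transport_relcomp:
  assumes "inj_on \<theta> A" "r \<subseteq> A \<times> A" "s \<subseteq> A \<times> A"
  shows "map_prod \<theta> \<theta> ` (r O s) = map_prod \<theta> \<theta> ` r O map_prod \<theta> \<theta> ` s"
proof
  show "map_prod \<theta> \<theta> ` (r O s) \<subseteq> map_prod \<theta> \<theta> ` r O map_prod \<theta> \<theta> ` s" by force
  show "map_prod \<theta> \<theta> ` r O map_prod \<theta> \<theta> ` s \<subseteq> map_prod \<theta> \<theta> ` (r O s)"
  proof (rule subrelI)
    fix a b assume "(a, b) \<in> map_prod \<theta> \<theta> ` r O map_prod \<theta> \<theta> ` s"
    then obtain x y y' z where p: "a = \<theta> x" "(x, y) \<in> r" "\<theta> y = \<theta> y'" "(y', z) \<in> s" "b = \<theta> z" by auto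
    then have "y = y'" using assms by (meson inj_onD mem_Sigma_iff subsetD)
    then have "(x, z) \<in> r O s" using p by blast
    then show "(a, b) \<in> map_prod \<theta> \<theta> ` (r O s)" using p by force
  qed
qed

lemma models_isomorphic:
  assumes S: "pseudogroup_model X M S \<rho>" and T: "pseudogroup_model Y N T \<sigma>"
    and bij: "bij_betw \<phi> M N" and hom: "\<And>r s. r \<in> M \<Longrightarrow> s \<in> M \<Longrightarrow> \<phi> (r O s) = \<phi> r O \<phi> s"
  shows "T \<cong> S"
proof -
  interpret S: pseudogroup_model X M S \<rho> by fact
  interpret T: pseudogroup_model Y N T \<sigma> by fact
  define \<psi> where "\<psi> = inv_into M \<phi>"
  have psi: "\<And>p. p \<in> N \<Longrightarrow> \<psi> p \<in> M" "\<And>p. p \<in> N \<Longrightarrow> \<phi> (\<psi> p) = p" "\<And>r. r \<in> M \<Longrightarrow> \<psi> (\<phi> r) = r"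
    using bij bij_betw_inv_into_left[OF bij] bij_betw_inv_into_right[OF bij] bij_betw_inv_into[OF bij]
    unfolding \<psi>_def by (auto simp: bij_betw_def)
  have psi_comp: "\<psi> (p O q) = \<psi> p O \<psi> q" if "p \<in> N" "q \<in> N" for p q
    using hom[of "\<psi> p" "\<psi> q"] psi that S.comp by metis
  let ?h = "\<lambda>t. S.lift (\<psi> (\<sigma> t))"
  have "bij_betw ?h (carrier T) (carrier S)"
  proof -
    have "bij_betw \<psi> N M" unfolding \<psi>_def using bij by (rule bij_betw_inv_into)
    moreover have "bij_betw S.lift M (carrier S)"
      using bij_betw_inv_into[OF S.rho_bij] by (rule bij_betw_cong[THEN iffD1, rotated]) (simp add: S.lift_def)
    ultimately have "bij_betw (S.lift \<circ> \<psi> \<circ> \<sigma>) (carrier T) (carrier S)"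
      using T.rho_bij by (metis bij_betw_trans comp_assoc)
    then show ?thesis by (simp add: comp_def)
  qed
  moreover have "?h \<in> hom T S"
  proof (rule homI)
    show "?h t \<in> carrier S" if "t \<in> carrier T" for t
      using S.lift_closed psi(1) T.rho_mem that by blast
    fix t u assume t: "t \<in> carrier T" and u: "u \<in> carrier T"
    note m = psi(1)[OF T.rho_mem[OF t]] psi(1)[OF T.rho_mem[OF u]]
    have "\<rho> (?h (t \<otimes>\<^bsub>T\<^esub> u)) = \<psi> (\<sigma> u) O \<psi> (\<sigma> t)"
      using t u m S.rho_lift S.comp[OF m(2,1)] by (simp add: T.rho_mult psi_comp T.rho_mem)
    also have "\<dots> = \<rho> (?h t \<otimes>\<^bsub>S\<^esub> ?h u)" using m S.lift_closed S.rho_lift by (simp add: S.rho_mult)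
    finally show "?h (t \<otimes>\<^bsub>T\<^esub> u) = ?h t \<otimes>\<^bsub>S\<^esub> ?h u"
      using S.rho_inject S.lift_closed m t u psi(1) T.rho_mem by (metis S.m_closed T.m_closed)
  qed
  ultimately show ?thesis unfolding is_iso_def iso_def by blast
qed

section \<open>The correspondence\<close>

lemma zero_simplifying_dense_pseudogroup:
  assumes "tarski_inverse_monoid S" "fundamental S" "zero_simplifying S"
  shows "dense_pseudogroup (stone_space (idem_poset S)) (stone_rep S ` carrier S)"
proof -
  interpret T: tarski_inverse_monoid S by fact
  interpret m: pseudogroup_model "stone_space (idem_poset S)" "stone_rep S ` carrier S" S "stone_rep S"
    using T.stone_rep_model[OF assms(2)] .
  show ?thesis
  proof
    show "is_cantor_space (stone_space (idem_poset S))" by (rule T.stone_space_cantor)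
    show "countable (stone_rep S ` carrier S)" using T.countable_monoid by simp
    show "\<exists>r\<in>stone_rep S ` carrier S. \<exists>u\<in>U. (x, u) \<in> r"
      if "x \<in> topspace (stone_space (idem_poset S))" "clopenin (stone_space (idem_poset S)) U" "U \<noteq> {}" for x U
      using m.zero_simplifying_imp_dense[OF assms(3) that] .
  qed
qed

lemma zero_simplifying_minimal_units:
  assumes "tarski_inverse_monoid S" "fundamental S" "zero_simplifying S"
  shows "minimal_cantor_group (stone_space (idem_poset S)) (unit_homeos S)"
  using dense_pseudogroup.minimal_full_maps[OF zero_simplifying_dense_pseudogroup[OF assms]]
    tarski_inverse_monoid.unit_homeos_eq_full_maps[OF assms(1,2)] by simp

lemma cantor_group_realization:
  assumes "cantor_group X G"
  obtains S :: "nat monoid" and \<rho> where "pseudogroup_model X (generated_pseudogroup X G) S \<rho>"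
    "tarski_inverse_monoid S" "fundamental S" "occurs_as_units X G S"
proof -
  interpret cantor_group X G by fact
  obtain S :: "nat monoid" and \<rho> where m: "pseudogroup_model X (generated_pseudogroup X G) S \<rho>"
    using countable_pseudogroup_nat_model[OF pseudogroup_generated countable_generated_pseudogroup] .
  interpret m: pseudogroup_model X "generated_pseudogroup X G" S \<rho> by fact
  show thesis
    using that[OF m m.tarski_inverse_monoid_model m.fundamental_model] m.occurs_full_maps
      cantor countable_generated_pseudogroup full_maps_generated by simp
qed

text \<open>Such a monoid \<open>T\<close> is isomorphic to the pseudogroup that its units generate on the Stone space
  (\<open>generated_full_maps\<close>), and the homeomorphism that conjugates \<open>G\<close> to the group of units carries the
  pseudogroup generated by \<open>G\<close> to that one.\<close>

lemma zero_simplifying_unique: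
  assumes S: "pseudogroup_model X (generated_pseudogroup X G) S \<rho>" and G: "cantor_group X G"
    and T: "tarski_inverse_monoid T" "fundamental T" "zero_simplifying T" "occurs_as_units X G T"
  shows "T \<cong> S"
proof -
  interpret G: cantor_group X G by fact
  interpret T: tarski_inverse_monoid T by fact
  let ?Y = "stone_space (idem_poset T)" and ?N = "stone_rep T ` carrier T"
  interpret N: dense_pseudogroup ?Y ?N using zero_simplifying_dense_pseudogroup[OF T(1-3)] .
  have uh: "unit_homeos T = full_maps ?Y ?N" using T.unit_homeos_eq_full_maps[OF T(2)] .
  obtain \<theta> where \<theta>: "homeomorphic_map X ?Y \<theta>" "conjugate X ?Y \<theta> ` G = full_maps ?Y ?N"
    using T(4) uh unfolding occurs_as_units_def cantor_group_iso_def by auto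
  have GB: "G \<subseteq> Bij (topspace X)" using G.element(1) by blast
  have HB: "full_maps ?Y ?N \<subseteq> Bij (topspace ?Y)" using N.full_mapsD(1) by blast
  have bij: "bij_betw (image (map_prod \<theta> \<theta>)) (generated_pseudogroup X G) ?N"
    using transport_generated_bij[OF \<theta>(1) GB \<theta>(2) HB] N.generated_full_maps by simp
  show ?thesis
  proof (rule models_isomorphic[OF S T.stone_rep_model[OF T(2)] bij])
    fix r s assume "r \<in> generated_pseudogroup X G" "s \<in> generated_pseudogroup X G"
    then show "map_prod \<theta> \<theta> ` (r O s) = map_prod \<theta> \<theta> ` r O map_prod \<theta> \<theta> ` s"
      using generated_pseudogroup_subset by (intro transport_relcomp[OF homeomorphic_imp_injective_map[OF \<theta>(1)]])
  qed
qed

lemma minimal_cantor_group_realization: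
  assumes "minimal_cantor_group X G"
  obtains S :: "nat monoid" and \<rho> where "pseudogroup_model X (generated_pseudogroup X G) S \<rho>"
    "tarski_inverse_monoid S" "fundamental S" "zero_simplifying S" "occurs_as_units X G S"
proof -
  interpret minimal_cantor_group X G by fact
  obtain S :: "nat monoid" and \<rho> where m: "pseudogroup_model X (generated_pseudogroup X G) S \<rho>"
      "tarski_inverse_monoid S" "fundamental S" "occurs_as_units X G S"
    using cantor_group_realization[OF cantor_group_axioms] .
  have "zero_simplifying S" using pseudogroup_model.dense_imp_zero_simplifying[OF m(1)] dense_generated by blast
  then show thesis using that m by blast
qed

theorem theorem2p21:
  shows
    "(\<forall>S :: 'a monoid. tarski_inverse_monoid S \<and> fundamental S \<longrightarrow>
        naturally_faithful S \<and> cantor_group (stone_space (idem_poset S)) (unit_homeos S)) \<and>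
     (\<forall>(X :: 'b topology) G. cantor_group X G \<longrightarrow>
        (\<exists>S :: nat monoid. tarski_inverse_monoid S \<and> fundamental S \<and> occurs_as_units X G S)) \<and>
     (\<forall>S :: 'a monoid. tarski_inverse_monoid S \<and> fundamental S \<and> zero_simplifying S \<longrightarrow>
        naturally_faithful S \<and>
        minimal_cantor_group (stone_space (idem_poset S)) (unit_homeos S)) \<and>
     (\<forall>(X :: 'b topology) G. minimal_cantor_group X G \<longrightarrow>
        (\<exists>S :: nat monoid.
           tarski_inverse_monoid S \<and> fundamental S \<and> zero_simplifying S \<and>
           occurs_as_units X G S \<and>
           (\<forall>T :: 'c monoid.
              tarski_inverse_monoid T \<and> fundamental T \<and> zero_simplifying T \<and>
              occurs_as_units X G T \<longrightarrow> T \<cong> S)))"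
proof (intro conjI allI impI; (elim conjE)?)
  fix S :: "'a monoid" assume S: "tarski_inverse_monoid S" "fundamental S"
  show "naturally_faithful S" using tarski_inverse_monoid.naturally_faithful[OF S] .
  then show "naturally_faithful S" .
  show "cantor_group (stone_space (idem_poset S)) (unit_homeos S)"
    using tarski_inverse_monoid.unit_homeos_cantor_group[OF S] .
  show "minimal_cantor_group (stone_space (idem_poset S)) (unit_homeos S)" if "zero_simplifying S"
    using zero_simplifying_minimal_units[OF S that] .
next
  fix X :: "'b topology" and G assume "cantor_group X G"
  then show "\<exists>S :: nat monoid. tarski_inverse_monoid S \<and> fundamental S \<and> occurs_as_units X G S"
    using cantor_group_realization by metis
next
  fix X :: "'b topology" and G assume m: "minimal_cantor_group X G"
  then have G: "cantor_group X G" by (rule minimal_cantor_group.axioms(1))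
  obtain S :: "nat monoid" and \<rho> where S: "pseudogroup_model X (generated_pseudogroup X G) S \<rho>"
      "tarski_inverse_monoid S" "fundamental S" "zero_simplifying S" "occurs_as_units X G S"
    using minimal_cantor_group_realization[OF m] .
  moreover have "T \<cong> S"
    if "tarski_inverse_monoid T" "fundamental T" "zero_simplifying T" "occurs_as_units X G T"
    for T :: "'c monoid"
    using zero_simplifying_unique[OF S(1) G that] .
  ultimately show "\<exists>S :: nat monoid.
           tarski_inverse_monoid S \<and> fundamental S \<and> zero_simplifying S \<and>
           occurs_as_units X G S \<and>
           (\<forall>T :: 'c monoid.
              tarski_inverse_monoid T \<and> fundamental T \<and> zero_simplifying T \<and>
              occurs_as_units X G T \<longrightarrow> T \<cong> S)" by blast
qed

end
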